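(* Assume $(\mathrm{A}_1)$–$(\mathrm{A}_4)$ (stated in the context). Suppose that $f\in L^2(\Omega^\varepsilon)$ and $\alpha<0$. Let $u_\varepsilon\in\widetilde{\mathcal{W}}_\varepsilon$ be the unique weak solution of $$\nabla\cdot(-\mathbf{A}(x/\varepsilon)\nabla u_\varepsilon)+\varepsilon^\alpha\mathcal{R}(u_\varepsilon)=f\ \text{in }\Omega^\varepsilon,\qquad-\mathbf{A}(x/\varepsilon)\nabla u_\varepsilon\cdot\mathrm{n}=0\ \text{on }\Gamma^\varepsilon,\qquad u_\varepsilon=0\ \text{on }\Gamma^{\mathrm{ext}}.$$ Then there is a constant $C$ independent of $\varepsilon$ such that $$\|u_\varepsilon\|_{L^2(\Omega^\varepsilon)}+\sqrt{\varepsilon}\,\|u_\varepsilon\|_{L^2(\Gamma^\varepsilon)}\le C\left(\varepsilon^{-\frac{\alpha}{2}}+\varepsilon\right).$$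
   Context: Geometry. $\Omega\subset\mathbb{R}^d$ is a bounded, open, connected domain with Lipschitz boundary $\partial\Omega=\Gamma^{\mathrm{ext}}$. $Y=(0,1)^d$ is the unit cell; $Y_l,Y_s$ are disjoint open subsets of $Y$ with $\bar Y_l\cup\bar Y_s=\bar Y$, $\bar Y_l\cap\bar Y_s=\Gamma$ of non-zero $(d-1)$-dimensional measure; $Y_s$ lies totally inside $Y$ (it does not meet $\partial Y$) and $Y_l$ is connected. For $k\in\mathbb{Z}^d$, $X^k:=X+\sum_i k_i\vec e_i$. For a small parameter $0<\varepsilon\ll1$, $\Omega$ is completely covered by the $\varepsilon$-scaled cells $\varepsilon Y^k$; $\Omega_0^\varepsilon$ is the union of the solid parts $\varepsilon Y_s^k$, $\Omega^\varepsilon$ is the union of the liquid parts $\varepsilon Y_l^k$ of these cells, and $\Gamma^\varepsilon:=\partial\Omega_0^\varepsilon$. $\Omega^\varepsilon$ is bounded, connected and has $C^2$ internal boundary $\Gamma^\varepsilon$; $\mathrm{n}$ is the unit outward normal on $\Gamma^\varepsilon$. Spaces and weak solutions. $V^\varepsilon:=\{v\in H^1(\Omega^\varepsilon):v=0\text{ on }\Gamma^{\mathrm{ext}}\}$. For this problem (zero flux on $\Gamma^\varepsilon$) $\widetilde{\mathcal{W}}_\varepsilon$ consists of the functions of $V^\varepsilon$, with norm $\|u\|_{\widetilde{\mathcal{W}}_\varepsilon}^2=\|\nabla u\|_{L^2(\Omega^\varepsilon)}^2+\varepsilon^\alpha\|u\|_{L^2(\Omega^\varepsilon)}^2$. A weak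 solution is $u_\varepsilon\in\widetilde{\mathcal{W}}_\varepsilon$ with $\int_{\Omega^\varepsilon}\mathbf{A}(x/\varepsilon)\nabla u_\varepsilon\cdot\nabla\varphi\,dx+\varepsilon^\alpha\langle\mathcal{R}(u_\varepsilon),\varphi\rangle_{L^2(\Omega^\varepsilon)}=\langle f,\varphi\rangle_{L^2(\Omega^\varepsilon)}$ for all $\varphi\in\widetilde{\mathcal{W}}_\varepsilon$. Assumptions. $(\mathrm{A}_1)$: $\mathbf{A}\in L^\infty(\mathbb{R}^d)$ (matrix-valued, $d\times d$) is $Y$-periodic and symmetric, and there are constants $\underline\gamma,\overline\gamma>0$ independent of $\varepsilon$ with $\underline\gamma|\xi|^2\le\sum_{i,j}\mathbf{A}_{ij}(y)\xi_i\xi_j\le\overline\gamma|\xi|^2$ for all $\xi\in\mathbb{R}^d$. $(\mathrm{A}_2)$: the reaction functions $\mathcal{S},\mathcal{R}:\mathbb{R}\to\mathbb{R}$ are Carathéodory and globally Lipschitz ($\mathcal{S}$ does not occur in this problem). $(\mathrm{A}_3)$: there are constants $\delta_0,\delta_1>0$ independent of $\varepsilon$ with $0<\delta_0\le\mathcal{S}',\mathcal{R}'\le\delta_1$ a.e. in $\mathbb{R}$. $(\mathrm{A}_4)$: $f$ is a smooth function in $\Omega$.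
   Formalization: The formal theorem additionally assumes R(0)=0; without it the estimate fails (e.g. A = identity, R(s)=s+1, f=0 gives u_ε → -1 in L² as ε → 0, while the right-hand side tends to 0). *)

theory Defs
  imports "HOL-Analysis.Analysis"
begin

section \<open>Functions of class $C^k$\<close>

text \<open>Intended for open \<open>S\<close>: all iterated partial derivatives up to order \<open>k\<close> exist and are
  continuous on \<open>S\<close>.\<close>

primrec Ck_on :: "nat \<Rightarrow> 'a::euclidean_space set \<Rightarrow> ('a \<Rightarrow> real) \<Rightarrow> bool" where
  "Ck_on 0 S f \<longleftrightarrow> continuous_on S f"
| "Ck_on (Suc k) S f \<longleftrightarrow>
     f differentiable_on S \<and> (\<forall>i\<in>Basis. Ck_on k S (\<lambda>x. frechet_derivative f (at x) i))"

definition smooth_on :: "'a::euclidean_space set \<Rightarrow> ('a \<Rightarrow> real) \<Rightarrow> bool" where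
  "smooth_on S f \<longleftrightarrow> (\<forall>k. Ck_on k S f)"

definition grad :: "(real^'n \<Rightarrow> real) \<Rightarrow> real^'n \<Rightarrow> real^'n" where
  "grad f x = (\<chi> i. frechet_derivative f (at x) (axis i 1))"

definition test_function :: "(real^'n) set \<Rightarrow> (real^'n \<Rightarrow> real) \<Rightarrow> bool" where
  "test_function U \<phi> \<longleftrightarrow>
     smooth_on UNIV \<phi> \<and> compact (closure {x. \<phi> x \<noteq> 0}) \<and> closure {x. \<phi> x \<noteq> 0} \<subseteq> U"


section \<open>Regularity of boundaries\<close>

text \<open>Near \<open>x0\<close> the set \<open>U\<close> is, in an orthonormal frame centred at \<open>x0\<close> whose last vector is \<open>e\<close>,
  the part lying strictly above the graph of a function \<open>g\<close> on the hyperplane orthogonal to \<open>e\<close>.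
  The function \<open>g\<close> is defined on a full ball, but only its values on the hyperplane matter;
  a function on the hyperplane extends with the same regularity by being constant along \<open>e\<close>.
  The predicate \<open>reg\<close> is the regularity required of \<open>g\<close>.\<close>

definition graph_boundary_at ::
  "((real^'n) set \<Rightarrow> (real^'n \<Rightarrow> real) \<Rightarrow> bool) \<Rightarrow> (real^'n) set \<Rightarrow> real^'n \<Rightarrow> bool" where
  "graph_boundary_at reg U x0 \<longleftrightarrow>
     (\<exists>e r g. norm e = 1 \<and> 0 < r \<and> reg (ball 0 r) g \<and>
        (\<forall>y\<in>ball x0 r.
           y \<in> U \<longleftrightarrow> g ((y - x0) - ((y - x0) \<bullet> e) *\<^sub>R e) < (y - x0) \<bullet> e))"

definition lipschitz_boundary :: "(real^'n) set \<Rightarrow> bool" where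
  "lipschitz_boundary U \<longleftrightarrow>
     (\<forall>x0\<in>frontier U. graph_boundary_at (\<lambda>S g. \<exists>L. L-lipschitz_on S g) U x0)"

text \<open>The portion \<open>\<Gamma>\<close> of the boundary of \<open>U\<close> is of class $C^2$.\<close>

definition C2_boundary_part :: "(real^'n) set \<Rightarrow> (real^'n) set \<Rightarrow> bool" where
  "C2_boundary_part U \<Gamma> \<longleftrightarrow> (\<forall>x0\<in>\<Gamma>. graph_boundary_at (Ck_on 2) U x0)"


section \<open>Surface measure\<close>

text \<open>Hausdorff measure of dimension \<open>s\<close>, normalised to agree with Lebesgue measure when \<open>s\<close> is
  the dimension of the space. It is a metric outer measure, hence countably
  additive on the Borel sets by Caratheodory's criterion.\<close>

definition hausdorff_gauge :: "nat \<Rightarrow> 'a::metric_space set \<Rightarrow> ennreal" where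
  "hausdorff_gauge s E =
     (if E = {} then 0 else ennreal (unit_ball_vol (real s) * (diameter E / 2) ^ s))"

definition hausdorff_outer :: "nat \<Rightarrow> 'a::metric_space set \<Rightarrow> ennreal" where
  "hausdorff_outer s E =
     (SUP \<delta>\<in>{0<..}.
        INF C\<in>{C :: nat \<Rightarrow> 'a set. E \<subseteq> (\<Union>i. C i) \<and> (\<forall>i. bounded (C i) \<and> diameter (C i) \<le> \<delta>)}.
          (\<Sum>i. hausdorff_gauge s (C i)))"

definition hausdorff_measure :: "nat \<Rightarrow> 'a::metric_space measure" where
  "hausdorff_measure s = measure_of UNIV (sets borel) (hausdorff_outer s)"

definition surface_measure :: "(real^'n) measure" where
  "surface_measure = hausdorff_measure (CARD('n) - 1)"

definition surface_on :: "(real^'n) set \<Rightarrow> (real^'n) measure" where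
  "surface_on \<Gamma> = restrict_space surface_measure \<Gamma>"


section \<open>Lebesgue and Sobolev spaces\<close>

definition in_L2 :: "'a measure \<Rightarrow> ('a \<Rightarrow> 'b::euclidean_space) \<Rightarrow> bool" where
  "in_L2 M f \<longleftrightarrow> f \<in> borel_measurable M \<and> integrable M (\<lambda>x. (norm (f x))\<^sup>2)"

definition norm_L2 :: "'a measure \<Rightarrow> ('a \<Rightarrow> 'b::euclidean_space) \<Rightarrow> real" where
  "norm_L2 M f = sqrt (\<integral>x. (norm (f x))\<^sup>2 \<partial>M)"

definition L2_converges ::
  "'a measure \<Rightarrow> (nat \<Rightarrow> 'a \<Rightarrow> 'b::euclidean_space) \<Rightarrow> ('a \<Rightarrow> 'b) \<Rightarrow> bool" where
  "L2_converges M w u \<longleftrightarrow>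
     (\<lambda>k. \<integral>\<^sup>+x. ennreal ((norm (w k x - u x))\<^sup>2) \<partial>M) \<longlonglongrightarrow> 0"

definition has_weak_gradient ::
  "(real^'n) set \<Rightarrow> (real^'n \<Rightarrow> real) \<Rightarrow> (real^'n \<Rightarrow> real^'n) \<Rightarrow> bool" where
  "has_weak_gradient U u G \<longleftrightarrow> in_L2 (lebesgue_on U) G \<and>
     (\<forall>\<phi>. test_function U \<phi> \<longrightarrow>
        (\<forall>i. (\<integral>x. u x * grad \<phi> x $ i \<partial>lebesgue_on U) = - (\<integral>x. G x $ i * \<phi> x \<partial>lebesgue_on U)))"

definition in_H1 :: "(real^'n) set \<Rightarrow> (real^'n \<Rightarrow> real) \<Rightarrow> bool" where
  "in_H1 U u \<longleftrightarrow> in_L2 (lebesgue_on U) u \<and> (\<exists>G. has_weak_gradient U u G)"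

text \<open>The weak gradient is unique up to null sets; this picks a representative.\<close>

definition weak_gradient :: "(real^'n) set \<Rightarrow> (real^'n \<Rightarrow> real) \<Rightarrow> real^'n \<Rightarrow> real^'n" where
  "weak_gradient U u = (SOME G. has_weak_gradient U u G)"

text \<open>Trace of \<open>u\<close> on \<open>\<Gamma> \<subseteq> frontier U\<close>: the $L^2(\Gamma)$-limit of the restrictions of functions
  smooth up to the boundary that converge to \<open>u\<close> in $H^1(U)$. For bounded Lipschitz \<open>U\<close> this is
  the usual trace, which exists and is unique up to null sets.\<close>

definition has_trace ::
  "(real^'n) set \<Rightarrow> (real^'n) set \<Rightarrow> (real^'n \<Rightarrow> real) \<Rightarrow> (real^'n \<Rightarrow> real) \<Rightarrow> bool" where
  "has_trace U \<Gamma> u g \<longleftrightarrow> in_L2 (surface_on \<Gamma>) g \<and>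
     (\<exists>w. (\<forall>k. smooth_on UNIV (w k)) \<and>
          L2_converges (lebesgue_on U) w u \<and>
          L2_converges (lebesgue_on U) (\<lambda>k. grad (w k)) (weak_gradient U u) \<and>
          L2_converges (surface_on \<Gamma>) w g)"

definition boundary_trace ::
  "(real^'n) set \<Rightarrow> (real^'n) set \<Rightarrow> (real^'n \<Rightarrow> real) \<Rightarrow> real^'n \<Rightarrow> real" where
  "boundary_trace U \<Gamma> u = (SOME g. has_trace U \<Gamma> u g)"


section \<open>Perforated geometry\<close>

definition unit_cell :: "(real^'n) set" where
  "unit_cell = box 0 1"

definition unit_cell_decomposition :: "(real^'n) set \<Rightarrow> (real^'n) set \<Rightarrow> bool" where
  "unit_cell_decomposition Yl Ys \<longleftrightarrow>
     open Yl \<and> open Ys \<and> Yl \<subseteq> unit_cell \<and> Ys \<subseteq> unit_cell \<and> Yl \<inter> Ys = {} \<and>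
     closure Yl \<union> closure Ys = closure unit_cell \<and>
     emeasure surface_measure (closure Yl \<inter> closure Ys) \<noteq> 0 \<and>
     closure Ys \<inter> frontier unit_cell = {} \<and>
     connected Yl"

definition lattice_vec :: "int^'n \<Rightarrow> real^'n" where
  "lattice_vec k = (\<chi> i. of_int (k $ i))"

definition scaled_cell :: "real \<Rightarrow> (real^'n) set \<Rightarrow> int^'n \<Rightarrow> (real^'n) set" where
  "scaled_cell \<epsilon> X k = (\<lambda>y. \<epsilon> *\<^sub>R (y + lattice_vec k)) ` X"

definition cells :: "(real^'n) set \<Rightarrow> real \<Rightarrow> (int^'n) set" where
  "cells \<Omega> \<epsilon> = {k. scaled_cell \<epsilon> unit_cell k \<subseteq> \<Omega>}"

definition solid_part :: "(real^'n) set \<Rightarrow> (real^'n) set \<Rightarrow> real \<Rightarrow> (real^'n) set" where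
  "solid_part \<Omega> Ys \<epsilon> = (\<Union>k\<in>cells \<Omega> \<epsilon>. scaled_cell \<epsilon> Ys k)"

text \<open>The plain union of the open sets $\varepsilon Y_l^k$ misses the common faces of neighbouring
  cells and would be disconnected; as usual, the union of the liquid parts includes these faces.\<close>

definition liquid_part :: "(real^'n) set \<Rightarrow> (real^'n) set \<Rightarrow> real \<Rightarrow> (real^'n) set" where
  "liquid_part \<Omega> Yl \<epsilon> = interior (\<Union>k\<in>cells \<Omega> \<epsilon>. closure (scaled_cell \<epsilon> Yl k))"

definition internal_boundary :: "(real^'n) set \<Rightarrow> (real^'n) set \<Rightarrow> real \<Rightarrow> (real^'n) set" where
  "internal_boundary \<Omega> Ys \<epsilon> = frontier (solid_part \<Omega> Ys \<epsilon>)"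

text \<open>The scales at which the geometric assumptions hold: the cells inside \<open>\<Omega>\<close> cover it completely,
  and the liquid part is bounded and connected with internal boundary, i.e. boundary apart from
  \<open>frontier \<Omega>\<close>, the $C^2$ hypersurface \<open>internal_boundary \<Omega> Ys \<epsilon>\<close>.\<close>

definition admissible_scale ::
  "(real^'n) set \<Rightarrow> (real^'n) set \<Rightarrow> (real^'n) set \<Rightarrow> real \<Rightarrow> bool" where
  "admissible_scale \<Omega> Yl Ys \<epsilon> \<longleftrightarrow>
     0 < \<epsilon> \<and> \<epsilon> < 1 \<and>
     closure \<Omega> = (\<Union>k\<in>cells \<Omega> \<epsilon>. closure (scaled_cell \<epsilon> unit_cell k)) \<and>
     bounded (liquid_part \<Omega> Yl \<epsilon>) \<and> connected (liquid_part \<Omega> Yl \<epsilon>) \<and>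
     frontier (liquid_part \<Omega> Yl \<epsilon>) - frontier \<Omega> = internal_boundary \<Omega> Ys \<epsilon> \<and>
     C2_boundary_part (liquid_part \<Omega> Yl \<epsilon>) (internal_boundary \<Omega> Ys \<epsilon>)"


section \<open>Data of the problem and weak solutions\<close>

text \<open>\<open>A\<close> stands for a class in $L^\infty$, so all its properties are required almost everywhere.\<close>

definition diffusion_matrix :: "(real^'n \<Rightarrow> real^'n^'n) \<Rightarrow> bool" where
  "diffusion_matrix A \<longleftrightarrow>
     A \<in> borel_measurable lebesgue \<and> (\<exists>M. AE y in lebesgue. norm (A y) \<le> M) \<and>
     (\<forall>k. AE y in lebesgue. A (y + lattice_vec k) = A y) \<and>
     (AE y in lebesgue. transpose (A y) = A y) \<and>
     (\<exists>\<gamma>1 \<gamma>2. 0 < \<gamma>1 \<and> 0 < \<gamma>2 \<and>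
        (AE y in lebesgue. \<forall>\<xi>. \<gamma>1 * (norm \<xi>)\<^sup>2 \<le> (\<Sum>i\<in>UNIV. \<Sum>j\<in>UNIV. A y $ i $ j * \<xi> $ i * \<xi> $ j) \<and>
           (\<Sum>i\<in>UNIV. \<Sum>j\<in>UNIV. A y $ i $ j * \<xi> $ i * \<xi> $ j) \<le> \<gamma>2 * (norm \<xi>)\<^sup>2))"

text \<open>For functions of the unknown alone the Caratheodory condition is continuity.\<close>

definition reaction_function :: "(real \<Rightarrow> real) \<Rightarrow> bool" where
  "reaction_function R \<longleftrightarrow>
     continuous_on UNIV R \<and> (\<exists>L. L-lipschitz_on UNIV R) \<and>
     (\<exists>\<delta>0 \<delta>1. 0 < \<delta>0 \<and> 0 < \<delta>1 \<and>
        (AE s in lebesgue. \<exists>D. (R has_real_derivative D) (at s) \<and> \<delta>0 \<le> D \<and> D \<le> \<delta>1))"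

definition space_V :: "(real^'n) set \<Rightarrow> (real^'n) set \<Rightarrow> (real^'n \<Rightarrow> real) set" where
  "space_V U \<Gamma>ext = {v. in_H1 U v \<and> has_trace U \<Gamma>ext v (\<lambda>_. 0)}"

text \<open>The zero flux condition on the internal boundary is natural, hence leaves no term here.\<close>

definition weak_solution ::
  "(real^'n) set \<Rightarrow> (real^'n) set \<Rightarrow> (real^'n \<Rightarrow> real^'n^'n) \<Rightarrow> (real \<Rightarrow> real) \<Rightarrow> (real^'n \<Rightarrow> real) \<Rightarrow>
   real \<Rightarrow> real \<Rightarrow> (real^'n \<Rightarrow> real) \<Rightarrow> bool" where
  "weak_solution U \<Gamma>ext A R f \<alpha> \<epsilon> u \<longleftrightarrow> u \<in> space_V U \<Gamma>ext \<and>
     (\<forall>\<phi>\<in>space_V U \<Gamma>ext.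
        (\<integral>x. (A ((1 / \<epsilon>) *\<^sub>R x) *v weak_gradient U u x) \<bullet> weak_gradient U \<phi> x \<partial>lebesgue_on U)
          + \<epsilon> powr \<alpha> * (\<integral>x. R (u x) * \<phi> x \<partial>lebesgue_on U)
        = (\<integral>x. f x * \<phi> x \<partial>lebesgue_on U))"

end

theory Submission
  imports Defs
begin

text \<open>Testing the equation with the solution itself and using coercivity of the diffusion matrix and of
  the reaction gives $\|u\| = O(\varepsilon^{-\alpha})$ and
  $\|\nabla u\| = O(\varepsilon^{-\alpha/2})$. The boundary term then follows from the scaled trace
  inequality $\varepsilon \|u\|^2_{\Gamma^\varepsilon} \le C (\|u\|^2 + \varepsilon^2 \|\nabla u\|^2)$,
  which only has to be known for smooth functions: the functions approximating \<open>u\<close> that witness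
  its zero trace on \<open>frontier \<Omega>\<close> also converge on $\Gamma^\varepsilon$.

  For the trace inequality, the boundary of the solid inclusion is covered by finitely many compact
  patches \<open>K\<close> that are Lipschitz graphs in a direction \<open>e\<close> pointing into the liquid. Packing disjoint
  balls into the tube \<open>K + [a, a + h] e\<close> bounds the Hausdorff measure of \<open>K\<close> by the Lebesgue
  measure of the tube divided by \<open>h\<close>, so that integrals over \<open>K\<close> are controlled by volume integrals
  without an area formula. Patches, directions and constants are invariant under scaling, except for
  the length \<open>h\<close>, and this produces the powers of $\varepsilon$.\<close>

section \<open>Hausdorff measure of graphs and volume of tubes\<close>

text \<open>Regularity is assumed for the boundary at admissible scales and not for
  \<open>Ys\<close> itself. The patches are therefore cut out of one cell at one such scale and
  pulled back to the unit cell; fixing them there, before \<epsilon> is given, makes the trace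
  constant uniform. Surface integrals are reached from set estimates: superlevel sets of a
  continuous function on a compact flat patch are again compact and flat, so the tube bound holds at
  every level and can be integrated over the levels. The source \<open>f\<close> is smooth in the
  open set \<Omega> but may be unbounded near its boundary. A bound on its norm that is uniform in
  \<epsilon> comes from comparing two scales: one liquid part exceeds another only within a compact
  subset of \<Omega>. Finally, \<open>R 0 = 0\<close> makes the reaction push towards 0; otherwise
  testing with the solution would leave \<epsilon>^\<alpha> R(0) times the integral of
  \<open>u\<close>, which the argument could not absorb.\<close>

lemma maximal_separated_subset:
  fixes K :: "'a::metric_space set"
  assumes "0 \<le> \<delta>"
    and bound: "\<And>F. F \<subseteq> K \<Longrightarrow> finite F \<Longrightarrow> (\<forall>x\<in>F. \<forall>y\<in>F. x \<noteq> y \<longrightarrow> \<delta> < dist x y) \<Longrightarrow> card F \<le> N"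
  obtains F where "F \<subseteq> K" "finite F" "\<forall>x\<in>F. \<forall>y\<in>F. x \<noteq> y \<longrightarrow> \<delta> < dist x y"
    "K \<subseteq> (\<Union>x\<in>F. cball x \<delta>)"
proof -
  define S where "S F \<longleftrightarrow> F \<subseteq> K \<and> finite F \<and> (\<forall>x\<in>F. \<forall>y\<in>F. x \<noteq> y \<longrightarrow> \<delta> < dist x y)" for F
  have "S {}" by (simp add: S_def)
  moreover have "\<forall>F. S F \<longrightarrow> card F < Suc N" using bound by (simp add: S_def le_imp_less_Suc)
  ultimately obtain F where F: "S F" and Fmax: "\<And>G. S G \<Longrightarrow> card G \<le> card F"
    using ex_has_greatest_nat[of S "{}" card "Suc N"] by blast
  \<comment> \<open>A point outside all these balls could be added to \<open>F\<close>, against the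
    maximality of its cardinality.\<close>
  have "K \<subseteq> (\<Union>x\<in>F. cball x \<delta>)"
  proof
    fix y assume "y \<in> K"
    show "y \<in> (\<Union>x\<in>F. cball x \<delta>)"
    proof (rule ccontr)
      assume *: "\<not> ?thesis"
      then have "\<delta> < dist x y" "\<delta> < dist y x" if "x \<in> F" for x
        using that by (auto simp: dist_commute not_le)
      then have "S (insert y F)" using F \<open>y \<in> K\<close> by (auto simp: S_def)
      moreover have "y \<notin> F" using * assms(1) by auto
      ultimately show False using Fmax[of "insert y F"] F by (simp add: S_def)
    qed
  qed
  then show thesis using F that by (auto simp: S_def)
qed

lemma hausdorff_outer_le_cballs:
  fixes K :: "'a::euclidean_space set"
  assumes cov: "\<And>\<delta>. 0 < \<delta> \<Longrightarrow> \<exists>F \<rho>. finite F \<and> 0 < \<rho> \<and> 2 * \<rho> \<le> \<delta> \<and> K \<subseteq> (\<Union>x\<in>F. cball x \<rho>) \<and>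
      ennreal (real (card F) * (unit_ball_vol (real s) * \<rho> ^ s)) \<le> B"
  shows "hausdorff_outer s K \<le> B"
  unfolding hausdorff_outer_def
proof (rule SUP_least)
  fix \<delta> :: real assume "\<delta> \<in> {0<..}"
  then obtain F \<rho> where F: "finite F" "0 < \<rho>" "2 * \<rho> \<le> \<delta>" "K \<subseteq> (\<Union>x\<in>F. cball x \<rho>)"
    "ennreal (real (card F) * (unit_ball_vol (real s) * \<rho> ^ s)) \<le> B"
    using cov[of \<delta>] by auto
  obtain f where f: "bij_betw f {0..<card F} F"
    using ex_bij_betw_nat_finite[OF \<open>finite F\<close>] by blast
  \<comment> \<open>The finite cover is padded with empty sets. Their gauge is 0 by the separate
    case in \<open>hausdorff_gauge\<close>; for \<open>s = 0\<close> the general formula would give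
    1.\<close>
  define C where "C i = (if i < card F then cball (f i) \<rho> else {})" for i
  have "F = f ` {0..<card F}" using f by (simp add: bij_betw_def)
  then have "(\<Union>x\<in>F. cball x \<rho>) \<subseteq> (\<Union>i. C i)"
    by (force simp: C_def)
  moreover have "bounded (C i) \<and> diameter (C i) \<le> \<delta>" for i
    using F by (auto simp: C_def)
  moreover have "(\<Sum>i. hausdorff_gauge s (C i)) \<le> B"
  proof -
    have "(\<Sum>i. hausdorff_gauge s (C i)) = (\<Sum>i\<in>{..<card F}. hausdorff_gauge s (C i))"
      by (rule suminf_finite) (auto simp: C_def hausdorff_gauge_def)
    also have "\<dots> = (\<Sum>i\<in>{..<card F}. ennreal (unit_ball_vol (real s) * \<rho> ^ s))"
      using F by (intro sum.cong refl) (auto simp: C_def hausdorff_gauge_def)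
    also have "\<dots> = ennreal (real (card F) * (unit_ball_vol (real s) * \<rho> ^ s))"
      using F by (simp add: ennreal_mult ennreal_of_nat_eq_real_of_nat)
    finally show ?thesis using F by simp
  qed
  ultimately show "(INF C\<in>{C :: nat \<Rightarrow> 'a set. K \<subseteq> (\<Union>i. C i) \<and> (\<forall>i. bounded (C i) \<and> diameter (C i) \<le> \<delta>)}.
          (\<Sum>i. hausdorff_gauge s (C i))) \<le> B"
    using F by (intro INF_lower2[of C]) auto
qed

text \<open>If the outer measure were not countably additive on the Borel sets, \<open>measure_of\<close> would return
  the zero measure, so the inequality needs no appeal to Caratheodory's criterion.\<close>

lemma emeasure_hausdorff_measure_le: "emeasure (hausdorff_measure s) A \<le> hausdorff_outer s A"
  by (simp add: hausdorff_measure_def emeasure_measure_of_conv)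

lemma sets_hausdorff_measure [simp, measurable_cong]: "sets (hausdorff_measure s) = sets borel"
  using sets.sigma_sets_eq[of borel]
  by (simp add: hausdorff_measure_def sets_measure_of)

lemma space_hausdorff_measure [simp]: "space (hausdorff_measure s) = UNIV"
  by (simp add: hausdorff_measure_def)

text \<open>For a unit vector \<open>e\<close> this is the orthogonal projection onto the hyperplane
  on which \<open>graph_boundary_at\<close> evaluates its function \<open>g\<close>.\<close>

definition reject :: "'a::real_inner \<Rightarrow> 'a \<Rightarrow> 'a" where
  "reject e v = v - (v \<bullet> e) *\<^sub>R e"

text \<open>Pythagoras: among all points of the line through \<open>v\<close> in direction
  \<open>e\<close>, the projection is the shortest.\<close>

lemma norm_reject_le:
  assumes "norm e = 1" shows "norm (reject e v) \<le> norm (v + s *\<^sub>R e)"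
proof -
  have "e \<bullet> e = 1" using assms by (simp add: norm_eq_1)
  then have "reject e v \<bullet> reject e v + (v \<bullet> e + s)^2 = (v + s *\<^sub>R e) \<bullet> (v + s *\<^sub>R e)"
    by (simp add: reject_def algebra_simps inner_simps power2_eq_square inner_commute)
  then have "reject e v \<bullet> reject e v \<le> (v + s *\<^sub>R e) \<bullet> (v + s *\<^sub>R e)"
    by (metis le_add_same_cancel1 zero_le_power2)
  then show ?thesis by (simp add: norm_le)
qed

definition tube :: "'a::real_vector set \<Rightarrow> 'a \<Rightarrow> real \<Rightarrow> real \<Rightarrow> 'a set" where
  "tube K e a b = (\<lambda>(x,t). x + t *\<^sub>R e) ` (K \<times> {a..b})"

lemma compact_tube:
  fixes K :: "'a::real_normed_vector set"
  assumes "compact K" shows "compact (tube K e a b)"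
  unfolding tube_def
  by (intro compact_continuous_image compact_Times assms compact_Icc)
     (auto intro!: continuous_intros simp: split_beta)

text \<open>Over each point of \<open>F\<close> a column of \<open>N\<close> balls of radius \<rho>
  is stacked in direction \<open>e\<close> at spacing 2 * \<rho>. The balls are pairwise disjoint,
  and all of them lie in the closed \<rho>-neighbourhood of the tube.\<close>

lemma separated_card_le_tube_volume:
  fixes K :: "'a::euclidean_space set"
  assumes e: "norm e = 1" and "0 < \<rho>" and "0 < M" and "h = 2 * \<rho> * real N"
    and flat: "\<And>x y. x \<in> K \<Longrightarrow> y \<in> K \<Longrightarrow> norm (x - y) \<le> M * norm (reject e (x - y))"
    and F: "F \<subseteq> K" "finite F" "\<forall>x\<in>F. \<forall>y\<in>F. x \<noteq> y \<longrightarrow> 2 * M * \<rho> < dist x y"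
  shows "ennreal (real (card F) * real N * (unit_ball_vol DIM('a) * \<rho> ^ DIM('a)))
     \<le> emeasure lborel {z. infdist z (tube K e a (a + h)) \<le> \<rho>}"
proof -
  define B where "B = (\<lambda>(x, j::nat). ball (x + (a + 2 * \<rho> * real j) *\<^sub>R e) \<rho>)"
  have far: "2 * \<rho> \<le> norm ((x + (a + 2 * \<rho> * real j) *\<^sub>R e) - (x' + (a + 2 * \<rho> * real j') *\<^sub>R e))"
    if "x \<in> F" "x' \<in> F" "(x,j) \<noteq> (x',j')" for x x' j j'
  proof (cases "x = x'")
    case True
    then have "j \<noteq> j'" using that by simp
    then have "1 \<le> \<bar>real j - real j'\<bar>" by (metis abs_ge_self abs_minus_commute le_diff_eq linorder_neqE_nat nat_less_real_le add.commute order_trans)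
    then have "2 * \<rho> * 1 \<le> 2 * \<rho> * \<bar>real j - real j'\<bar>" using \<open>0 < \<rho>\<close> by (intro mult_left_mono) auto
    also have "\<dots> = \<bar>2 * \<rho> * (real j - real j')\<bar> * norm e" using e \<open>0 < \<rho>\<close> by (simp add: abs_mult)
    also have "\<dots> = norm ((x + (a + 2 * \<rho> * real j) *\<^sub>R e) - (x' + (a + 2 * \<rho> * real j') *\<^sub>R e))"
      using True by (simp add: scaleR_diff_left[symmetric] right_diff_distrib del: scaleR_left_diff_distrib
          flip: norm_scaleR)
    finally show ?thesis by simp
  next
    case False
    \<comment> \<open>Flatness turns the distance of the base points into a distance greater than 2
      * \<rho> across \<open>e\<close>, and no shift along \<open>e\<close> can reduce that
      part.\<close>
    then have "2 * M * \<rho> < norm (x - x')" using F that by (auto simp: dist_norm)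
    also have "\<dots> \<le> M * norm (reject e (x - x'))" using flat F that by blast
    also have "\<dots> \<le> M * norm ((x - x') + (2 * \<rho> * (real j - real j')) *\<^sub>R e)"
      using \<open>0 < M\<close> norm_reject_le[OF e] by (intro mult_left_mono) auto
    also have "(x - x') + (2 * \<rho> * (real j - real j')) *\<^sub>R e
        = (x + (a + 2 * \<rho> * real j) *\<^sub>R e) - (x' + (a + 2 * \<rho> * real j') *\<^sub>R e)"
      by (simp add: algebra_simps)
    finally show ?thesis using \<open>0 < M\<close> by (simp add: mult.assoc mult.left_commute)
  qed
  have disj: "disjoint_family_on B (F \<times> {..<N})"
  proof (unfold disjoint_family_on_def, intro ballI impI)
    fix p q assume pq: "p \<in> F \<times> {..<N}" "q \<in> F \<times> {..<N}" "p \<noteq> q"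
    obtain x j x' j' where [simp]: "p = (x,j)" "q = (x',j')" by fastforce
    have "2 * \<rho> \<le> dist (x + (a + 2 * \<rho> * real j) *\<^sub>R e) (x' + (a + 2 * \<rho> * real j') *\<^sub>R e)"
      unfolding dist_norm using far pq by auto
    then show "B p \<inter> B q = {}" unfolding B_def by (auto intro!: disjoint_ballI)
  qed
  have sub: "(\<Union>p\<in>F \<times> {..<N}. B p) \<subseteq> {z. infdist z (tube K e a (a + h)) \<le> \<rho>}"
  proof clarsimp
    fix z x j assume "x \<in> F" "j < N" and z: "z \<in> B (x, j)"
    have "2 * \<rho> * real j \<le> h" using \<open>j < N\<close> \<open>0 < \<rho>\<close> by (simp add: assms(4))
    then have "x + (a + 2 * \<rho> * real j) *\<^sub>R e \<in> tube K e a (a + h)"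
      using \<open>x \<in> F\<close> F \<open>0 < \<rho>\<close> by (force simp: tube_def)
    then have "infdist z (tube K e a (a + h)) \<le> dist z (x + (a + 2 * \<rho> * real j) *\<^sub>R e)"
      by (rule infdist_le)
    then show "infdist z (tube K e a (a + h)) \<le> \<rho>" using z by (auto simp: B_def dist_commute)
  qed
  have "ennreal (real (card F) * real N * (unit_ball_vol DIM('a) * \<rho> ^ DIM('a)))
      = (\<Sum>p\<in>F \<times> {..<N}. emeasure lborel (B p))"
    using \<open>0 < \<rho>\<close> by (simp add: B_def split_beta emeasure_ball ennreal_mult ennreal_of_nat_eq_real_of_nat card_cartesian_product)
  also have "\<dots> = emeasure lborel (\<Union>p\<in>F \<times> {..<N}. B p)"
    using F disj by (intro sum_emeasure) (auto simp: B_def)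
  also have "\<dots> \<le> emeasure lborel {z. infdist z (tube K e a (a + h)) \<le> \<rho>}"
  proof (intro emeasure_mono sub)
    have "closed {z. infdist z (tube K e a (a + h)) \<le> \<rho>}"
      by (intro closed_Collect_le continuous_intros)
    then show "{z. infdist z (tube K e a (a + h)) \<le> \<rho>} \<in> sets lborel" by simp
  qed
  finally show ?thesis .
qed


text \<open>Divided by \<open>h\<close>, this is the ratio of the gauge of a ball of radius 2 M
  \<rho> in dimension d - 1 to the volume of a column of h / (2 \<rho>) balls of radius \<rho> in
  dimension d; the radius \<rho> cancels.\<close>

definition flat_const :: "'a::euclidean_space itself \<Rightarrow> real \<Rightarrow> real" where
  "flat_const _ M = 2 * unit_ball_vol (real (DIM('a) - 1)) * (2 * M) ^ (DIM('a) - 1) / unit_ball_vol (real DIM('a))"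

text \<open>A maximal separated set covers \<open>K\<close> by balls of radius 2 M \<rho>, and
  counting columns bounds its size by the volume of a neighbourhood of the tube. As \<rho> tends to
  0 these neighbourhoods decrease to the compact tube, so their finite volumes converge to its
  volume.\<close>

lemma hausdorff_outer_le_tube:
  fixes K :: "'a::euclidean_space set"
  assumes K: "compact K" and e: "norm e = 1" and h: "0 < h" and M: "0 < M"
    and flat: "\<And>x y. x \<in> K \<Longrightarrow> y \<in> K \<Longrightarrow> norm (x - y) \<le> M * norm (reject e (x - y))"
  shows "hausdorff_outer (DIM('a) - 1) K
     \<le> ennreal (flat_const TYPE('a) M / h) * emeasure lborel (tube K e a (a + h))"
\<comment> \<open>The empty set is treated apart because \<open>infdist\<close> to the empty set is
  0, which would make every neighbourhood of the tube the whole space.\<close>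
proof (cases "K = {}")
  case True
  show ?thesis
    by (rule hausdorff_outer_le_cballs, rule exI[of _ "{}"], rule_tac x="\<delta>/2" in exI) (simp add: True)
next
  case False
  define T where "T = tube K e a (a + h)"
  define c where "c = flat_const TYPE('a) M / h"
  have T: "compact T" unfolding T_def using K by (rule compact_tube)
  have "T \<noteq> {}" using False h by (auto simp: T_def tube_def)
  \<comment> \<open>With this radius exactly \<open>Suc n\<close> ball diameters make up the height
    \<open>h\<close>.\<close>
  define \<rho> where "\<rho> n = h / (2 * real (Suc n))" for n
  define A where "A n = {z. infdist z T \<le> \<rho> n}" for n
  have \<rho>_pos: "0 < \<rho> n" for n using h by (simp add: \<rho>_def)
  have \<rho>_lim: "\<rho> \<longlonglongrightarrow> 0"
    unfolding \<rho>_def using tendsto_mult[OF tendsto_const[of "h/2"] LIMSEQ_inverse_real_of_nat]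
    by (simp add: field_simps)
  have \<rho>_dec: "\<rho> n \<le> \<rho> m" if "m \<le> n" for m n
    using that h by (simp add: \<rho>_def frac_le)
  have closedA: "closed (A n)" for n
    unfolding A_def by (intro closed_Collect_le continuous_intros)
  have decA: "decseq A"
    unfolding decseq_def A_def using \<rho>_dec order_trans by blast
  have finA: "emeasure lborel (A n) < \<infinity>" for n
  proof -
    obtain r where r: "T \<subseteq> cball 0 r" using compact_imp_bounded[OF T] by (auto simp: bounded_iff subset_iff)
    have "A n \<subseteq> cball 0 (r + \<rho> n)"
    proof
      fix z assume "z \<in> A n"
      obtain x where "x \<in> T" "infdist z T = dist z x"
        using infdist_attains_inf[OF compact_imp_closed[OF T] \<open>T \<noteq> {}\<close>] by metis
      then have "dist z x \<le> \<rho> n" "norm x \<le> r" using \<open>z \<in> A n\<close> r by (auto simp: A_def)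
      then show "z \<in> cball 0 (r + \<rho> n)"
        using norm_triangle_ineq2[of z x] by (simp add: dist_norm)
    qed
    then have "emeasure lborel (A n) \<le> emeasure lborel (cball 0 (r + \<rho> n) :: 'a set)"
      by (intro emeasure_mono) auto
    also have "\<dots> < \<infinity>"
      by (rule emeasure_compact_finite) simp
    finally show ?thesis .
  qed
  have "(\<Inter>n. A n) = T"
  proof
    show "T \<subseteq> (\<Inter>n. A n)" using \<rho>_pos by (auto simp: A_def less_imp_le)
    show "(\<Inter>n. A n) \<subseteq> T"
    proof
      fix z assume "z \<in> (\<Inter>n. A n)"
      then have "infdist z T \<le> 0"
        using LIMSEQ_le_const[OF \<rho>_lim, of "infdist z T"] by (auto simp: A_def)
      then have "infdist z T = 0" using infdist_nonneg[of z T] by linarith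
      then show "z \<in> T"
        using T \<open>T \<noteq> {}\<close> by (simp add: in_closed_iff_infdist_zero compact_imp_closed)
    qed
  qed
  then have "(\<lambda>n. emeasure lborel (A n)) \<longlonglongrightarrow> emeasure lborel T"
    using Lim_emeasure_decseq[of A lborel] finA closedA decA by (simp add: image_subset_iff less_top)
  then have lim: "(\<lambda>n. ennreal c * emeasure lborel (A n)) \<longlonglongrightarrow> ennreal c * emeasure lborel T"
    by (intro ennreal_tendsto_cmult) auto
  show ?thesis unfolding T_def[symmetric] c_def[symmetric]
  \<comment> \<open>A value \<open>y\<close> strictly above the bound also exceeds the bounds given
    by the neighbourhoods \<open>A n\<close> for large \<open>n\<close>, so each mesh size is served
    by one finite cover.\<close>
  proof (rule dense_ge)
    fix y assume y: "ennreal c * emeasure lborel T < y"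
    show "hausdorff_outer (DIM('a) - 1) K \<le> y"
    proof (rule hausdorff_outer_le_cballs)
      fix \<delta> :: real assume "0 < \<delta>"
      have "eventually (\<lambda>n. ennreal c * emeasure lborel (A n) < y) sequentially"
        using lim y by (rule order_tendstoD)
      moreover have "eventually (\<lambda>n. \<rho> n < \<delta> / (4 * M)) sequentially"
        using \<rho>_lim \<open>0 < \<delta>\<close> M by (intro order_tendstoD) auto
      ultimately obtain n where n: "ennreal c * emeasure lborel (A n) < y" "\<rho> n < \<delta> / (4 * M)"
        using eventually_happens'[OF sequentially_bot eventually_conj] by blast
      define \<omega> where "\<omega> = unit_ball_vol (real DIM('a))"
      have "0 < \<omega>" by (simp add: \<omega>_def)
      define q where "q = real (Suc n) * (\<omega> * \<rho> n ^ DIM('a))"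
      have "0 < q" using \<rho>_pos \<open>0 < \<omega>\<close> by (simp add: q_def)
      have hN: "h = 2 * \<rho> n * real (Suc n)" by (simp add: \<rho>_def del: of_nat_Suc)
      have count: "ennreal (real (card F) * q) \<le> emeasure lborel (A n)"
        if "F \<subseteq> K" "finite F" "\<forall>x\<in>F. \<forall>y\<in>F. x \<noteq> y \<longrightarrow> 2 * M * \<rho> n < dist x y" for F
        using separated_card_le_tube_volume[OF e \<rho>_pos M hN flat that, of a]
        by (simp only: A_def T_def q_def \<omega>_def mult.assoc)
      define v where "v = enn2real (emeasure lborel (A n))"
      have v: "emeasure lborel (A n) = ennreal v" "0 \<le> v"
        using finA[of n] by (auto simp: v_def)
      \<comment> \<open>\<open>q\<close> is the volume of one column. The finite volume of
        \<open>A n\<close> thus caps the size of separated sets, which makes a maximal one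
        exist.\<close>
      have "card F \<le> nat \<lceil>v / q\<rceil>"
        if "F \<subseteq> K" "finite F" "\<forall>x\<in>F. \<forall>y\<in>F. x \<noteq> y \<longrightarrow> 2 * M * \<rho> n < dist x y" for F
      proof -
        have "real (card F) * q \<le> v" using count[OF that] v by (simp add: ennreal_le_iff)
        then have "real (card F) \<le> v / q" using \<open>0 < q\<close> by (simp add: pos_le_divide_eq)
        then show ?thesis by linarith
      qed
      then obtain F where F: "F \<subseteq> K" "finite F"
        "\<forall>x\<in>F. \<forall>y\<in>F. x \<noteq> y \<longrightarrow> 2 * M * \<rho> n < dist x y" "K \<subseteq> (\<Union>x\<in>F. cball x (2 * M * \<rho> n))"
        using maximal_separated_subset[of "2 * M * \<rho> n" K "nat \<lceil>v / q\<rceil>"] M less_imp_le[OF \<rho>_pos[of n]]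
        by (simp only: mult_nonneg_nonneg zero_le_numeral less_imp_le) blast
      have "q = (h / 2) * \<omega> * \<rho> n ^ (DIM('a) - 1)"
      proof -
        have "\<rho> n ^ DIM('a) = \<rho> n * \<rho> n ^ (DIM('a) - 1)"
          using DIM_positive[where 'a='a] by (metis Suc_pred' power_Suc)
        moreover have "real (Suc n) * \<rho> n = h / 2" by (simp add: \<rho>_def field_simps)
        ultimately show ?thesis unfolding q_def by (simp add: mult_ac)
      qed
      then have "real (card F) * (unit_ball_vol (real (DIM('a) - 1)) * (2 * M * \<rho> n) ^ (DIM('a) - 1))
          = c * (real (card F) * q)"
        using h \<open>0 < \<omega>\<close>
        by (simp add: c_def flat_const_def \<omega>_def[symmetric] power_mult_distrib field_simps)
      moreover have "0 \<le> c" using h M by (simp add: c_def flat_const_def)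
      ultimately have "ennreal (real (card F) * (unit_ball_vol (real (DIM('a) - 1)) * (2 * M * \<rho> n) ^ (DIM('a) - 1)))
          = ennreal c * ennreal (real (card F) * q)"
        using \<open>0 < q\<close> by (simp only: ennreal_mult mult_nonneg_nonneg of_nat_0_le_iff less_imp_le)
      also have "\<dots> \<le> ennreal c * emeasure lborel (A n)"
        using count[OF F(1-3)] by (intro mult_left_mono) auto
      also have "\<dots> \<le> y" using n by simp
      finally show "\<exists>F \<rho>. finite F \<and> 0 < \<rho> \<and> 2 * \<rho> \<le> \<delta> \<and> K \<subseteq> (\<Union>x\<in>F. cball x \<rho>) \<and>
         ennreal (real (card F) * (unit_ball_vol (real (DIM('a) - 1)) * \<rho> ^ (DIM('a) - 1))) \<le> y"
        using F n(2) M \<rho>_pos[of n]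
        by (intro exI[of _ F] exI[of _ "2 * M * \<rho> n"]) (simp add: field_simps)
    qed
  qed
qed

section \<open>From measures of level sets to integrals over flat compact sets\<close>

lemma emeasure_lborel_Ioc_ennreal: "emeasure lborel {s::real. 0 < s \<and> ennreal s \<le> y} = y"
proof (cases y)
  case (real r)
  then have "{s::real. 0 < s \<and> ennreal s \<le> y} = {0<..r}"
    by (auto simp: ennreal_le_iff)
  then show ?thesis using real by simp
next
  case top
  then have "{s::real. 0 < s \<and> ennreal s \<le> y} = {0<..}" by auto
  moreover have "emeasure lborel ({0<..} :: real set) = top"
  proof (rule ccontr)
    assume "emeasure lborel ({0<..} :: real set) \<noteq> top"
    then obtain r where r: "emeasure lborel ({0<..} :: real set) = ennreal r" "0 \<le> r"
      by (cases "emeasure lborel ({0<..} :: real set)") auto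
    have "emeasure lborel {0<..r + 1} \<le> emeasure lborel ({0<..} :: real set)"
      by (intro emeasure_mono) auto
    then show False using r by (simp add: ennreal_le_iff)
  qed
  ultimately show ?thesis using top by simp
qed

text \<open>Tonelli for the indicator of the region 0 < s \<le> f x, whose section over
  \<open>x\<close> has length \<open>f x\<close> even if that is infinite. Estimates of the measures
  of superlevel sets thereby become estimates of integrals.\<close>

lemma nn_integral_layer_cake:
  fixes f :: "'a \<Rightarrow> ennreal"
  assumes "sigma_finite_measure M" and f [measurable]: "f \<in> borel_measurable M"
  shows "(\<integral>\<^sup>+x. f x \<partial>M)
    = (\<integral>\<^sup>+s. emeasure M {x\<in>space M. ennreal s \<le> f x} * indicator {0<..} s \<partial>lborel)"
proof -
  interpret M: sigma_finite_measure M by fact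
  interpret pair_sigma_finite M "lborel :: real measure" ..
  define g where "g x s = (if 0 < s \<and> ennreal s \<le> f x then 1 else 0 :: ennreal)" for x s
  have [measurable]: "case_prod g \<in> borel_measurable (M \<Otimes>\<^sub>M lborel)"
    unfolding g_def by measurable
  have "(\<integral>\<^sup>+x. f x \<partial>M) = (\<integral>\<^sup>+x. (\<integral>\<^sup>+s. g x s \<partial>lborel) \<partial>M)"
  proof (intro nn_integral_cong)
    fix x
    have "(\<integral>\<^sup>+s. g x s \<partial>lborel) = (\<integral>\<^sup>+s. indicator {s. 0 < s \<and> ennreal s \<le> f x} s \<partial>lborel)"
      by (intro nn_integral_cong) (simp add: g_def indicator_def)
    also have "\<dots> = emeasure lborel {s. 0 < s \<and> ennreal s \<le> f x}"
      by (intro nn_integral_indicator) simp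
    finally show "f x = (\<integral>\<^sup>+s. g x s \<partial>lborel)" by (simp add: emeasure_lborel_Ioc_ennreal)
  qed
  also have "\<dots> = (\<integral>\<^sup>+s. (\<integral>\<^sup>+x. g x s \<partial>M) \<partial>lborel)"
    by (rule Fubini'[symmetric]) measurable
  also have "\<dots> = (\<integral>\<^sup>+s. emeasure M {x\<in>space M. ennreal s \<le> f x} * indicator {0<..} s \<partial>lborel)"
  proof (intro nn_integral_cong)
    fix s :: real
    have "(\<integral>\<^sup>+x. g x s \<partial>M) = (\<integral>\<^sup>+x. indicator {0<..} s * indicator {x\<in>space M. ennreal s \<le> f x} x \<partial>M)"
      by (intro nn_integral_cong) (simp add: g_def indicator_def)
    also have "\<dots> = emeasure M {x\<in>space M. ennreal s \<le> f x} * indicator {0<..} s"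
      by (simp add: nn_integral_cmult mult.commute)
    finally show "(\<integral>\<^sup>+x. g x s \<partial>M) = emeasure M {x\<in>space M. ennreal s \<le> f x} * indicator {0<..} s" .
  qed
  finally show ?thesis .
qed

lemma emeasure_hausdorff_le_tube:
  fixes K :: "'a::euclidean_space set"
  assumes "compact K" "norm e = 1" "0 < h" "0 < M"
    and "\<And>x y. x \<in> K \<Longrightarrow> y \<in> K \<Longrightarrow> norm (x - y) \<le> M * norm (reject e (x - y))"
  shows "emeasure (hausdorff_measure (DIM('a) - 1)) K
     \<le> ennreal (flat_const TYPE('a) M / h) * emeasure lborel (tube K e a (a + h))"
  using emeasure_hausdorff_measure_le hausdorff_outer_le_tube[OF assms] by (rule order_trans)

text \<open>Superlevel sets of \<psi> in \<open>K\<close> are compact and inherit flatness, and the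
  tube over such a set lies in the superlevel set of \<Phi> at the same level. The tube estimate is
  applied at each level, with the layer-cake formula on both sides.\<close>

lemma hausdorff_integral_le_tube:
  fixes K :: "'a::euclidean_space set" and \<psi> :: "'a \<Rightarrow> real" and \<Phi> :: "'a \<Rightarrow> ennreal"
  assumes K: "compact K" and e: "norm e = 1" and h: "0 < h" and M: "0 < M"
    and flat: "\<And>x y. x \<in> K \<Longrightarrow> y \<in> K \<Longrightarrow> norm (x - y) \<le> M * norm (reject e (x - y))"
    and \<psi>: "continuous_on K \<psi>"
    and \<Phi> [measurable]: "\<Phi> \<in> borel_measurable borel"
    and le: "\<And>x t. x \<in> K \<Longrightarrow> a \<le> t \<Longrightarrow> t \<le> a + h \<Longrightarrow> ennreal (\<psi> x) \<le> \<Phi> (x + t *\<^sub>R e)"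
  shows "(\<integral>\<^sup>+x. ennreal (\<psi> x) \<partial>restrict_space (hausdorff_measure (DIM('a) - 1)) K)
    \<le> ennreal (flat_const TYPE('a) M / h) * (\<integral>\<^sup>+z. \<Phi> z \<partial>lborel)"
proof -
  define H where "H = restrict_space (hausdorff_measure (DIM('a) - 1)) K"
  define c where "c = ennreal (flat_const TYPE('a) M / h)"
  have [measurable]: "K \<in> sets borel" using K by (simp add: compact_imp_closed)
  have space_H: "space H = K" by (simp add: H_def space_restrict_space)
  have emH: "emeasure H B = emeasure (hausdorff_measure (DIM('a) - 1)) B" if "B \<subseteq> K" for B
    unfolding H_def using that by (intro emeasure_restrict_space) auto
  have "emeasure (hausdorff_measure (DIM('a) - 1)) K \<le> c * emeasure lborel (tube K e a (a + h))"
    unfolding c_def by (rule emeasure_hausdorff_le_tube[OF K e h M flat])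
  also have "\<dots> < \<infinity>"
    using emeasure_compact_finite[OF compact_tube[OF K]] by (simp add: c_def ennreal_mult_less_top)
  \<comment> \<open>Finiteness on \<open>K\<close> comes from the tube estimate itself and supplies
    the sigma-finiteness that the layer-cake formula asks for.\<close>
  finally have "finite_measure H"
    using emH[of K] by (intro finite_measureI) (auto simp: space_H)
  then interpret H: finite_measure H .
  have [measurable]: "\<psi> \<in> borel_measurable H"
  proof -
    have "sets H = sets (restrict_space borel K)"
      unfolding H_def by (rule sets_restrict_space_cong) simp
    then show ?thesis
      using borel_measurable_continuous_on_restrict[OF \<psi>] measurable_cong_sets by blast
  qed
  have "(\<integral>\<^sup>+x. ennreal (\<psi> x) \<partial>H)
     = (\<integral>\<^sup>+s. emeasure H {x\<in>space H. ennreal s \<le> ennreal (\<psi> x)} * indicator {0<..} s \<partial>lborel)"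
    by (rule nn_integral_layer_cake) (auto intro: H.sigma_finite_measure_axioms)
  also have "\<dots> \<le> (\<integral>\<^sup>+s. c * (emeasure lborel {z\<in>space lborel. ennreal s \<le> \<Phi> z} * indicator {0<..} s) \<partial>lborel)"
  proof (intro nn_integral_mono)
    fix s :: real
    define L where "L = {x\<in>K. ennreal s \<le> ennreal (\<psi> x)}"
    show "emeasure H {x\<in>space H. ennreal s \<le> ennreal (\<psi> x)} * indicator {0<..} s
      \<le> c * (emeasure lborel {z\<in>space lborel. ennreal s \<le> \<Phi> z} * indicator {0<..} s)"
    proof (cases "0 < s")
      case True
      \<comment> \<open>\<open>ennreal\<close> cuts off negative values, so positivity of the level
        \<open>s\<close> is what identifies this with a superlevel set of \<psi>.\<close>
      have "L = K \<inter> \<psi> -` {s..}"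
        using True by (auto simp: L_def ennreal_le_iff2)
      then have "closed L"
        using continuous_closed_preimage[OF \<psi> compact_imp_closed[OF K] closed_atLeast] by simp
      then have "compact L" using K by (metis L_def compact_Int_closed Int_absorb1 mem_Collect_eq subsetI)
      then have "emeasure H L \<le> c * emeasure lborel (tube L e a (a + h))"
        unfolding c_def using emeasure_hausdorff_le_tube[of L e h M a] e h M flat emH[of L]
        by (auto simp: L_def)
      also have "\<dots> \<le> c * emeasure lborel {z\<in>space lborel. ennreal s \<le> \<Phi> z}"
      proof (intro mult_left_mono emeasure_mono)
        show "tube L e a (a + h) \<subseteq> {z\<in>space lborel. ennreal s \<le> \<Phi> z}"
          using le by (auto simp: tube_def L_def intro: order_trans)
      qed auto
      finally show ?thesis using True by (simp add: L_def space_H)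
    qed simp
  qed
  also have "\<dots> = c * (\<integral>\<^sup>+s. emeasure lborel {z\<in>space lborel. ennreal s \<le> \<Phi> z} * indicator {0<..} s \<partial>lborel)"
    by (rule nn_integral_cmult) measurable
  also have "\<dots> = c * (\<integral>\<^sup>+z. \<Phi> z \<partial>lborel)"
    by (subst nn_integral_layer_cake[of lborel \<Phi>]) (auto intro: sigma_finite_lborel)
  finally show ?thesis by (simp add: H_def c_def)
qed

section \<open>Trace inequality on a patch\<close>

lemma smooth_on_UNIV_imp:
  fixes w :: "real^'n \<Rightarrow> real"
  assumes "smooth_on UNIV w"
  shows smooth_differentiable: "w differentiable (at x)"
    and smooth_continuous: "continuous_on S w"
    and smooth_continuous_grad: "continuous_on S (grad w)"
proof -
  have "Ck_on (Suc 0) UNIV w" using assms unfolding smooth_on_def by blast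
  then have d: "w differentiable_on UNIV"
    and c: "\<forall>i\<in>Basis. continuous_on UNIV (\<lambda>x. frechet_derivative w (at x) i)" by auto
  from d show "w differentiable (at x)" by (simp add: differentiable_on_def)
  from d show "continuous_on S w"
    using differentiable_imp_continuous_on continuous_on_subset by blast
  have "continuous_on UNIV (grad w)"
    unfolding grad_def using c by (intro continuous_on_vec_lambda) (auto simp: axis_in_Basis_iff)
  then show "continuous_on S (grad w)" using continuous_on_subset by blast
qed

lemma grad_inner:
  fixes w :: "real^'n \<Rightarrow> real"
  assumes "w differentiable (at x)"
  shows "(w has_derivative (\<lambda>v. grad w x \<bullet> v)) (at x)"
proof -
  let ?D = "frechet_derivative w (at x)"
  have D: "(w has_derivative ?D) (at x)" using assms frechet_derivative_works by blast
  have lin: "linear ?D" using assms linear_frechet_derivative by blast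
  have "?D v = grad w x \<bullet> v" for v
  proof -
    have "?D v = ?D (\<Sum>i\<in>UNIV. (v $ i) *\<^sub>R axis i 1)"
      using basis_expansion[of v] by (simp add: scalar_mult_eq_scaleR)
    also have "\<dots> = (\<Sum>i\<in>UNIV. v $ i * ?D (axis i 1))"
      by (simp add: linear_sum[OF lin] linear_scale[OF lin])
    finally show ?thesis by (simp add: grad_def inner_vec_def mult.commute)
  qed
  then have "?D = (\<lambda>v. grad w x \<bullet> v)" by auto
  then show ?thesis using D by metis
qed

text \<open>The fundamental theorem of calculus for the square of \<open>w\<close> along the segment
  from \<open>z\<close> to \<open>z - t *\<^sub>R e\<close>, with 2 |w| |grad w| bounded by w^2 / h
  + h |grad w|^2. With this weight, a further integration over a length \<open>h\<close> yields w^2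
  + h^2 |grad w|^2.\<close>

lemma square_le_ray_integral:
  fixes w :: "real^'n \<Rightarrow> real"
  assumes w: "smooth_on UNIV w" and e: "norm e = 1" and h: "0 < h" and t: "0 \<le> t" "t \<le> h"
    and V: "\<And>r. 0 \<le> r \<Longrightarrow> r < t \<Longrightarrow> z - r *\<^sub>R e \<in> V"
  shows "ennreal ((w (z - t *\<^sub>R e))\<^sup>2) \<le> ennreal ((w z)\<^sup>2)
     + (\<integral>\<^sup>+r. ennreal ((w (z - r *\<^sub>R e))\<^sup>2 / h + h * (norm (grad w (z - r *\<^sub>R e)))\<^sup>2)
          * indicator V (z - r *\<^sub>R e) * indicator {0..h} r \<partial>lborel)"
proof -
  define p where "p r = (w (z - r *\<^sub>R e))\<^sup>2 / h + h * (norm (grad w (z - r *\<^sub>R e)))\<^sup>2" for r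
  define F' where "F' r = - 2 * w (z - r *\<^sub>R e) * (grad w (z - r *\<^sub>R e) \<bullet> e)" for r
  have cont1: "continuous_on S (\<lambda>r. w (z - r *\<^sub>R e))" for S
    by (rule continuous_on_compose2[OF smooth_continuous[OF w, of UNIV]]) (auto intro!: continuous_intros)
  have cont2: "continuous_on S (\<lambda>r. grad w (z - r *\<^sub>R e))" for S
    by (rule continuous_on_compose2[OF smooth_continuous_grad[OF w, of UNIV]]) (auto intro!: continuous_intros)
  have contp: "continuous_on S p" for S unfolding p_def by (intro continuous_intros cont1 cont2)
      (use h in auto)
  have contF': "continuous_on S F'" for S unfolding F'_def by (intro continuous_intros cont1 cont2)
  have der: "((\<lambda>r. (w (z - r *\<^sub>R e))\<^sup>2) has_vector_derivative F' r) (at r within S)" for r S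
  proof -
    have "((\<lambda>r. z - r *\<^sub>R e) has_derivative (\<lambda>s. - s *\<^sub>R e)) (at r within S)"
      by (auto intro!: derivative_eq_intros)
    then have "((\<lambda>r. w (z - r *\<^sub>R e)) has_derivative (\<lambda>s. grad w (z - r *\<^sub>R e) \<bullet> (- s *\<^sub>R e))) (at r within S)"
      by (rule has_derivative_compose[OF _ grad_inner[OF smooth_differentiable[OF w]]])
    then have "((\<lambda>r. w (z - r *\<^sub>R e)) has_real_derivative - (grad w (z - r *\<^sub>R e) \<bullet> e)) (at r within S)"
      by (rule has_derivative_imp_has_field_derivative) simp
    then have "((\<lambda>r. (w (z - r *\<^sub>R e))\<^sup>2) has_real_derivative F' r) (at r within S)"
      unfolding F'_def by (auto intro!: derivative_eq_intros)
    then show ?thesis by (simp add: has_real_derivative_iff_has_vector_derivative)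
  qed
  have "(F' has_integral ((w (z - t *\<^sub>R e))\<^sup>2 - (w (z - 0 *\<^sub>R e))\<^sup>2)) {0..t}"
    by (rule fundamental_theorem_of_calculus[OF t(1) der])
  moreover have "(p has_integral integral {0..t} p) {0..t}"
    by (intro integrable_integral integrable_continuous_real contp)
  moreover have "F' r \<le> p r" for r
  proof -
    have "F' r \<le> 2 * (\<bar>w (z - r *\<^sub>R e)\<bar> * norm (grad w (z - r *\<^sub>R e)))"
    proof -
      have "\<bar>F' r\<bar> = 2 * (\<bar>w (z - r *\<^sub>R e)\<bar> * \<bar>grad w (z - r *\<^sub>R e) \<bullet> e\<bar>)"
        by (simp add: F'_def abs_mult)
      also have "\<dots> \<le> 2 * (\<bar>w (z - r *\<^sub>R e)\<bar> * norm (grad w (z - r *\<^sub>R e)))"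
        using Cauchy_Schwarz_ineq2[of "grad w (z - r *\<^sub>R e)" e] e by (intro mult_left_mono) auto
      finally show ?thesis by linarith
    qed
    also have "\<dots> \<le> p r"
    proof -
      have "0 \<le> (\<bar>w (z - r *\<^sub>R e)\<bar> / sqrt h - sqrt h * norm (grad w (z - r *\<^sub>R e)))\<^sup>2" by simp
      then show ?thesis using h
        by (simp add: p_def power2_diff power_divide power_mult_distrib)
    qed
    finally show ?thesis .
  qed
  ultimately have "(w (z - t *\<^sub>R e))\<^sup>2 - (w z)\<^sup>2 \<le> integral {0..t} p"
    using has_integral_le[of F' _ "{0..t}" p] by force
  then have "ennreal ((w (z - t *\<^sub>R e))\<^sup>2) \<le> ennreal ((w z)\<^sup>2) + ennreal (integral {0..t} p)"
    by (subst ennreal_plus[symmetric])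
       (auto intro!: ennreal_leI Henstock_Kurzweil_Integration.integral_nonneg integrable_continuous_real contp simp: p_def h less_imp_le)
  also have "ennreal (integral {0..t} p) = (\<integral>\<^sup>+r. ennreal (p r) * indicator {0..t} r \<partial>lborel)"
  proof -
    have "(p has_integral integral {0..t} p) {0..t}"
      by (intro integrable_integral integrable_continuous_real contp)
    moreover have "p \<in> borel_measurable borel" using contp by (rule borel_measurable_continuous_onI)
    moreover have "0 \<le> p r" for r using h by (simp add: p_def)
    ultimately have "(\<integral>\<^sup>+r. ennreal (indicator {0..t} r * p r) \<partial>lborel) = ennreal (integral {0..t} p)"
      using nn_integral_has_integral_lebesgue[of "{0..t}" p "integral {0..t} p"]
      by (simp add: nn_integral_completion)
    moreover have "ennreal (indicator {0..t} r * p r) = ennreal (p r) * indicator {0..t} r" for r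
      by (simp add: indicator_def)
    ultimately show ?thesis by simp
  qed
  also have "\<dots> \<le> (\<integral>\<^sup>+r. ennreal (p r) * indicator V (z - r *\<^sub>R e) * indicator {0..h} r \<partial>lborel)"
  proof (rule nn_integral_mono_AE)
    \<comment> \<open>The segment lies in \<open>V\<close> except possibly at \<open>r = t\<close>,
      where the boundary point of a patch will sit; a single parameter is negligible.\<close>
    have "AE r in lborel. r \<noteq> t" by (rule AE_lborel_singleton)
    then show "AE r in lborel. ennreal (p r) * indicator {0..t} r
        \<le> ennreal (p r) * indicator V (z - r *\<^sub>R e) * indicator {0..h} r"
      by eventually_elim (use V t in \<open>auto simp: indicator_def\<close>)
  qed
  finally show ?thesis by (simp add: p_def)
qed


text \<open>Bounding chords by their projections says that \<open>K\<close> is part of a Lipschitz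
  graph over the hyperplane orthogonal to \<open>e\<close>, without naming the graph function; in
  this form \<open>M\<close> is invariant under scaling. The value \<open>t = 0\<close> is left out
  because the points of \<open>K\<close> will lie on the boundary of \<open>V\<close>.\<close>

definition flat_patch :: "'a::euclidean_space set \<Rightarrow> 'a \<Rightarrow> real \<Rightarrow> real \<Rightarrow> 'a set \<Rightarrow> bool" where
  "flat_patch K e h M V \<longleftrightarrow> compact K \<and> norm e = 1 \<and> 0 < h \<and> 0 < M \<and> open V \<and>
     (\<forall>x\<in>K. \<forall>y\<in>K. norm (x - y) \<le> M * norm (reject e (x - y))) \<and>
     (\<forall>x\<in>K. \<forall>t. 0 < t \<longrightarrow> t \<le> h \<longrightarrow> x + t *\<^sub>R e \<in> V)"

lemma nn_integral_lborel_shift: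
  fixes f :: "'a::euclidean_space \<Rightarrow> ennreal"
  assumes [measurable]: "f \<in> borel_measurable borel"
  shows "(\<integral>\<^sup>+z. f (z - c) \<partial>lborel) = (\<integral>\<^sup>+z. f z \<partial>lborel)"
proof -
  have "(\<integral>\<^sup>+z. f z \<partial>lborel) = (\<integral>\<^sup>+z. f z \<partial>distr lborel borel ((+) (- c)))"
    by (simp add: lborel_distr_plus)
  also have "\<dots> = (\<integral>\<^sup>+z. f (- c + z) \<partial>lborel)"
    by (rule nn_integral_distr) auto
  finally show ?thesis by simp
qed

text \<open>For every height t from h / 2 to h the square of \<open>w\<close> at \<open>x\<close> is
  bounded by one function \<Phi> at \<open>x + t *\<^sub>R e\<close>, as the tube estimate requires.
  Heights near 0 are avoided since \<open>x\<close> itself may lie outside \<open>V\<close>. The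
  constant 4 is 2 from the tube length h / 2 times 2 from the two terms of \<Phi>.\<close>

lemma flat_patch_trace:
  fixes w :: "real^'n \<Rightarrow> real" and K :: "(real^'n) set"
  assumes patch: "flat_patch K e h M V" and w: "smooth_on UNIV w"
  shows "(\<integral>\<^sup>+x. ennreal ((w x)\<^sup>2) \<partial>surface_on K)
    \<le> ennreal (4 * flat_const TYPE(real^'n) M / h)
        * (\<integral>\<^sup>+x\<in>V. ennreal ((w x)\<^sup>2 + h\<^sup>2 * (norm (grad w x))\<^sup>2) \<partial>lborel)"
proof -
  have K: "compact K" and e: "norm e = 1" and h: "0 < h" and M: "0 < M" and "open V"
    and flat: "\<And>x y. x \<in> K \<Longrightarrow> y \<in> K \<Longrightarrow> norm (x - y) \<le> M * norm (reject e (x - y))"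
    and V: "\<And>x t. x \<in> K \<Longrightarrow> 0 < t \<Longrightarrow> t \<le> h \<Longrightarrow> x + t *\<^sub>R e \<in> V"
    using patch by (auto simp: flat_patch_def)
  have [measurable]: "V \<in> sets borel" using \<open>open V\<close> by simp
  have [measurable]: "w \<in> borel_measurable borel" "grad w \<in> borel_measurable borel"
    using smooth_continuous[OF w] smooth_continuous_grad[OF w] by (auto intro: borel_measurable_continuous_onI)
  define q where "q z = ennreal ((w z)\<^sup>2 / h + h * (norm (grad w z))\<^sup>2) * indicator V z" for z
  have q [measurable]: "q \<in> borel_measurable borel" unfolding q_def by measurable
  define \<Phi> where "\<Phi> z = ennreal ((w z)\<^sup>2) * indicator V z
      + (\<integral>\<^sup>+r. q (z - r *\<^sub>R e) * indicator {0..h} r \<partial>lborel)" for z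
  have [measurable]: "\<Phi> \<in> borel_measurable borel" unfolding \<Phi>_def by measurable
  have le: "ennreal ((w x)\<^sup>2) \<le> \<Phi> (x + t *\<^sub>R e)" if "x \<in> K" "h / 2 \<le> t" "t \<le> h / 2 + h / 2" for x t
  proof -
    have t: "0 < t" "t \<le> h" using that h by auto
    have "x + t *\<^sub>R e - r *\<^sub>R e \<in> V" if "0 \<le> r" "r < t" for r
      using V[OF \<open>x \<in> K\<close>, of "t - r"] that t by (simp add: algebra_simps)
    then show ?thesis
      using square_le_ray_integral[OF w e h less_imp_le[OF t(1)] t(2), of "x + t *\<^sub>R e" V]
        V[OF \<open>x \<in> K\<close> t] by (simp add: \<Phi>_def q_def)
  qed
  have CD: "DIM(real^'n) = CARD('n)" by simp
  have "(\<integral>\<^sup>+x. ennreal ((w x)\<^sup>2) \<partial>surface_on K)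
     \<le> ennreal (flat_const TYPE(real^'n) M / (h / 2)) * (\<integral>\<^sup>+z. \<Phi> z \<partial>lborel)"
    unfolding surface_on_def surface_measure_def CD[symmetric]
    by (rule hausdorff_integral_le_tube[OF K e _ M flat, where a = "h/2"])
       (use h le smooth_continuous[OF w] in \<open>auto intro!: continuous_intros\<close>)
  also have "(\<integral>\<^sup>+z. \<Phi> z \<partial>lborel) \<le> 2 * (\<integral>\<^sup>+x\<in>V. ennreal ((w x)\<^sup>2 + h\<^sup>2 * (norm (grad w x))\<^sup>2) \<partial>lborel)"
  proof -
    have "(\<integral>\<^sup>+z. \<Phi> z \<partial>lborel) = (\<integral>\<^sup>+z. ennreal ((w z)\<^sup>2) * indicator V z \<partial>lborel)
       + (\<integral>\<^sup>+z. (\<integral>\<^sup>+r. q (z - r *\<^sub>R e) * indicator {0..h} r \<partial>lborel) \<partial>lborel)"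
      unfolding \<Phi>_def by (rule nn_integral_add) measurable
    \<comment> \<open>After exchanging the integrals, translation invariance removes the shift by
      \<open>r\<close>, and the length of the interval of shifts gives the factor
      \<open>h\<close>.\<close>
    also have "(\<integral>\<^sup>+z. (\<integral>\<^sup>+r. q (z - r *\<^sub>R e) * indicator {0..h} r \<partial>lborel) \<partial>lborel)
       = (\<integral>\<^sup>+r. (\<integral>\<^sup>+z. q (z - r *\<^sub>R e) * indicator {0..h} r \<partial>lborel) \<partial>lborel)"
      by (rule lborel_pair.Fubini') measurable
    also have "\<dots> = (\<integral>\<^sup>+r. (\<integral>\<^sup>+z. q z \<partial>lborel) * indicator {0..h} r \<partial>lborel)"
      by (simp add: nn_integral_multc nn_integral_lborel_shift)
    also have "\<dots> = (\<integral>\<^sup>+z. q z \<partial>lborel) * ennreal h"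
      using h by (subst nn_integral_cmult) auto
    also have "\<dots> = (\<integral>\<^sup>+z. q z * ennreal h \<partial>lborel)"
      by (simp add: nn_integral_multc)
    also have "(\<integral>\<^sup>+z. ennreal ((w z)\<^sup>2) * indicator V z \<partial>lborel) + (\<integral>\<^sup>+z. q z * ennreal h \<partial>lborel)
       = (\<integral>\<^sup>+z. ennreal ((w z)\<^sup>2) * indicator V z + q z * ennreal h \<partial>lborel)"
      by (rule nn_integral_add[symmetric]) measurable
    also have "\<dots> \<le> (\<integral>\<^sup>+z. 2 * (ennreal ((w z)\<^sup>2 + h\<^sup>2 * (norm (grad w z))\<^sup>2) * indicator V z) \<partial>lborel)"
    proof (rule nn_integral_mono)
      fix z
      have "((w z)\<^sup>2 / h + h * (norm (grad w z))\<^sup>2) * h = (w z)\<^sup>2 + h\<^sup>2 * (norm (grad w z))\<^sup>2"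
        using h by (simp add: field_simps power2_eq_square)
      then have "ennreal ((w z)\<^sup>2 / h + h * (norm (grad w z))\<^sup>2) * ennreal h
          = ennreal ((w z)\<^sup>2 + h\<^sup>2 * (norm (grad w z))\<^sup>2)"
        using h by (subst ennreal_mult'[symmetric]) auto
      moreover have "ennreal ((w z)\<^sup>2) \<le> ennreal ((w z)\<^sup>2 + h\<^sup>2 * (norm (grad w z))\<^sup>2)"
        by (intro ennreal_leI) simp
      ultimately show "ennreal ((w z)\<^sup>2) * indicator V z + q z * ennreal h
        \<le> 2 * (ennreal ((w z)\<^sup>2 + h\<^sup>2 * (norm (grad w z))\<^sup>2) * indicator V z)"
        by (auto simp: q_def indicator_def mult_2 intro: add_right_mono)
    qed
    also have "\<dots> = 2 * (\<integral>\<^sup>+x\<in>V. ennreal ((w x)\<^sup>2 + h\<^sup>2 * (norm (grad w x))\<^sup>2) \<partial>lborel)"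
      by (rule nn_integral_cmult) measurable
    finally show ?thesis .
  qed
  also have "ennreal (flat_const TYPE(real^'n) M / (h / 2))
       * (2 * (\<integral>\<^sup>+x\<in>V. ennreal ((w x)\<^sup>2 + h\<^sup>2 * (norm (grad w x))\<^sup>2) \<partial>lborel))
     = ennreal (4 * flat_const TYPE(real^'n) M / h)
        * (\<integral>\<^sup>+x\<in>V. ennreal ((w x)\<^sup>2 + h\<^sup>2 * (norm (grad w x))\<^sup>2) \<partial>lborel)"
  proof -
    have "ennreal (4 * flat_const TYPE(real^'n) M / h) = ennreal (flat_const TYPE(real^'n) M / (h / 2)) * 2"
      using h M by (simp add: flat_const_def ennreal_mult[symmetric] flip: ennreal_numeral)
    then show ?thesis by (simp add: mult.assoc)
  qed
  finally show ?thesis by (simp add: mult_left_mono)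
qed

section \<open>Covering the internal boundary by patches\<close>

text \<open>The gradient is continuous, hence bounded on the smaller closed ball, which is compact
  and convex; near the rim of the open ball it may be unbounded.\<close>

lemma Ck2_lipschitz_on_cball:
  fixes g :: "real^'n \<Rightarrow> real"
  assumes g: "Ck_on 2 (ball 0 r) g" and "s < r"
  shows "\<exists>L. L-lipschitz_on (cball 0 s) g"
proof -
  have d: "g differentiable_on ball 0 r"
    and c: "\<forall>i\<in>Basis. continuous_on (ball 0 r) (\<lambda>x. frechet_derivative g (at x) i)"
    using g by (auto simp: numeral_2_eq_2 intro: differentiable_imp_continuous_on)
  have sub: "cball 0 s \<subseteq> ball (0::real^'n) r" using \<open>s < r\<close> by auto
  have der: "(g has_derivative (\<lambda>v. grad g x \<bullet> v)) (at x)" if "x \<in> cball 0 s" for x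
    using d sub that by (intro grad_inner) (auto simp: differentiable_on_eq_differentiable_at)
  have "continuous_on (ball 0 r) (grad g)"
    unfolding grad_def using c by (intro continuous_on_vec_lambda) (auto simp: axis_in_Basis_iff)
  then have "compact (grad g ` cball 0 s)"
    using sub by (intro compact_continuous_image) (auto intro: continuous_on_subset)
  then obtain B where B: "\<And>x. x \<in> cball 0 s \<Longrightarrow> norm (grad g x) \<le> B"
    using compact_imp_bounded by (force simp: bounded_iff)
  have "\<bar>B\<bar>-lipschitz_on (cball 0 s) g"
  proof (rule bounded_derivative_imp_lipschitz)
    show "(g has_derivative (\<lambda>v. grad g x \<bullet> v)) (at x within cball 0 s)" if "x \<in> cball 0 s" for x
      using der[OF that] by (rule has_derivative_at_withinI)
    show "onorm (\<lambda>v. grad g x \<bullet> v) \<le> \<bar>B\<bar>" if "x \<in> cball 0 s" for x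
    proof (rule onorm_le)
      fix v
      have "norm (grad g x \<bullet> v) \<le> norm (grad g x) * norm v" by (simp add: Cauchy_Schwarz_ineq2)
      also have "\<dots> \<le> \<bar>B\<bar> * norm v" using B[OF that] by (intro mult_right_mono) auto
      finally show "norm (grad g x \<bullet> v) \<le> \<bar>B\<bar> * norm v" .
    qed
  qed auto
  then show ?thesis by blast
qed

lemma reject_add_scale: "norm e = 1 \<Longrightarrow> reject e (v + t *\<^sub>R e) = reject e v"
  by (simp add: reject_def inner_simps norm_eq_1 algebra_simps)

lemma reject_diff: "reject e (v - w) = reject e v - reject e w"
  by (simp add: reject_def inner_simps algebra_simps)

lemma norm_reject_le_norm: "norm e = 1 \<Longrightarrow> norm (reject e v) \<le> norm v"
  using norm_reject_le[of e v 0] by simp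

text \<open>Two points of the graph differ along \<open>e\<close> by at most L times the length of
  their projected difference, hence M = 1 + L. Moving along \<open>e\<close> keeps the projection
  and lifts the point above the graph, that is, into \<open>U\<close>. The open set \<open>W\<close>
  will be a single cell, to keep the segments inside it.\<close>

lemma graph_boundary_flat_patch:
  fixes U G W :: "(real^'n) set"
  assumes "open U" "open W" "x0 \<in> W" "closed G" "G \<subseteq> frontier U"
    and "graph_boundary_at (Ck_on 2) U x0"
  shows "\<exists>\<rho> e h M. 0 < \<rho> \<and> flat_patch (G \<inter> cball x0 \<rho>) e h M (U \<inter> W)"
proof -
  obtain e r g where e: "norm e = 1" and r: "0 < r" and g: "Ck_on 2 (ball 0 r) g"
    and U: "\<And>y. y \<in> ball x0 r \<Longrightarrow> y \<in> U \<longleftrightarrow> g (reject e (y - x0)) < (y - x0) \<bullet> e"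
    using assms(6) unfolding graph_boundary_at_def reject_def by blast
  obtain \<eta> where \<eta>: "0 < \<eta>" "ball x0 \<eta> \<subseteq> W" using \<open>open W\<close> \<open>x0 \<in> W\<close> openE by blast
  \<comment> \<open>Patch points moved by at most \<rho> stay within 2 * \<rho> of
    \<open>x0\<close>, inside both balls, and projections of patch points stay in the half ball
    where the Lipschitz constant holds.\<close>
  define \<rho> where "\<rho> = min r \<eta> / 4"
  have \<rho>: "0 < \<rho>" "4 * \<rho> \<le> r" "4 * \<rho> \<le> \<eta>" using r \<eta> by (auto simp: \<rho>_def)
  obtain L where L: "L-lipschitz_on (cball 0 (r / 2)) g"
    using Ck2_lipschitz_on_cball[OF g, of "r/2"] r by auto
  then have "0 \<le> L" by (rule lipschitz_on_nonneg)
  define gap where "gap y = g (reject e (y - x0)) - (y - x0) \<bullet> e" for y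
  have "continuous_on (ball x0 r) gap"
  proof -
    have "continuous_on (ball 0 r) g"
      using g by (auto simp: numeral_2_eq_2 intro: differentiable_imp_continuous_on)
    moreover have "continuous_on (ball x0 r) (\<lambda>y. reject e (y - x0))"
      unfolding reject_def by (intro continuous_intros)
    moreover have "(\<lambda>y. reject e (y - x0)) ` ball x0 r \<subseteq> ball 0 r"
    proof clarify
      fix y assume "y \<in> ball x0 r"
      then show "reject e (y - x0) \<in> ball 0 r"
        using norm_reject_le_norm[OF e, of "y - x0"] by (simp add: dist_norm norm_minus_commute)
    qed
    ultimately have "continuous_on (ball x0 r) (\<lambda>y. g (reject e (y - x0)))"
      by (rule continuous_on_compose2)
    then show ?thesis unfolding gap_def by (intro continuous_intros)
  qed
  then have "open {y \<in> ball x0 r. 0 < gap y}"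
    using continuous_open_preimage[of "ball x0 r" gap "{0<..}"] by (simp add: vimage_def Int_def)
  moreover have "{y \<in> ball x0 r. 0 < gap y} \<inter> U = {}"
    using U by (auto simp: gap_def)
  \<comment> \<open>Where \<open>gap\<close> is positive there is an open set free of
    \<open>U\<close>, so no point of the closure of \<open>U\<close> lies there. Points of
    \<open>G\<close> are moreover outside \<open>U\<close>, which puts them exactly on the
    graph.\<close>
  ultimately have gap_le: "gap x \<le> 0" if "x \<in> closure U" "x \<in> ball x0 r" for x
    using that open_Int_closure_eq_empty by fastforce
  have graph: "g (reject e (x - x0)) = (x - x0) \<bullet> e" if "x \<in> G" "x \<in> ball x0 r" for x
  proof -
    have "x \<in> closure U" "x \<notin> U" using assms that by (auto simp: frontier_def interior_open)
    then show ?thesis using gap_le[of x] U[of x] that by (auto simp: gap_def)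
  qed
  have "flat_patch (G \<inter> cball x0 \<rho>) e \<rho> (1 + L) (U \<inter> W)"
    unfolding flat_patch_def
  proof (intro conjI ballI allI impI)
    show "compact (G \<inter> cball x0 \<rho>)" using \<open>closed G\<close> by (simp add: closed_Int_compact)
    show "open (U \<inter> W)" using assms by blast
    fix x assume x: "x \<in> G \<inter> cball x0 \<rho>"
    have near: "y \<in> ball x0 r" "reject e (y - x0) \<in> cball 0 (r / 2)" if "y \<in> cball x0 \<rho>" for y
      using that \<rho> norm_reject_le_norm[OF e, of "y - x0"] by (auto simp: dist_norm norm_minus_commute)
    {
      fix y assume y: "y \<in> G \<inter> cball x0 \<rho>"
      have "x - y = reject e (x - y) + ((x - y) \<bullet> e) *\<^sub>R e" by (simp add: reject_def)
      then have "norm (x - y) \<le> norm (reject e (x - y)) + \<bar>(x - y) \<bullet> e\<bar>"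
        using norm_triangle_ineq[of "reject e (x - y)" "((x - y) \<bullet> e) *\<^sub>R e"] e by simp
      also have "(x - y) \<bullet> e = g (reject e (x - x0)) - g (reject e (y - x0))"
        using graph[of x] graph[of y] x y near by (simp add: inner_simps)
      also have "\<bar>\<dots>\<bar> \<le> L * norm (reject e (x - x0) - reject e (y - x0))"
        using lipschitz_onD[OF L near(2) near(2), of x y] x y by (simp add: dist_norm)
      also have "reject e (x - x0) - reject e (y - x0) = reject e (x - y)"
        by (simp add: reject_diff)
      finally show "norm (x - y) \<le> (1 + L) * norm (reject e (x - y))" by (simp add: algebra_simps)
    }
    {
      fix t assume t: "0 < t" "t \<le> \<rho>"
      have "norm (x + t *\<^sub>R e - x0) \<le> norm (x - x0) + norm (t *\<^sub>R e)"
        using norm_triangle_ineq[of "x - x0" "t *\<^sub>R e"] by (simp add: algebra_simps)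
      then have "dist x0 (x + t *\<^sub>R e) \<le> 2 * \<rho>"
        using x t e by (simp add: dist_norm norm_minus_commute)
      then have "x + t *\<^sub>R e \<in> ball x0 r" "x + t *\<^sub>R e \<in> ball x0 \<eta>" using \<rho> by auto
      moreover have "g (reject e (x + t *\<^sub>R e - x0)) < (x + t *\<^sub>R e - x0) \<bullet> e"
      proof -
        have sh: "x + t *\<^sub>R e - x0 = (x - x0) + t *\<^sub>R e" by simp
        have "reject e (x + t *\<^sub>R e - x0) = reject e (x - x0)"
          by (simp only: sh reject_add_scale[OF e])
        moreover have "(x + t *\<^sub>R e - x0) \<bullet> e = (x - x0) \<bullet> e + t"
          unfolding sh using e by (simp add: inner_add_left norm_eq_1)
        ultimately show ?thesis using graph[of x] x near t by auto
      qed
      ultimately show "x + t *\<^sub>R e \<in> U \<inter> W" using U \<eta> by auto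
    }
  qed (use e \<rho> \<open>0 \<le> L\<close> in auto)
  then show ?thesis using \<rho> by blast
qed

lemma flat_patch_affine:
  assumes "flat_patch K e h M V" and s: "0 < s"
  shows "flat_patch ((\<lambda>y. s *\<^sub>R y + b) ` K) e (s * h) M ((\<lambda>y. s *\<^sub>R y + b) ` V)"
  unfolding flat_patch_def
proof (intro conjI ballI allI impI)
  note P = assms(1)[unfolded flat_patch_def]
  show "compact ((\<lambda>y. s *\<^sub>R y + b) ` K)"
    using P by (intro compact_continuous_image continuous_intros) auto
  have "(\<lambda>y. s *\<^sub>R y + b) ` V = (+) b ` (*\<^sub>R) s ` V" by (auto simp: image_image add.commute)
  then show "open ((\<lambda>y. s *\<^sub>R y + b) ` V)"
    using P s by (simp add: open_translation open_scaling)
  fix x assume "x \<in> (\<lambda>y. s *\<^sub>R y + b) ` K"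
  then obtain x' where x: "x' \<in> K" "x = s *\<^sub>R x' + b" by auto
  {
    fix y assume "y \<in> (\<lambda>y. s *\<^sub>R y + b) ` K"
    then obtain y' where y: "y' \<in> K" "y = s *\<^sub>R y' + b" by auto
    have "x - y = s *\<^sub>R (x' - y')" using x y by (simp add: algebra_simps)
    moreover have "reject e (s *\<^sub>R (x' - y')) = s *\<^sub>R reject e (x' - y')"
      by (simp add: reject_def scaleR_right_diff_distrib inner_diff_left right_diff_distrib)
    ultimately show "norm (x - y) \<le> M * norm (reject e (x - y))"
      using P x y s by (simp add: mult.left_commute)
  }
  {
    fix t assume t: "0 < t" "t \<le> s * h"
    have "x' + (t / s) *\<^sub>R e \<in> V" using P x t s by (auto simp: field_simps)
    moreover have "x + t *\<^sub>R e = s *\<^sub>R (x' + (t / s) *\<^sub>R e) + b"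
      using x s by (simp add: algebra_simps)
    ultimately show "x + t *\<^sub>R e \<in> (\<lambda>y. s *\<^sub>R y + b) ` V" by blast
  }
qed (use assms in \<open>auto simp: flat_patch_def\<close>)

section \<open>Lattice cells, inclusions and liquid pieces at scale \<epsilon>\<close>

lemma scaled_cell_eq: "scaled_cell s X k = (\<lambda>y. s *\<^sub>R y + s *\<^sub>R lattice_vec k) ` X"
  by (simp add: scaled_cell_def scaleR_add_right)

lemma scaled_cell_eq': "scaled_cell s X k = (+) (s *\<^sub>R lattice_vec k) ` (*\<^sub>R) s ` X"
  by (simp add: scaled_cell_eq image_image add.commute)

lemma scaled_cell_mono: "X \<subseteq> Y \<Longrightarrow> scaled_cell s X k \<subseteq> scaled_cell s Y k"
  by (auto simp: scaled_cell_def)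

lemma open_scaled_cell: "open X \<Longrightarrow> s \<noteq> 0 \<Longrightarrow> open (scaled_cell s X k)"
  unfolding scaled_cell_eq' by (intro open_translation open_scaling)

lemma closure_scaled_cell: "closure (scaled_cell s X k) = scaled_cell s (closure X) k"
  unfolding scaled_cell_eq' by (simp only: closure_translation closure_scaleR)

lemma interior_scaled_cell:
  assumes "s \<noteq> 0" shows "interior (scaled_cell s X k) = scaled_cell s (interior X) k"
proof -
  have "interior ((*\<^sub>R) s ` X) = (*\<^sub>R) s ` interior X"
    using assms by (intro interior_injective_linear_image) (auto simp: inj_on_def linear_iff algebra_simps)
  then show ?thesis unfolding scaled_cell_eq' by (simp only: interior_translation)
qed

lemma unit_cell_iff: "x \<in> unit_cell \<longleftrightarrow> (\<forall>i. 0 < x $ i \<and> x $ i < 1)"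
  by (simp add: unit_cell_def mem_box_cart)

lemma open_unit_cell: "open unit_cell" by (simp add: unit_cell_def open_box)

lemma scaled_unit_cells_disjoint:
  fixes k k' :: "int^'n"
  assumes "s \<noteq> 0" and "k \<noteq> k'"
  shows "scaled_cell s unit_cell k \<inter> scaled_cell s unit_cell k' = {}"
proof (rule ccontr)
  assume "\<not> ?thesis"
  then obtain x where "x \<in> scaled_cell s unit_cell k" "x \<in> scaled_cell s unit_cell k'" by blast
  then obtain y y' :: "real^'n" where y: "y \<in> unit_cell" "y' \<in> unit_cell"
    "s *\<^sub>R (y + lattice_vec k) = s *\<^sub>R (y' + lattice_vec k')"
    by (auto simp: scaled_cell_def)
  then have eq: "y + lattice_vec k = y' + lattice_vec k'" using assms by simp
  have "k $ i = k' $ i" for i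
  proof -
    have "y $ i + of_int (k $ i) = y' $ i + of_int (k' $ i)"
      using arg_cong[OF eq, of "\<lambda>v. v $ i"] by (simp add: lattice_vec_def)
    moreover have "0 < y $ i" "y $ i < 1" "0 < y' $ i" "y' $ i < 1" using y by (auto simp: unit_cell_iff)
    ultimately have "\<bar>of_int (k $ i - k' $ i) :: real\<bar> < 1" by simp
    then show ?thesis by linarith
  qed
  then show False using \<open>k \<noteq> k'\<close> by (simp add: vec_eq_iff)
qed

lemma finite_cells:
  fixes \<Omega> :: "(real^'n) set"
  assumes "bounded \<Omega>" and "0 < \<epsilon>"
  shows "finite (cells \<Omega> \<epsilon>)"
proof -
  obtain B where B: "\<And>x. x \<in> \<Omega> \<Longrightarrow> norm x \<le> B" using assms by (auto simp: bounded_iff)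
  \<comment> \<open>The cell centres lie in the bounded set \<Omega>; the summand 1 absorbs their
    offset 1/2 from the lattice.\<close>
  define N where "N = \<lceil>B / \<epsilon>\<rceil> + 1"
  have "cells \<Omega> \<epsilon> \<subseteq> (\<lambda>f. \<chi> i. f i) ` (UNIV \<rightarrow>\<^sub>E {- N..N})"
  proof
    fix k assume k: "k \<in> cells \<Omega> \<epsilon>"
    define x :: "real^'n" where "x = \<epsilon> *\<^sub>R ((\<chi> i. 1/2) + lattice_vec k)"
    have "x \<in> scaled_cell \<epsilon> unit_cell k" by (auto simp: x_def scaled_cell_def unit_cell_iff)
    then have "norm x \<le> B" using k B by (auto simp: cells_def)
    have "k $ i \<in> {- N..N}" for i
    proof -
      have "\<bar>x $ i\<bar> \<le> B" using component_le_norm_cart[of x i] \<open>norm x \<le> B\<close> by linarith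
      then have "\<epsilon> * \<bar>1/2 + of_int (k $ i)\<bar> \<le> B"
        using \<open>0 < \<epsilon>\<close> by (simp add: x_def lattice_vec_def abs_mult)
      then have "\<bar>1/2 + of_int (k $ i)\<bar> \<le> B / \<epsilon>"
        using \<open>0 < \<epsilon>\<close> by (simp add: field_simps)
      then have "\<bar>of_int (k $ i) :: real\<bar> \<le> of_int \<lceil>B / \<epsilon>\<rceil> + 1"
        using le_of_int_ceiling[of "B / \<epsilon>"] by linarith
      then have "\<bar>k $ i\<bar> \<le> N" unfolding N_def by linarith
      then show ?thesis by auto
    qed
    then show "k \<in> (\<lambda>f. \<chi> i. f i) ` (UNIV \<rightarrow>\<^sub>E {- N..N})"
      by (intro image_eqI[of _ _ "\<lambda>i. k $ i"]) (auto simp: vec_eq_iff)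
  qed
  then show ?thesis by (rule finite_subset) (auto intro!: finite_imageI finite_PiE)
qed

lemma closure_solid_subset_unit_cell:
  assumes "unit_cell_decomposition Yl Ys"
  shows "closure Ys \<subseteq> unit_cell"
proof -
  have "closure Ys \<subseteq> closure unit_cell" using assms by (auto simp: unit_cell_decomposition_def)
  moreover have "closure Ys \<inter> frontier unit_cell = {}" using assms by (auto simp: unit_cell_decomposition_def)
  ultimately show ?thesis
    using closure_Un_frontier[of "unit_cell :: (real^'a) set"] by blast
qed

text \<open>Closed inclusions stay inside their own open cells, which are pairwise disjoint. A
  boundary point of one inclusion therefore cannot be covered by another and remains outside the
  whole solid part.\<close>

lemma scaled_frontier_subset:
  assumes dec: "unit_cell_decomposition Yl Ys" and "0 < \<epsilon>" and k: "k \<in> cells \<Omega> \<epsilon>"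
  shows "scaled_cell \<epsilon> (frontier Ys) k \<subseteq> internal_boundary \<Omega> Ys \<epsilon>"
proof
  have Ys: "open Ys" "Ys \<subseteq> unit_cell" using dec by (auto simp: unit_cell_decomposition_def)
  fix x assume "x \<in> scaled_cell \<epsilon> (frontier Ys) k"
  then obtain y where y: "y \<in> frontier Ys" "x = \<epsilon> *\<^sub>R (y + lattice_vec k)" by (auto simp: scaled_cell_def)
  have "y \<in> closure Ys" "y \<notin> Ys" using y Ys by (auto simp: frontier_def interior_open)
  have "x \<in> scaled_cell \<epsilon> (closure Ys) k"
    using \<open>y \<in> closure Ys\<close> y by (auto simp: scaled_cell_def)
  then have "x \<in> closure (scaled_cell \<epsilon> Ys k)" by (simp add: closure_scaled_cell)
  then have "x \<in> closure (solid_part \<Omega> Ys \<epsilon>)"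
    unfolding solid_part_def using k closure_mono[of "scaled_cell \<epsilon> Ys k"] by blast
  moreover have "x \<notin> solid_part \<Omega> Ys \<epsilon>"
  proof
    assume "x \<in> solid_part \<Omega> Ys \<epsilon>"
    then obtain k' where k': "x \<in> scaled_cell \<epsilon> Ys k'" by (auto simp: solid_part_def)
    have "x \<in> scaled_cell \<epsilon> unit_cell k'" using k' scaled_cell_mono[OF Ys(2)] by blast
    moreover have "x \<in> scaled_cell \<epsilon> unit_cell k"
      using closure_solid_subset_unit_cell[OF dec] \<open>y \<in> closure Ys\<close> y by (auto simp: scaled_cell_def)
    ultimately have "k' = k" using scaled_unit_cells_disjoint[of \<epsilon> k' k] \<open>0 < \<epsilon>\<close> by blast
    then show False using k' y \<open>y \<notin> Ys\<close> \<open>0 < \<epsilon>\<close> by (auto simp: scaled_cell_def)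
  qed
  moreover have "open (solid_part \<Omega> Ys \<epsilon>)"
    unfolding solid_part_def using Ys \<open>0 < \<epsilon>\<close> by (auto intro!: open_scaled_cell)
  ultimately show "x \<in> internal_boundary \<Omega> Ys \<epsilon>"
    by (simp add: internal_boundary_def frontier_def interior_open)
qed

text \<open>With finitely many cells the union of the closed inclusions is closed, so it contains
  the closure of the solid part; and a point interior to one inclusion is interior to the
  union.\<close>

lemma internal_boundary_subset:
  assumes "finite (cells \<Omega> \<epsilon>)" and "0 < \<epsilon>"
  shows "internal_boundary \<Omega> Ys \<epsilon> \<subseteq> (\<Union>k\<in>cells \<Omega> \<epsilon>. scaled_cell \<epsilon> (frontier Ys) k)"
proof
  fix x assume x: "x \<in> internal_boundary \<Omega> Ys \<epsilon>"
  have "closed (\<Union>k\<in>cells \<Omega> \<epsilon>. scaled_cell \<epsilon> (closure Ys) k)"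
    unfolding closure_scaled_cell[symmetric] using assms by (intro closed_UN) auto
  moreover have "solid_part \<Omega> Ys \<epsilon> \<subseteq> (\<Union>k\<in>cells \<Omega> \<epsilon>. scaled_cell \<epsilon> (closure Ys) k)"
    unfolding solid_part_def using scaled_cell_mono[OF closure_subset] by blast
  ultimately have "closure (solid_part \<Omega> Ys \<epsilon>) \<subseteq> (\<Union>k\<in>cells \<Omega> \<epsilon>. scaled_cell \<epsilon> (closure Ys) k)"
    by (rule closure_minimal[rotated])
  then obtain k where k: "k \<in> cells \<Omega> \<epsilon>" "x \<in> scaled_cell \<epsilon> (closure Ys) k"
    using x by (force simp: internal_boundary_def frontier_def)
  have "interior (scaled_cell \<epsilon> Ys k) \<subseteq> interior (solid_part \<Omega> Ys \<epsilon>)"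
    unfolding solid_part_def using k by (intro interior_mono) blast
  then have "x \<notin> scaled_cell \<epsilon> (interior Ys) k"
    using x \<open>0 < \<epsilon>\<close> by (auto simp: internal_boundary_def frontier_def interior_scaled_cell)
  then have "x \<in> scaled_cell \<epsilon> (frontier Ys) k"
    using k by (auto simp: scaled_cell_def frontier_def)
  then show "x \<in> (\<Union>k\<in>cells \<Omega> \<epsilon>. scaled_cell \<epsilon> (frontier Ys) k)" using k by blast
qed

text \<open>The set \<open>Yl\<close> may have cracks; they belong to \<open>liquid_part\<close>, which is built from closures.\<close>

definition filled_liquid :: "(real^'n) set \<Rightarrow> (real^'n) set" where
  "filled_liquid Yl = interior (closure Yl) \<inter> unit_cell"

lemma open_filled_liquid: "open (filled_liquid Yl)"
  by (simp add: filled_liquid_def open_unit_cell open_Int)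

lemma scaled_filled_liquid_subset:
  assumes "k \<in> cells \<Omega> \<epsilon>" and "0 < \<epsilon>"
  shows "scaled_cell \<epsilon> (filled_liquid Yl) k \<subseteq> liquid_part \<Omega> Yl \<epsilon>"
proof -
  have "scaled_cell \<epsilon> (filled_liquid Yl) k \<subseteq> closure (scaled_cell \<epsilon> Yl k)"
    unfolding closure_scaled_cell filled_liquid_def using interior_subset by (intro scaled_cell_mono) blast
  then show ?thesis
    unfolding liquid_part_def using assms open_filled_liquid
    by (intro interior_maximal open_scaled_cell) auto
qed

text \<open>An open cell does not meet the closures of the liquid pieces of other cells, so inside
  it only its own piece counts. The intersection is open and hence contained in the interior of the
  closure of that piece.\<close>

lemma liquid_part_Int_cell_subset:
  assumes Yl: "Yl \<subseteq> unit_cell" and "0 < \<epsilon>"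
  shows "liquid_part \<Omega> Yl \<epsilon> \<inter> scaled_cell \<epsilon> unit_cell k \<subseteq> scaled_cell \<epsilon> (filled_liquid Yl) k"
proof -
  let ?W = "scaled_cell \<epsilon> unit_cell k"
  have W: "open ?W" using \<open>0 < \<epsilon>\<close> by (intro open_scaled_cell open_unit_cell) auto
  have "?W \<inter> closure (scaled_cell \<epsilon> Yl k') = {}" if "k' \<noteq> k" for k'
  proof -
    have "?W \<inter> scaled_cell \<epsilon> Yl k' = {}"
      using scaled_unit_cells_disjoint[of \<epsilon> k k'] scaled_cell_mono[OF Yl, of \<epsilon> k'] \<open>0 < \<epsilon>\<close> that by auto
    then show ?thesis using W open_Int_closure_eq_empty by blast
  qed
  note other = this
  have "?W \<inter> (\<Union>k'\<in>cells \<Omega> \<epsilon>. closure (scaled_cell \<epsilon> Yl k')) \<subseteq> closure (scaled_cell \<epsilon> Yl k)"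
  proof clarify
    fix x k' assume x: "x \<in> ?W" "x \<in> closure (scaled_cell \<epsilon> Yl k')"
    show "x \<in> closure (scaled_cell \<epsilon> Yl k)"
    proof (cases "k' = k")
      case False
      then show ?thesis using other[OF False] x by (metis IntI empty_iff)
    qed (use x in simp)
  qed
  then have "liquid_part \<Omega> Yl \<epsilon> \<inter> ?W \<subseteq> closure (scaled_cell \<epsilon> Yl k)"
    unfolding liquid_part_def using interior_subset[of "\<Union>k'\<in>cells \<Omega> \<epsilon>. closure (scaled_cell \<epsilon> Yl k')"] by blast
  then have "liquid_part \<Omega> Yl \<epsilon> \<inter> ?W \<subseteq> interior (closure (scaled_cell \<epsilon> Yl k))"
    using W by (intro interior_maximal) (auto simp: liquid_part_def)
  then have "liquid_part \<Omega> Yl \<epsilon> \<inter> ?W \<subseteq> scaled_cell \<epsilon> (interior (closure Yl)) k \<inter> ?W"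
    using \<open>0 < \<epsilon>\<close> by (simp add: closure_scaled_cell interior_scaled_cell)
  also have "\<dots> \<subseteq> scaled_cell \<epsilon> (filled_liquid Yl) k"
    using \<open>0 < \<epsilon>\<close> by (auto simp: scaled_cell_def filled_liquid_def)
  finally show ?thesis .
qed


text \<open>The $C^2$ assumption concerns the boundary at an admissible scale. A patch is found in
  any one cell at that scale and carried to the unit cell by the inverse similarity, from where it
  can serve all scales.\<close>

lemma unit_scale_flat_patch:
  fixes \<Omega> Yl Ys :: "(real^'n) set"
  assumes dec: "unit_cell_decomposition Yl Ys" and adm: "admissible_scale \<Omega> Yl Ys \<epsilon>"
    and "bounded \<Omega>" and "\<Omega> \<noteq> {}" and y: "y \<in> frontier Ys"
  shows "\<exists>\<rho> e h M. 0 < \<rho> \<and> flat_patch (frontier Ys \<inter> cball y \<rho>) e h M (filled_liquid Yl)"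
proof -
  let ?U = "liquid_part \<Omega> Yl \<epsilon>" and ?\<Gamma> = "internal_boundary \<Omega> Ys \<epsilon>"
  have \<epsilon>: "0 < \<epsilon>" and cov: "closure \<Omega> = (\<Union>k\<in>cells \<Omega> \<epsilon>. closure (scaled_cell \<epsilon> unit_cell k))"
    and fr: "frontier ?U - frontier \<Omega> = ?\<Gamma>" and C2: "C2_boundary_part ?U ?\<Gamma>"
    using adm by (auto simp: admissible_scale_def)
  have Yl: "Yl \<subseteq> unit_cell" using dec by (auto simp: unit_cell_decomposition_def)
  have "cells \<Omega> \<epsilon> \<noteq> {}" using cov \<open>\<Omega> \<noteq> {}\<close> by auto
  then obtain k where k: "k \<in> cells \<Omega> \<epsilon>" by blast
  let ?W = "scaled_cell \<epsilon> unit_cell k" and ?G = "scaled_cell \<epsilon> (frontier Ys) k"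
  define x0 where "x0 = \<epsilon> *\<^sub>R y + \<epsilon> *\<^sub>R lattice_vec k"
  have x0: "x0 \<in> ?G" using y by (auto simp: x0_def scaled_cell_eq)
  have G: "?G \<subseteq> ?\<Gamma>" using scaled_frontier_subset[OF dec \<epsilon> k] .
  have frYs: "frontier Ys \<subseteq> unit_cell"
    using closure_solid_subset_unit_cell[OF dec] by (auto simp: frontier_def)
  have "closed ?G"
    unfolding scaled_cell_eq' by (intro closed_translation closed_scaling) simp
  have "\<exists>\<rho> e h M. 0 < \<rho> \<and> flat_patch (?G \<inter> cball x0 \<rho>) e h M (?U \<inter> ?W)"
  proof (rule graph_boundary_flat_patch)
    show "open ?U" by (simp add: liquid_part_def)
    show "open ?W" using \<epsilon> by (intro open_scaled_cell open_unit_cell) auto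
    show "x0 \<in> ?W" using x0 scaled_cell_mono[OF frYs] by blast
    show "?G \<subseteq> frontier ?U" using G fr by blast
    show "graph_boundary_at (Ck_on 2) ?U x0" using C2 x0 G by (auto simp: C2_boundary_part_def)
  qed fact
  then obtain \<rho> e h M where \<rho>: "0 < \<rho>" and P: "flat_patch (?G \<inter> cball x0 \<rho>) e h M (?U \<inter> ?W)" by blast
  \<comment> \<open>The open side of the patch is enlarged to the scaled copy of
    \<open>filled_liquid Yl\<close>, a set that does not refer to \<Omega> or to the other
    cells.\<close>
  have mono: "flat_patch (?G \<inter> cball x0 \<rho>) e h M (scaled_cell \<epsilon> (filled_liquid Yl) k)"
    using P liquid_part_Int_cell_subset[OF Yl \<epsilon>, of \<Omega> k] open_scaled_cell[OF open_filled_liquid, of \<epsilon> Yl k] \<epsilon>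
    by (auto simp: flat_patch_def)
  let ?inv = "\<lambda>x. (1 / \<epsilon>) *\<^sub>R x + (- lattice_vec k)"
  have inv: "?inv ` scaled_cell \<epsilon> X k = X" for X
    using \<epsilon> by (auto simp: scaled_cell_eq image_image scaleR_add_right)
  have "?inv ` (?G \<inter> cball x0 \<rho>) = frontier Ys \<inter> cball y (\<rho> / \<epsilon>)"
  proof -
    have "?inv ` cball x0 \<rho> = cball y (\<rho> / \<epsilon>)"
    proof -
      have "cball x0 \<rho> = scaled_cell \<epsilon> (cball y (\<rho> / \<epsilon>)) k"
        using cball_scale[of \<epsilon> y "\<rho> / \<epsilon>"] \<epsilon> cball_translation[of "\<epsilon> *\<^sub>R lattice_vec k" "\<epsilon> *\<^sub>R y" \<rho>]
        unfolding scaled_cell_eq' by (simp only: x0_def add.commute[of "\<epsilon> *\<^sub>R y"]) simp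
      then show ?thesis by (simp only: inv)
    qed
    moreover have "inj ?inv" using \<epsilon> by (auto simp: inj_on_def)
    ultimately show ?thesis by (simp only: image_Int inv)
  qed
  then have "flat_patch (frontier Ys \<inter> cball y (\<rho> / \<epsilon>)) e (1 / \<epsilon> * h) M (filled_liquid Yl)"
    using flat_patch_affine[OF mono, of "1 / \<epsilon>" "- lattice_vec k"] \<epsilon> by (simp only: inv) simp
  then show ?thesis using \<rho> \<epsilon> by (meson divide_pos_pos)
qed

lemma finite_flat_patch_cover:
  fixes \<Omega> Yl Ys :: "(real^'n) set"
  assumes "unit_cell_decomposition Yl Ys" and "admissible_scale \<Omega> Yl Ys \<epsilon>"
    and "bounded \<Omega>" and "\<Omega> \<noteq> {}"
  obtains D :: "(real^'n) set" and K e h M where "finite D" "frontier Ys \<subseteq> (\<Union>y\<in>D. K y)"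
    "\<And>y. y \<in> D \<Longrightarrow> flat_patch (K y) (e y) (h y) (M y) (filled_liquid Yl)"
proof -
  obtain \<rho> e h M where P: "\<And>y. y \<in> frontier Ys \<Longrightarrow> 0 < \<rho> y"
    "\<And>y. y \<in> frontier Ys \<Longrightarrow> flat_patch (frontier Ys \<inter> cball y (\<rho> y)) (e y) (h y) (M y) (filled_liquid Yl)"
    using unit_scale_flat_patch[OF assms] by metis
  have "closure Ys \<subseteq> unit_cell" using closure_solid_subset_unit_cell assms by blast
  then have "bounded (closure Ys)" by (rule bounded_subset[rotated]) (simp add: unit_cell_def bounded_box)
  then have "compact (frontier Ys)"
    using bounded_subset[OF _ closure_subset] by (intro compact_frontier_bounded) blast
  \<comment> \<open>Open balls serve for extracting the finite cover; the patches use the closed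
    balls, which makes them compact.\<close>
  moreover have "frontier Ys \<subseteq> (\<Union>y\<in>frontier Ys. ball y (\<rho> y))" using P(1) by auto
  ultimately obtain D where D: "D \<subseteq> frontier Ys" "finite D" "frontier Ys \<subseteq> (\<Union>y\<in>D. ball y (\<rho> y))"
    using compactE_image[of "frontier Ys" "frontier Ys" "\<lambda>y. ball y (\<rho> y)"] by auto
  show thesis
  proof (rule that[OF D(2)])
    show "frontier Ys \<subseteq> (\<Union>y\<in>D. frontier Ys \<inter> cball y (\<rho> y))"
    proof
      fix x assume x: "x \<in> frontier Ys"
      then obtain y where "y \<in> D" "x \<in> ball y (\<rho> y)" using D(3) by blast
      then have "x \<in> frontier Ys \<inter> cball y (\<rho> y)" using x by simp
      with \<open>y \<in> D\<close> show "x \<in> (\<Union>y\<in>D. frontier Ys \<inter> cball y (\<rho> y))" by blast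
    qed
    show "flat_patch (frontier Ys \<inter> cball y (\<rho> y)) (e y) (h y) (M y) (filled_liquid Yl)" if "y \<in> D" for y
      using P(2) D(1) that by blast
  qed
qed

section \<open>Summation of the patch inequalities over all cells\<close>

lemma nn_integral_surface_on:
  assumes "\<Gamma> \<in> sets borel"
  shows "(\<integral>\<^sup>+x. f x \<partial>surface_on \<Gamma>) = (\<integral>\<^sup>+x. f x * indicator \<Gamma> x \<partial>surface_measure)"
  using assms unfolding surface_on_def
  by (subst nn_integral_restrict_space) (simp_all add: surface_measure_def)

lemma nn_integral_lebesgue_on_open:
  assumes "open U"
  shows "(\<integral>\<^sup>+x. f x \<partial>lebesgue_on U) = (\<integral>\<^sup>+x\<in>U. f x \<partial>lborel)"
  using assms by (subst nn_integral_restrict_space) (auto simp: nn_integral_completion)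

text \<open>The patches of one cell share its liquid piece, which costs a sum over the finite set
  \<open>D\<close>. The pieces of different cells are disjoint, so the number of cells, which grows
  as \<epsilon> decreases, does not enter the constant.\<close>

lemma scaled_trace_inequality:
  fixes \<Omega> Yl Ys :: "(real^'n) set"
  assumes dec: "unit_cell_decomposition Yl Ys" and bdd: "bounded \<Omega>" and "\<Omega> \<noteq> {}"
  shows "\<exists>C\<ge>0. \<forall>\<epsilon> w. admissible_scale \<Omega> Yl Ys \<epsilon> \<longrightarrow> smooth_on UNIV w \<longrightarrow>
    (\<integral>\<^sup>+x. ennreal ((w x)\<^sup>2) \<partial>surface_on (internal_boundary \<Omega> Ys \<epsilon>))
      \<le> ennreal (C / \<epsilon>) * (\<integral>\<^sup>+x. ennreal ((w x)\<^sup>2 + \<epsilon>\<^sup>2 * (norm (grad w x))\<^sup>2) \<partial>lebesgue_on (liquid_part \<Omega> Yl \<epsilon>))"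
proof (cases "\<exists>\<epsilon>. admissible_scale \<Omega> Yl Ys \<epsilon>")
  case False
  then show ?thesis by (intro exI[of _ 0]) auto
next
  case True
  then obtain \<epsilon>0 where "admissible_scale \<Omega> Yl Ys \<epsilon>0" by blast
  then obtain D :: "(real^'n) set" and K e h M where D: "finite D" "frontier Ys \<subseteq> (\<Union>y\<in>D. K y)"
    and P: "\<And>y. y \<in> D \<Longrightarrow> flat_patch (K y) (e y) (h y) (M y) (filled_liquid Yl)"
    using finite_flat_patch_cover[OF dec _ bdd \<open>\<Omega> \<noteq> {}\<close>] by blast
  \<comment> \<open>The constant of \<open>flat_patch_trace\<close> at unit scale; the factor 1 +
    h^2 trades the gradient weight (\<epsilon> * h)^2 of a scaled patch for the common weight
    \<epsilon>^2.\<close>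
  define c where "c y = 4 * flat_const TYPE(real^'n) (M y) / h y * (1 + (h y)\<^sup>2)" for y
  have c: "0 \<le> c y" if "y \<in> D" for y
    using P[OF that] by (auto simp: flat_patch_def c_def flat_const_def)
  show ?thesis
  proof (intro exI[of _ "sum c D"] conjI allI impI)
    show "0 \<le> sum c D" using c by (rule sum_nonneg)
    fix \<epsilon> and w :: "real^'n \<Rightarrow> real" assume adm: "admissible_scale \<Omega> Yl Ys \<epsilon>" and w: "smooth_on UNIV w"
    then have \<epsilon>: "0 < \<epsilon>" by (auto simp: admissible_scale_def)
    let ?\<Gamma> = "internal_boundary \<Omega> Ys \<epsilon>" and ?U = "liquid_part \<Omega> Yl \<epsilon>"
    let ?V = "\<lambda>k. scaled_cell \<epsilon> (filled_liquid Yl) k"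
    have fin: "finite (cells \<Omega> \<epsilon>)" using bdd \<epsilon> by (rule finite_cells)
    have [measurable]: "w \<in> borel_measurable borel" "grad w \<in> borel_measurable borel"
      using smooth_continuous[OF w] smooth_continuous_grad[OF w] by (auto intro: borel_measurable_continuous_onI)
    have [simp]: "sets surface_measure = sets borel" by (simp add: surface_measure_def)
    have [measurable_cong]: "sets surface_measure = sets borel" by simp
    define E where "E x = ennreal ((w x)\<^sup>2 + \<epsilon>\<^sup>2 * (norm (grad w x))\<^sup>2)" for x
    have [measurable]: "E \<in> borel_measurable borel" unfolding E_def by measurable
    define I where "I = cells \<Omega> \<epsilon> \<times> D"
    have "finite I" using fin D by (simp add: I_def)
    define Q where "Q = (\<lambda>(k, y). scaled_cell \<epsilon> (K y) k)"
    have VU [measurable]: "?V k \<in> sets borel" for k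
      using \<epsilon> by (intro borel_open open_scaled_cell open_filled_liquid) auto
    have Qp: "flat_patch (Q (k, y)) (e y) (\<epsilon> * h y) (M y) (?V k)" if "y \<in> D" for k y
      using flat_patch_affine[OF P[OF that] \<epsilon>] by (simp add: Q_def scaled_cell_eq)
    have Qb: "Q p \<in> sets borel" if "p \<in> I" for p
      using that Qp by (auto simp: I_def flat_patch_def compact_imp_closed)
    have cover: "?\<Gamma> \<subseteq> (\<Union>p\<in>I. Q p)"
    proof
      fix x assume "x \<in> ?\<Gamma>"
      then obtain k z where k: "k \<in> cells \<Omega> \<epsilon>" "z \<in> frontier Ys" "x = \<epsilon> *\<^sub>R (z + lattice_vec k)"
        using internal_boundary_subset[OF fin \<epsilon>, of Ys] by (auto simp: scaled_cell_def)
      then obtain y where "y \<in> D" "z \<in> K y" using D by blast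
      then have "(k, y) \<in> I" "x \<in> Q (k, y)" using k by (auto simp: I_def Q_def scaled_cell_def)
      then show "x \<in> (\<Union>p\<in>I. Q p)" by blast
    qed
    have patch: "(\<integral>\<^sup>+x. ennreal ((w x)\<^sup>2) * indicator (Q (k, y)) x \<partial>surface_measure)
        \<le> ennreal (c y / \<epsilon>) * (\<integral>\<^sup>+x\<in>?V k. E x \<partial>lborel)" if "k \<in> cells \<Omega> \<epsilon>" "y \<in> D" for k y
    proof -
      have hM: "0 < h y" "0 < M y" using P[OF that(2)] by (auto simp: flat_patch_def)
      have "(\<integral>\<^sup>+x. ennreal ((w x)\<^sup>2) * indicator (Q (k, y)) x \<partial>surface_measure)
        = (\<integral>\<^sup>+x. ennreal ((w x)\<^sup>2) \<partial>surface_on (Q (k, y)))"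
        by (rule nn_integral_surface_on[symmetric], rule Qb) (simp add: I_def that)
      also have "\<dots> \<le> ennreal (4 * flat_const TYPE(real^'n) (M y) / (\<epsilon> * h y))
          * (\<integral>\<^sup>+x\<in>?V k. ennreal ((w x)\<^sup>2 + (\<epsilon> * h y)\<^sup>2 * (norm (grad w x))\<^sup>2) \<partial>lborel)"
        using flat_patch_trace[OF Qp[OF that(2)] w] .
      also have "\<dots> \<le> ennreal (4 * flat_const TYPE(real^'n) (M y) / (\<epsilon> * h y))
          * (\<integral>\<^sup>+x. ennreal (1 + (h y)\<^sup>2) * (E x * indicator (?V k) x) \<partial>lborel)"
      proof (intro mult_left_mono nn_integral_mono)
        fix x
        have "(w x)\<^sup>2 + (\<epsilon> * h y)\<^sup>2 * (norm (grad w x))\<^sup>2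
           \<le> (1 + (h y)\<^sup>2) * ((w x)\<^sup>2 + \<epsilon>\<^sup>2 * (norm (grad w x))\<^sup>2)"
          by (simp add: algebra_simps power_mult_distrib)
        then have "ennreal ((w x)\<^sup>2 + (\<epsilon> * h y)\<^sup>2 * (norm (grad w x))\<^sup>2) \<le> ennreal (1 + (h y)\<^sup>2) * E x"
          unfolding E_def by (subst ennreal_mult[symmetric]) (auto intro: ennreal_leI simp del: ennreal_plus)
        then show "ennreal ((w x)\<^sup>2 + (\<epsilon> * h y)\<^sup>2 * (norm (grad w x))\<^sup>2) * indicator (?V k) x
            \<le> ennreal (1 + (h y)\<^sup>2) * (E x * indicator (?V k) x)"
          by (auto simp: indicator_def)
      qed auto
      also have "\<dots> = ennreal (4 * flat_const TYPE(real^'n) (M y) / (\<epsilon> * h y))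
          * (ennreal (1 + (h y)\<^sup>2) * (\<integral>\<^sup>+x\<in>?V k. E x \<partial>lborel))"
        by (subst nn_integral_cmult) auto
      also have "\<dots> = ennreal (4 * flat_const TYPE(real^'n) (M y) / (\<epsilon> * h y) * (1 + (h y)\<^sup>2))
           * (\<integral>\<^sup>+x\<in>?V k. E x \<partial>lborel)"
        using \<epsilon> hM by (subst ennreal_mult) (auto simp: flat_const_def mult.assoc)
      also have "4 * flat_const TYPE(real^'n) (M y) / (\<epsilon> * h y) * (1 + (h y)\<^sup>2) = c y / \<epsilon>"
        by (simp add: c_def)
      finally show ?thesis .
    qed
    have "(\<integral>\<^sup>+x. ennreal ((w x)\<^sup>2) \<partial>surface_on ?\<Gamma>)
       = (\<integral>\<^sup>+x. ennreal ((w x)\<^sup>2) * indicator ?\<Gamma> x \<partial>surface_measure)"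
      by (rule nn_integral_surface_on) (simp add: internal_boundary_def)
    also have "\<dots> \<le> (\<integral>\<^sup>+x. (\<Sum>p\<in>I. ennreal ((w x)\<^sup>2) * indicator (Q p) x) \<partial>surface_measure)"
    proof (intro nn_integral_mono)
      fix x
      show "ennreal ((w x)\<^sup>2) * indicator ?\<Gamma> x \<le> (\<Sum>p\<in>I. ennreal ((w x)\<^sup>2) * indicator (Q p) x)"
      proof (cases "x \<in> ?\<Gamma>")
        case True
        then obtain p where p: "p \<in> I" "x \<in> Q p" using cover by blast
        have "ennreal ((w x)\<^sup>2) * indicator (Q p) x \<le> (\<Sum>p\<in>I. ennreal ((w x)\<^sup>2) * indicator (Q p) x)"
          using \<open>finite I\<close> p by (intro member_le_sum) auto
        then show ?thesis using p True by simp
      qed simp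
    qed
    also have "\<dots> = (\<Sum>p\<in>I. (\<integral>\<^sup>+x. ennreal ((w x)\<^sup>2) * indicator (Q p) x \<partial>surface_measure))"
    proof (intro nn_integral_sum borel_measurable_times_ennreal)
      show "(\<lambda>x. ennreal ((w x)\<^sup>2)) \<in> borel_measurable surface_measure" by measurable
      show "indicator (Q p) \<in> borel_measurable surface_measure" if "p \<in> I" for p
        using Qb[OF that] by (intro borel_measurable_indicator) simp
    qed
    also have "\<dots> = (\<Sum>k\<in>cells \<Omega> \<epsilon>. \<Sum>y\<in>D. (\<integral>\<^sup>+x. ennreal ((w x)\<^sup>2) * indicator (Q (k, y)) x \<partial>surface_measure))"
      by (simp add: I_def sum.cartesian_product split_beta)
    also have "\<dots> \<le> (\<Sum>k\<in>cells \<Omega> \<epsilon>. \<Sum>y\<in>D. ennreal (c y / \<epsilon>) * (\<integral>\<^sup>+x\<in>?V k. E x \<partial>lborel))"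
      by (intro sum_mono patch)
    also have "\<dots> = (\<Sum>k\<in>cells \<Omega> \<epsilon>. ennreal (sum c D / \<epsilon>) * (\<integral>\<^sup>+x\<in>?V k. E x \<partial>lborel))"
    proof -
      have "(\<Sum>y\<in>D. ennreal (c y / \<epsilon>)) = ennreal (sum c D / \<epsilon>)"
        using c \<epsilon> by (subst sum_ennreal) (auto simp: sum_divide_distrib)
      then show ?thesis by (simp add: sum_distrib_right[symmetric])
    qed
    also have "\<dots> = ennreal (sum c D / \<epsilon>) * (\<integral>\<^sup>+x. (\<Sum>k\<in>cells \<Omega> \<epsilon>. E x * indicator (?V k) x) \<partial>lborel)"
      by (subst nn_integral_sum) (auto simp: sum_distrib_left)
    also have "\<dots> \<le> ennreal (sum c D / \<epsilon>) * (\<integral>\<^sup>+x\<in>?U. E x \<partial>lborel)"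
    proof (intro mult_left_mono nn_integral_mono)
      fix x
      \<comment> \<open>The pieces lie in disjoint open cells, so at most one summand is
        nonzero.\<close>
      show "(\<Sum>k\<in>cells \<Omega> \<epsilon>. E x * indicator (?V k) x) \<le> E x * indicator ?U x"
      proof (cases "\<exists>k\<in>cells \<Omega> \<epsilon>. x \<in> ?V k")
        case True
        then obtain k where k: "k \<in> cells \<Omega> \<epsilon>" "x \<in> ?V k" by blast
        have "x \<notin> ?V k'" if "k' \<noteq> k" for k'
        proof -
          have "?V k' \<subseteq> scaled_cell \<epsilon> unit_cell k'" "?V k \<subseteq> scaled_cell \<epsilon> unit_cell k"
            by (intro scaled_cell_mono; simp add: filled_liquid_def)+
          then show ?thesis using scaled_unit_cells_disjoint[of \<epsilon> k' k] that k \<epsilon> by auto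
        qed
        then have "(\<Sum>k'\<in>cells \<Omega> \<epsilon>. E x * indicator (?V k') x) = (\<Sum>k'\<in>cells \<Omega> \<epsilon>. if k' = k then E x else 0)"
          using k by (intro sum.cong) auto
        also have "\<dots> = E x" using fin k by simp
        finally show ?thesis using scaled_filled_liquid_subset[OF k(1) \<epsilon>, of Yl] k by auto
      next
        case False
        then have "(\<Sum>k\<in>cells \<Omega> \<epsilon>. E x * indicator (?V k) x) = 0" by (intro sum.neutral) auto
        then show ?thesis by simp
      qed
    qed auto
    also have "(\<integral>\<^sup>+x\<in>?U. E x \<partial>lborel) = (\<integral>\<^sup>+x. E x \<partial>lebesgue_on ?U)"
      by (rule nn_integral_lebesgue_on_open[symmetric]) (simp add: liquid_part_def)
    finally show "(\<integral>\<^sup>+x. ennreal ((w x)\<^sup>2) \<partial>surface_on ?\<Gamma>)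
      \<le> ennreal (sum c D / \<epsilon>) * (\<integral>\<^sup>+x. ennreal ((w x)\<^sup>2 + \<epsilon>\<^sup>2 * (norm (grad w x))\<^sup>2) \<partial>lebesgue_on ?U)"
      unfolding E_def .
  qed
qed

section \<open>Convergence in $L^2$ and traces\<close>

lemma in_L2_iff_nn_integral:
  "in_L2 M f \<longleftrightarrow> f \<in> borel_measurable M \<and> (\<integral>\<^sup>+x. ennreal ((norm (f x))\<^sup>2) \<partial>M) < \<infinity>"
proof
  assume f: "f \<in> borel_measurable M \<and> (\<integral>\<^sup>+x. ennreal ((norm (f x))\<^sup>2) \<partial>M) < \<infinity>"
  then have [measurable]: "f \<in> borel_measurable M" by blast
  have "integrable M (\<lambda>x. (norm (f x))\<^sup>2)"
    by (rule integrableI_bounded) (use f in auto)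
  with f show "in_L2 M f" by (simp add: in_L2_def)
next
  assume "in_L2 M f"
  then show "f \<in> borel_measurable M \<and> (\<integral>\<^sup>+x. ennreal ((norm (f x))\<^sup>2) \<partial>M) < \<infinity>"
    using integrableD(2)[of M "\<lambda>x. (norm (f x))\<^sup>2"] by (auto simp: in_L2_def integrable_iff_bounded)
qed

lemma norm_L2_nonneg: "0 \<le> norm_L2 M f"
  by (simp add: norm_L2_def)

lemma norm_L2_le:
  assumes "(\<integral>\<^sup>+x. ennreal ((norm (f x))\<^sup>2) \<partial>M) \<le> ennreal B" and "0 \<le> B"
  shows "norm_L2 M f \<le> sqrt B"
proof (cases "integrable M (\<lambda>x. (norm (f x))\<^sup>2)")
  case True
  then have "ennreal (\<integral>x. (norm (f x))\<^sup>2 \<partial>M) \<le> ennreal B"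
    using assms by (subst nn_integral_eq_integral[symmetric]) auto
  then show ?thesis using assms unfolding norm_L2_def by (simp add: ennreal_le_iff)
next
  \<comment> \<open>The Bochner integral of a non-integrable function is 0, so the bound is trivial
    here.\<close>
  case False
  then show ?thesis using assms by (simp add: norm_L2_def not_integrable_integral_eq)
qed

lemma square_norm_L2:
  assumes "in_L2 M f"
  shows "(\<integral>\<^sup>+x. ennreal ((norm (f x))\<^sup>2) \<partial>M) = ennreal ((norm_L2 M f)\<^sup>2)"
  using assms by (subst nn_integral_eq_integral) (auto simp: in_L2_def norm_L2_def)

lemma nn_integral_square_add_le:
  fixes f g :: "'a \<Rightarrow> 'b::euclidean_space"
  assumes [measurable]: "f \<in> borel_measurable M" "g \<in> borel_measurable M"
  shows "(\<integral>\<^sup>+x. ennreal ((norm (f x + g x))\<^sup>2) \<partial>M)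
    \<le> 2 * (\<integral>\<^sup>+x. ennreal ((norm (f x))\<^sup>2) \<partial>M) + 2 * (\<integral>\<^sup>+x. ennreal ((norm (g x))\<^sup>2) \<partial>M)"
proof -
  have "(\<integral>\<^sup>+x. ennreal ((norm (f x + g x))\<^sup>2) \<partial>M)
     \<le> (\<integral>\<^sup>+x. (2 * ennreal ((norm (f x))\<^sup>2) + 2 * ennreal ((norm (g x))\<^sup>2)) \<partial>M)"
  proof (rule nn_integral_mono)
    fix x
    have "(norm (f x + g x))\<^sup>2 \<le> (norm (f x) + norm (g x))\<^sup>2"
      by (intro power_mono norm_triangle_ineq) simp
    also have "\<dots> \<le> 2 * (norm (f x))\<^sup>2 + 2 * (norm (g x))\<^sup>2"
      using sum_squares_bound[of "norm (f x)" "norm (g x)"] by (simp add: power2_sum)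
    finally have "ennreal ((norm (f x + g x))\<^sup>2) \<le> ennreal (2 * (norm (f x))\<^sup>2 + 2 * (norm (g x))\<^sup>2)"
      by (rule ennreal_leI)
    then show "ennreal ((norm (f x + g x))\<^sup>2) \<le> 2 * ennreal ((norm (f x))\<^sup>2) + 2 * ennreal ((norm (g x))\<^sup>2)"
      by (simp add: ennreal_plus ennreal_mult)
  qed
  then show ?thesis by (simp add: nn_integral_add nn_integral_cmult)
qed

lemma L2_converges_subseq:
  assumes "L2_converges M w u" and "strict_mono r"
  shows "L2_converges M (w \<circ> r) u"
  using LIMSEQ_subseq_LIMSEQ[OF assms(1)[unfolded L2_converges_def] assms(2)]
  by (simp add: L2_converges_def o_def)

text \<open>Weighting the squared increments by $2^k$ makes the telescoping series converge absolutely
  almost everywhere.\<close>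

lemma L2_complete_fast:
  fixes w :: "nat \<Rightarrow> 'a \<Rightarrow> real"
  assumes w [measurable]: "\<And>k. w k \<in> borel_measurable M"
    and fast: "\<And>j k. k \<le> j \<Longrightarrow> (\<integral>\<^sup>+x. ennreal ((w j x - w k x)\<^sup>2) \<partial>M) \<le> ennreal ((1/4) ^ k)"
  shows "\<exists>g. g \<in> borel_measurable M \<and> L2_converges M w g"
proof -
  define S where "S x = (\<Sum>k. ennreal (2 ^ k * (w (Suc k) x - w k x)\<^sup>2))" for x
  have [measurable]: "S \<in> borel_measurable M" unfolding S_def by measurable
  have "(\<integral>\<^sup>+x. S x \<partial>M) = (\<Sum>k. \<integral>\<^sup>+x. ennreal (2 ^ k * (w (Suc k) x - w k x)\<^sup>2) \<partial>M)"
    unfolding S_def by (rule nn_integral_suminf) measurable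
  also have "\<dots> \<le> (\<Sum>k. ennreal ((1/2) ^ k))"
  proof (rule suminf_le)
    fix k
    have "(\<integral>\<^sup>+x. ennreal (2 ^ k * (w (Suc k) x - w k x)\<^sup>2) \<partial>M)
        = ennreal (2 ^ k) * (\<integral>\<^sup>+x. ennreal ((w (Suc k) x - w k x)\<^sup>2) \<partial>M)"
      by (subst nn_integral_cmult[symmetric]) (auto simp: ennreal_mult)
    also have "\<dots> \<le> ennreal (2 ^ k) * ennreal ((1/4) ^ k)"
      by (intro mult_left_mono fast) auto
    also have "\<dots> = ennreal ((1/2) ^ k)"
      by (subst ennreal_mult[symmetric]) (auto simp flip: power_mult_distrib)
    finally show "(\<integral>\<^sup>+x. ennreal (2 ^ k * (w (Suc k) x - w k x)\<^sup>2) \<partial>M) \<le> ennreal ((1/2) ^ k)" .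
  qed auto
  also have "\<dots> = ennreal (\<Sum>k. (1/2) ^ k)"
    by (rule suminf_ennreal2) (auto intro: summable_geometric)
  also have "\<dots> < \<infinity>" by simp
  finally have "AE x in M. S x \<noteq> \<infinity>"
    by (intro nn_integral_PInf_AE) auto
  then have conv: "AE x in M. (\<lambda>k. w k x) \<longlonglongrightarrow> lim (\<lambda>k. w k x)"
  proof eventually_elim
    fix x assume S: "S x \<noteq> \<infinity>"
    define a where "a k = 2 ^ k * (w (Suc k) x - w k x)\<^sup>2" for k
    have "summable a"
      by (rule summable_suminf_not_top) (use S in \<open>auto simp: a_def S_def\<close>)
    then have lim0: "a \<longlonglongrightarrow> 0" by (rule summable_LIMSEQ_zero)
    \<comment> \<open>Bounded weighted terms give increments of order 2^(-k/2), hence a geometric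
      majorant of the telescoping series.\<close>
    then obtain B where B: "\<And>k. norm (a k) \<le> B"
      using convergent_imp_Bseq[OF convergentI[OF lim0]] by (auto simp: Bseq_def)
    have geo: "norm (w (Suc k) x - w k x) \<le> sqrt B * (sqrt (1/2)) ^ k" for k
    proof -
      have "(w (Suc k) x - w k x)\<^sup>2 = a k * (1/2) ^ k"
        by (simp add: a_def flip: power_mult_distrib)
      also have "\<dots> \<le> B * (1/2) ^ k" using B[of k] by (intro mult_right_mono) auto
      finally have "sqrt ((w (Suc k) x - w k x)\<^sup>2) \<le> sqrt (B * (1/2) ^ k)" by (rule real_sqrt_le_mono)
      then have "norm (w (Suc k) x - w k x) \<le> sqrt (B * (1/2) ^ k)" by (simp only: real_sqrt_abs real_norm_def)
      then show ?thesis by (simp only: real_sqrt_mult real_sqrt_power)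
    qed
    have "summable (\<lambda>k. sqrt B * (sqrt (1/2)) ^ k)"
      by (intro summable_mult summable_geometric) (simp add: real_sqrt_divide)
    then have "summable (\<lambda>k. w (Suc k) x - w k x)"
      using geo by (rule summable_comparison_test')
    then have "convergent (\<lambda>n. \<Sum>k<n. w (Suc k) x - w k x)"
      by (simp add: summable_iff_convergent)
    then have "convergent (\<lambda>n. w n x - w 0 x)" by (simp add: sum_lessThan_telescope[of "\<lambda>n. w n x"])
    then have "convergent (\<lambda>n. w n x)" by (simp add: convergent_diff_const_right_iff)
    then show "(\<lambda>k. w k x) \<longlonglongrightarrow> lim (\<lambda>k. w k x)" by (simp add: convergent_LIMSEQ_iff)
  qed
  define g where "g x = lim (\<lambda>k. w k x)" for x
  have g [measurable]: "g \<in> borel_measurable M" unfolding g_def by measurable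
  have bound: "(\<integral>\<^sup>+x. ennreal ((w k x - g x)\<^sup>2) \<partial>M) \<le> ennreal ((1/4) ^ k)" for k
  proof -
    \<comment> \<open>The pointwise limit is written as a lower limit in \<open>j\<close>, so that
      Fatou carries the Cauchy bound over to \<open>g\<close>.\<close>
    have "(\<integral>\<^sup>+x. ennreal ((w k x - g x)\<^sup>2) \<partial>M)
        = (\<integral>\<^sup>+x. liminf (\<lambda>j. ennreal ((w j x - w k x)\<^sup>2)) \<partial>M)"
    proof (rule nn_integral_cong_AE)
      show "AE x in M. ennreal ((w k x - g x)\<^sup>2) = liminf (\<lambda>j. ennreal ((w j x - w k x)\<^sup>2))"
        using conv
      proof eventually_elim
        fix x assume "(\<lambda>k. w k x) \<longlonglongrightarrow> lim (\<lambda>k. w k x)"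
        then have "(\<lambda>j. ennreal ((w j x - w k x)\<^sup>2)) \<longlonglongrightarrow> ennreal ((g x - w k x)\<^sup>2)"
          unfolding g_def by (intro tendsto_intros)
        then have "liminf (\<lambda>j. ennreal ((w j x - w k x)\<^sup>2)) = ennreal ((g x - w k x)\<^sup>2)"
          by (intro lim_imp_Liminf) auto
        then show "ennreal ((w k x - g x)\<^sup>2) = liminf (\<lambda>j. ennreal ((w j x - w k x)\<^sup>2))"
          by (simp add: power2_commute)
      qed
    qed
    also have "\<dots> \<le> liminf (\<lambda>j. \<integral>\<^sup>+x. ennreal ((w j x - w k x)\<^sup>2) \<partial>M)"
      by (rule nn_integral_liminf) measurable
    also have "\<dots> \<le> liminf (\<lambda>j::nat. ennreal ((1/4) ^ k))"
      by (rule Liminf_mono) (use fast in \<open>auto simp: eventually_sequentially intro!: exI[of _ k]\<close>)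
    also have "\<dots> = ennreal ((1/4) ^ k)" by (simp add: Liminf_const)
    finally show ?thesis .
  qed
  have lim: "(\<lambda>k. ennreal ((1/4) ^ k)) \<longlonglongrightarrow> ennreal 0"
    by (intro tendsto_ennrealI LIMSEQ_realpow_zero) auto
  have "(\<lambda>k. \<integral>\<^sup>+x. ennreal ((w k x - g x)\<^sup>2) \<partial>M) \<longlonglongrightarrow> ennreal 0"
  proof (rule tendsto_sandwich[OF _ _ tendsto_const lim])
    show "\<forall>\<^sub>F k in sequentially. ennreal 0 \<le> (\<integral>\<^sup>+x. ennreal ((w k x - g x)\<^sup>2) \<partial>M)" by simp
    show "\<forall>\<^sub>F k in sequentially. (\<integral>\<^sup>+x. ennreal ((w k x - g x)\<^sup>2) \<partial>M) \<le> ennreal ((1/4) ^ k)"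
      using bound by (intro always_eventually allI)
  qed
  then have "L2_converges M w g" by (simp add: L2_converges_def)
  with g show ?thesis by blast
qed

text \<open>Thinning out the sequence produces the rate assumed in \<open>L2_complete_fast\<close>.
  Convergence along a subsequence is enough for a trace, which asks only for some approximating
  sequence.\<close>

lemma L2_complete:
  fixes w :: "nat \<Rightarrow> 'a \<Rightarrow> real"
  assumes w: "\<And>k. w k \<in> borel_measurable M"
    and cauchy: "\<And>\<eta>. 0 < \<eta> \<Longrightarrow> \<exists>N. \<forall>j\<ge>N. \<forall>k\<ge>N. (\<integral>\<^sup>+x. ennreal ((w j x - w k x)\<^sup>2) \<partial>M) \<le> ennreal \<eta>"
  shows "\<exists>r g. strict_mono r \<and> g \<in> borel_measurable M \<and> L2_converges M (w \<circ> r) g"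
proof -
  have "\<forall>i::nat. \<exists>N. \<forall>j\<ge>N. \<forall>k\<ge>N. (\<integral>\<^sup>+x. ennreal ((w j x - w k x)\<^sup>2) \<partial>M) \<le> ennreal ((1/4) ^ i)"
    by (intro allI cauchy) simp
  from choice[OF this] obtain N where N: "\<forall>i. \<forall>j\<ge>N i. \<forall>k\<ge>N i.
      (\<integral>\<^sup>+x. ennreal ((w j x - w k x)\<^sup>2) \<partial>M) \<le> ennreal ((1/4) ^ i)" ..
  \<comment> \<open>The sum dominates every earlier threshold \<open>N i\<close>, and the added
    \<open>k\<close> makes \<open>r\<close> strictly increasing.\<close>
  define r where "r k = (\<Sum>i\<le>k. N i) + k" for k
  have "strict_mono r" by (rule strict_monoI_Suc) (simp add: r_def)
  have ge: "N k \<le> r j" if "k \<le> j" for k j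
    using that member_le_sum[of k "{..j}" N] by (simp add: r_def)
  have "\<exists>g. g \<in> borel_measurable M \<and> L2_converges M (w \<circ> r) g"
  proof (rule L2_complete_fast)
    show "(w \<circ> r) k \<in> borel_measurable M" for k using w by simp
    show "(\<integral>\<^sup>+x. ennreal (((w \<circ> r) j x - (w \<circ> r) k x)\<^sup>2) \<partial>M) \<le> ennreal ((1/4) ^ k)" if "k \<le> j" for j k
      using N ge[OF that] ge[of k k] by simp
  qed
  then show ?thesis using \<open>strict_mono r\<close> by blast
qed

section \<open>Smooth approximations and the trace on a second part of the boundary\<close>

lemma Ck_on_diff:
  assumes "Ck_on k UNIV f" and "Ck_on k UNIV g"
  shows "Ck_on k UNIV (\<lambda>x. f x - g x)"
  using assms
proof (induction k arbitrary: f g)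
  case 0
  then show ?case by (auto intro: continuous_on_diff)
next
  case (Suc k)
  have d: "f differentiable (at x)" "g differentiable (at x)" for x
    using Suc.prems by (auto simp: differentiable_on_def)
  have "frechet_derivative (\<lambda>x. f x - g x) (at x) = (\<lambda>v. frechet_derivative f (at x) v - frechet_derivative g (at x) v)" for x
    using d[of x] frechet_derivative_works
    by (intro frechet_derivative_at[symmetric] has_derivative_diff) blast+
  then show ?case using Suc.prems by (auto intro!: Suc.IH differentiable_on_diff)
qed

lemma smooth_on_diff: "smooth_on UNIV f \<Longrightarrow> smooth_on UNIV g \<Longrightarrow> smooth_on UNIV (\<lambda>x. f x - g x)"
  by (simp add: smooth_on_def Ck_on_diff)

lemma grad_diff:
  assumes "smooth_on UNIV f" and "smooth_on UNIV g"
  shows "grad (\<lambda>x. f x - g x) x = grad f x - grad g x"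
proof -
  have "frechet_derivative (\<lambda>x. f x - g x) (at x) = (\<lambda>v. frechet_derivative f (at x) v - frechet_derivative g (at x) v)"
    using smooth_differentiable[OF assms(1), of x] smooth_differentiable[OF assms(2), of x] frechet_derivative_works
    by (intro frechet_derivative_at[symmetric] has_derivative_diff) blast+
  then show ?thesis by (simp add: grad_def vec_eq_iff)
qed

lemma borel_measurable_lebesgue_on:
  assumes "f \<in> borel_measurable borel"
  shows "f \<in> borel_measurable (lebesgue_on U)"
  using assms by (intro measurable_restrict_space1 measurable_completion) simp

lemma borel_measurable_surface_on:
  assumes "f \<in> borel_measurable borel"
  shows "f \<in> borel_measurable (surface_on \<Gamma>)"
  unfolding surface_on_def
proof (rule measurable_restrict_space1)
  have "sets surface_measure = sets borel" by (simp add: surface_measure_def)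
  then show "f \<in> borel_measurable surface_measure" using assms measurable_cong_sets by blast
qed

text \<open>Freezes one scale and keeps of the geometry only the trace inequality for smooth
  functions, from which the passage to the limit is made.\<close>

locale boundary_trace_setting =
  fixes U \<Gamma> :: "(real^'n) set" and c \<epsilon> :: real
  assumes c: "0 \<le> c"
    and trace_le: "\<And>w. smooth_on UNIV w \<Longrightarrow> (\<integral>\<^sup>+x. ennreal ((w x)\<^sup>2) \<partial>surface_on \<Gamma>)
      \<le> ennreal c * (\<integral>\<^sup>+x. ennreal ((w x)\<^sup>2 + \<epsilon>\<^sup>2 * (norm (grad w x))\<^sup>2) \<partial>lebesgue_on U)"
begin

text \<open>Squared distance in the $H^1$ norm with gradient weight \<epsilon>^2. The target is a
  function together with a separate gradient, so that it can be \<open>u\<close> with its weak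
  gradient, zero, or another smooth function.\<close>

definition sqdist :: "(real^'n \<Rightarrow> real) \<Rightarrow> (real^'n \<Rightarrow> real^'n) \<Rightarrow> (real^'n \<Rightarrow> real) \<Rightarrow> ennreal" where
  "sqdist u G w = (\<integral>\<^sup>+x. ennreal ((norm (w x - u x))\<^sup>2) \<partial>lebesgue_on U)
     + ennreal (\<epsilon>\<^sup>2) * (\<integral>\<^sup>+x. ennreal ((norm (grad w x - G x))\<^sup>2) \<partial>lebesgue_on U)"

lemma smooth_measurable:
  assumes "smooth_on UNIV w"
  shows "w \<in> borel_measurable (lebesgue_on U)" "grad w \<in> borel_measurable (lebesgue_on U)"
    "w \<in> borel_measurable (surface_on \<Gamma>)"
  using smooth_continuous[OF assms] smooth_continuous_grad[OF assms]
  by (auto intro!: borel_measurable_lebesgue_on borel_measurable_surface_on borel_measurable_continuous_onI)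

lemma energy_split:
  assumes "smooth_on UNIV w"
  shows "(\<integral>\<^sup>+x. ennreal ((w x)\<^sup>2 + \<epsilon>\<^sup>2 * (norm (grad w x))\<^sup>2) \<partial>lebesgue_on U) = sqdist (\<lambda>_. 0) (\<lambda>_. 0) w"
proof -
  note [measurable] = smooth_measurable[OF assms]
  have "(\<integral>\<^sup>+x. ennreal ((w x)\<^sup>2 + \<epsilon>\<^sup>2 * (norm (grad w x))\<^sup>2) \<partial>lebesgue_on U)
     = (\<integral>\<^sup>+x. (ennreal ((w x)\<^sup>2) + ennreal (\<epsilon>\<^sup>2) * ennreal ((norm (grad w x))\<^sup>2)) \<partial>lebesgue_on U)"
    by (intro nn_integral_cong) (simp add: ennreal_plus ennreal_mult)
  also have "\<dots> = sqdist (\<lambda>_. 0) (\<lambda>_. 0) w"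
    by (simp add: sqdist_def nn_integral_add nn_integral_cmult)
  finally show ?thesis .
qed

lemma sqdist_triangle:
  assumes w: "smooth_on UNIV w"
    and u [measurable]: "u \<in> borel_measurable (lebesgue_on U)" "G \<in> borel_measurable (lebesgue_on U)"
    and v [measurable]: "v \<in> borel_measurable (lebesgue_on U)" "H \<in> borel_measurable (lebesgue_on U)"
  shows "sqdist v H w \<le> 2 * sqdist u G w +
     2 * ((\<integral>\<^sup>+x. ennreal ((norm (u x - v x))\<^sup>2) \<partial>lebesgue_on U)
     + ennreal (\<epsilon>\<^sup>2) * (\<integral>\<^sup>+x. ennreal ((norm (G x - H x))\<^sup>2) \<partial>lebesgue_on U))"
proof -
  note [measurable] = smooth_measurable[OF w]
  let ?I = "\<lambda>f :: real^'n \<Rightarrow> real. \<integral>\<^sup>+x. ennreal ((norm (f x))\<^sup>2) \<partial>lebesgue_on U"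
  let ?J = "\<lambda>f :: real^'n \<Rightarrow> real^'n. \<integral>\<^sup>+x. ennreal ((norm (f x))\<^sup>2) \<partial>lebesgue_on U"
  have 1: "?I (\<lambda>x. w x - v x) \<le> 2 * ?I (\<lambda>x. w x - u x) + 2 * ?I (\<lambda>x. u x - v x)"
    using nn_integral_square_add_le[of "\<lambda>x. w x - u x" "lebesgue_on U" "\<lambda>x. u x - v x"] by simp
  have 2: "?J (\<lambda>x. grad w x - H x) \<le> 2 * ?J (\<lambda>x. grad w x - G x) + 2 * ?J (\<lambda>x. G x - H x)"
    using nn_integral_square_add_le[of "\<lambda>x. grad w x - G x" "lebesgue_on U" "\<lambda>x. G x - H x"] by simp
  have "sqdist v H w \<le> (2 * ?I (\<lambda>x. w x - u x) + 2 * ?I (\<lambda>x. u x - v x))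
      + ennreal (\<epsilon>\<^sup>2) * (2 * ?J (\<lambda>x. grad w x - G x) + 2 * ?J (\<lambda>x. G x - H x))"
    unfolding sqdist_def by (intro add_mono mult_left_mono 1 2) auto
  also have "\<dots> = 2 * sqdist u G w + 2 * (?I (\<lambda>x. u x - v x) + ennreal (\<epsilon>\<^sup>2) * ?J (\<lambda>x. G x - H x))"
    by (simp add: sqdist_def algebra_simps)
  finally show ?thesis .
qed

lemma sqdist_tendsto:
  assumes "L2_converges (lebesgue_on U) w u" and "L2_converges (lebesgue_on U) (\<lambda>k. grad (w k)) G"
  shows "(\<lambda>k. sqdist u G (w k)) \<longlonglongrightarrow> 0"
proof -
  have "(\<lambda>k. sqdist u G (w k)) \<longlonglongrightarrow> 0 + ennreal (\<epsilon>\<^sup>2) * 0"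
    unfolding sqdist_def using assms unfolding L2_converges_def
    by (intro tendsto_add ennreal_tendsto_cmult) auto
  then show ?thesis by simp
qed

text \<open>The trace is compared with a smooth approximant on the boundary, and the approximant
  with \<open>u\<close> in the volume. Both errors vanish in the limit; each splitting of a square
  costs a factor 2, which gives the 4.\<close>

lemma trace_bound:
  assumes u: "in_L2 (lebesgue_on U) u" "in_L2 (lebesgue_on U) (weak_gradient U u)"
    and g: "has_trace U \<Gamma> u g"
  shows "(\<integral>\<^sup>+x. ennreal ((norm (g x))\<^sup>2) \<partial>surface_on \<Gamma>)
    \<le> ennreal (4 * c * ((norm_L2 (lebesgue_on U) u)\<^sup>2 + \<epsilon>\<^sup>2 * (norm_L2 (lebesgue_on U) (weak_gradient U u))\<^sup>2))"
proof -
  let ?G = "weak_gradient U u"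
  obtain w where w: "\<And>k. smooth_on UNIV (w k)"
    and conv: "L2_converges (lebesgue_on U) w u" "L2_converges (lebesgue_on U) (\<lambda>k. grad (w k)) ?G"
      "L2_converges (surface_on \<Gamma>) w g"
    using g by (auto simp: has_trace_def)
  have [measurable]: "u \<in> borel_measurable (lebesgue_on U)" "?G \<in> borel_measurable (lebesgue_on U)"
    "g \<in> borel_measurable (surface_on \<Gamma>)"
    using u g by (auto simp: in_L2_def has_trace_def)
  note [measurable] = smooth_measurable[OF w]
  define N where "N = ennreal ((norm_L2 (lebesgue_on U) u)\<^sup>2) + ennreal (\<epsilon>\<^sup>2) * ennreal ((norm_L2 (lebesgue_on U) ?G)\<^sup>2)"
  define a where "a k = (\<integral>\<^sup>+x. ennreal ((norm (w k x - g x))\<^sup>2) \<partial>surface_on \<Gamma>)" for k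
  have "(\<integral>\<^sup>+x. ennreal ((norm (g x))\<^sup>2) \<partial>surface_on \<Gamma>)
      \<le> 2 * a k + 2 * (ennreal c * (2 * sqdist u ?G (w k) + 2 * N))" for k
  proof -
    have "(\<integral>\<^sup>+x. ennreal ((norm (g x))\<^sup>2) \<partial>surface_on \<Gamma>)
      \<le> 2 * (\<integral>\<^sup>+x. ennreal ((norm (g x - w k x))\<^sup>2) \<partial>surface_on \<Gamma>)
        + 2 * (\<integral>\<^sup>+x. ennreal ((norm (w k x))\<^sup>2) \<partial>surface_on \<Gamma>)"
      using nn_integral_square_add_le[of "\<lambda>x. g x - w k x" "surface_on \<Gamma>" "w k"] by simp
    also have "(\<integral>\<^sup>+x. ennreal ((norm (g x - w k x))\<^sup>2) \<partial>surface_on \<Gamma>) = a k"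
      by (simp add: a_def norm_minus_commute power2_commute)
    also have "(\<integral>\<^sup>+x. ennreal ((norm (w k x))\<^sup>2) \<partial>surface_on \<Gamma>) \<le> ennreal c * sqdist (\<lambda>_. 0) (\<lambda>_. 0) (w k)"
      using trace_le[OF w] energy_split[OF w] by simp
    also have "sqdist (\<lambda>_. 0) (\<lambda>_. 0) (w k) \<le> 2 * sqdist u ?G (w k) + 2 * N"
      using sqdist_triangle[OF w, of u ?G "\<lambda>_. 0" "\<lambda>_. 0" k] square_norm_L2[OF u(1)] square_norm_L2[OF u(2)]
      by (simp add: N_def)
    finally show ?thesis by (simp add: add_left_mono mult_left_mono)
  qed
  moreover have "(\<lambda>k. 2 * a k + 2 * (ennreal c * (2 * sqdist u ?G (w k) + 2 * N)))
     \<longlonglongrightarrow> 2 * 0 + 2 * (ennreal c * (2 * 0 + 2 * N))"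
  proof -
    have "a \<longlonglongrightarrow> 0" using conv(3) by (simp add: a_def[abs_def] L2_converges_def)
    moreover have "N < top" by (simp add: N_def ennreal_mult_less_top)
    ultimately show ?thesis using sqdist_tendsto[OF conv(1,2)]
      by (intro tendsto_add ennreal_tendsto_cmult tendsto_const) auto
  qed
  ultimately have "(\<integral>\<^sup>+x. ennreal ((norm (g x))\<^sup>2) \<partial>surface_on \<Gamma>) \<le> 2 * 0 + 2 * (ennreal c * (2 * 0 + 2 * N))"
    by (intro LIMSEQ_le_const) auto
  also have "\<dots> = 4 * ennreal c * N" by (simp add: mult.assoc mult.left_commute)
  also have "N = ennreal ((norm_L2 (lebesgue_on U) u)\<^sup>2 + \<epsilon>\<^sup>2 * (norm_L2 (lebesgue_on U) ?G)\<^sup>2)"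
    by (simp add: N_def ennreal_plus ennreal_mult)
  also have "4 * ennreal c * ennreal ((norm_L2 (lebesgue_on U) u)\<^sup>2 + \<epsilon>\<^sup>2 * (norm_L2 (lebesgue_on U) ?G)\<^sup>2)
     = ennreal (4 * c * ((norm_L2 (lebesgue_on U) u)\<^sup>2 + \<epsilon>\<^sup>2 * (norm_L2 (lebesgue_on U) ?G)\<^sup>2))"
    using c by (simp add: ennreal_mult del: ennreal_plus)
  finally show ?thesis .
qed

text \<open>The trace on the other part supplies smooth functions converging in $H^1(U)$. The trace
  inequality applied to their differences makes them a Cauchy sequence on \<Gamma>, and completeness
  gives the limit.\<close>

lemma trace_exists:
  assumes u: "in_L2 (lebesgue_on U) u" "in_L2 (lebesgue_on U) (weak_gradient U u)"
    and "has_trace U \<Gamma>' u g'"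
  shows "\<exists>g. has_trace U \<Gamma> u g"
proof -
  let ?G = "weak_gradient U u"
  obtain w where w: "\<And>k. smooth_on UNIV (w k)"
    and conv: "L2_converges (lebesgue_on U) w u" "L2_converges (lebesgue_on U) (\<lambda>k. grad (w k)) ?G"
    using assms(3) by (auto simp: has_trace_def)
  have [measurable]: "u \<in> borel_measurable (lebesgue_on U)" "?G \<in> borel_measurable (lebesgue_on U)"
    using u by (auto simp: in_L2_def)
  note [measurable] = smooth_measurable[OF w]
  note lim = sqdist_tendsto[OF conv]
  have diff: "(\<integral>\<^sup>+x. ennreal ((w j x - w k x)\<^sup>2) \<partial>surface_on \<Gamma>)
      \<le> ennreal c * (2 * sqdist u ?G (w j) + 2 * sqdist u ?G (w k))" for j k
  proof -
    have s: "smooth_on UNIV (\<lambda>x. w j x - w k x)" by (rule smooth_on_diff[OF w w])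
    have "(\<integral>\<^sup>+x. ennreal ((w j x - w k x)\<^sup>2) \<partial>surface_on \<Gamma>)
       \<le> ennreal c * sqdist (\<lambda>_. 0) (\<lambda>_. 0) (\<lambda>x. w j x - w k x)"
      using trace_le[OF s] energy_split[OF s] by simp
    \<comment> \<open>The size of the difference is the distance between two approximants, so the
      triangle inequality through \<open>u\<close> applies.\<close>
    also have "sqdist (\<lambda>_. 0) (\<lambda>_. 0) (\<lambda>x. w j x - w k x) = sqdist (w k) (grad (w k)) (w j)"
      by (simp add: sqdist_def grad_diff[OF w w])
    also have "\<dots> \<le> 2 * sqdist u ?G (w j) + 2 * sqdist u ?G (w k)"
    proof -
      have "(\<integral>\<^sup>+x. ennreal ((norm (u x - w k x))\<^sup>2) \<partial>lebesgue_on U)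
         + ennreal (\<epsilon>\<^sup>2) * (\<integral>\<^sup>+x. ennreal ((norm (?G x - grad (w k) x))\<^sup>2) \<partial>lebesgue_on U) = sqdist u ?G (w k)"
        by (simp add: sqdist_def norm_minus_commute power2_commute)
      then show ?thesis using sqdist_triangle[OF w, of u ?G "w k" "grad (w k)" j] by simp
    qed
    finally show ?thesis by (simp add: mult_left_mono)
  qed
  have "\<exists>r g. strict_mono r \<and> g \<in> borel_measurable (surface_on \<Gamma>) \<and> L2_converges (surface_on \<Gamma>) (w \<circ> r) g"
  proof (rule L2_complete)
    fix \<eta> :: real assume "0 < \<eta>"
    have "(\<lambda>k. ennreal c * (2 * sqdist u ?G (w k))) \<longlonglongrightarrow> ennreal c * (2 * 0)"
      by (intro ennreal_tendsto_cmult lim) auto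
    then have "eventually (\<lambda>k. ennreal c * (2 * sqdist u ?G (w k)) < ennreal (\<eta> / 2)) sequentially"
      using \<open>0 < \<eta>\<close> by (intro order_tendstoD) auto
    then obtain N where N: "\<And>k. N \<le> k \<Longrightarrow> ennreal c * (2 * sqdist u ?G (w k)) < ennreal (\<eta> / 2)"
      by (auto simp: eventually_sequentially)
    have "(\<integral>\<^sup>+x. ennreal ((w j x - w k x)\<^sup>2) \<partial>surface_on \<Gamma>) \<le> ennreal \<eta>" if "N \<le> j" "N \<le> k" for j k
    proof -
      have "(\<integral>\<^sup>+x. ennreal ((w j x - w k x)\<^sup>2) \<partial>surface_on \<Gamma>) \<le> ennreal (\<eta> / 2) + ennreal (\<eta> / 2)"
        using diff[of j k] add_mono[OF less_imp_le[OF N[OF that(1)]] less_imp_le[OF N[OF that(2)]]]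
        by (simp add: distrib_left)
      also have "\<dots> = ennreal \<eta>" using \<open>0 < \<eta>\<close> by (subst ennreal_plus[symmetric]) auto
      finally show ?thesis .
    qed
    then show "\<exists>N. \<forall>j\<ge>N. \<forall>k\<ge>N. (\<integral>\<^sup>+x. ennreal ((w j x - w k x)\<^sup>2) \<partial>surface_on \<Gamma>) \<le> ennreal \<eta>" by blast
  qed (rule smooth_measurable[OF w])
  then obtain r g where r: "strict_mono r" and g [measurable]: "g \<in> borel_measurable (surface_on \<Gamma>)"
    and rg: "L2_converges (surface_on \<Gamma>) (w \<circ> r) g" by blast
  have "in_L2 (surface_on \<Gamma>) g"
  proof -
    \<comment> \<open>One approximant at finite distance from both \<open>g\<close> and
      \<open>u\<close> is enough: its own boundary norm is finite by the trace inequality.\<close>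
    have "eventually (\<lambda>k. (\<integral>\<^sup>+x. ennreal ((norm (w (r k) x - g x))\<^sup>2) \<partial>surface_on \<Gamma>) < 1) sequentially"
      using rg unfolding L2_converges_def o_def by (rule order_tendstoD) simp
    moreover have "eventually (\<lambda>k. sqdist u ?G (w (r k)) < 1) sequentially"
      using LIMSEQ_subseq_LIMSEQ[OF lim r] unfolding o_def by (rule order_tendstoD) simp
    ultimately obtain k where k: "(\<integral>\<^sup>+x. ennreal ((norm (w (r k) x - g x))\<^sup>2) \<partial>surface_on \<Gamma>) < 1"
      "sqdist u ?G (w (r k)) < 1"
      using eventually_happens'[OF sequentially_bot eventually_conj] by blast
    have "sqdist (\<lambda>_. 0) (\<lambda>_. 0) (w (r k)) \<le> 2 * sqdist u ?G (w (r k)) +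
       2 * (ennreal ((norm_L2 (lebesgue_on U) u)\<^sup>2) + ennreal (\<epsilon>\<^sup>2) * ennreal ((norm_L2 (lebesgue_on U) ?G)\<^sup>2))"
      using sqdist_triangle[OF w, of u ?G "\<lambda>_. 0" "\<lambda>_. 0" "r k"] square_norm_L2[OF u(1)] square_norm_L2[OF u(2)]
      by simp
    also have "\<dots> < top"
      using k(2) less_trans[OF k(2) ennreal_one_less_top] by (simp add: ennreal_mult_less_top)
    finally have "ennreal c * sqdist (\<lambda>_. 0) (\<lambda>_. 0) (w (r k)) < top" by (simp add: ennreal_mult_less_top)
    then have wfin: "(\<integral>\<^sup>+x. ennreal ((norm (w (r k) x))\<^sup>2) \<partial>surface_on \<Gamma>) < top"
      using trace_le[OF w] energy_split[OF w] by (auto intro: le_less_trans)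
    have "(\<integral>\<^sup>+x. ennreal ((norm (g x))\<^sup>2) \<partial>surface_on \<Gamma>)
      \<le> 2 * (\<integral>\<^sup>+x. ennreal ((norm (g x - w (r k) x))\<^sup>2) \<partial>surface_on \<Gamma>)
        + 2 * (\<integral>\<^sup>+x. ennreal ((norm (w (r k) x))\<^sup>2) \<partial>surface_on \<Gamma>)"
      using nn_integral_square_add_le[of "\<lambda>x. g x - w (r k) x" "surface_on \<Gamma>" "w (r k)"] by simp
    also have "\<dots> < top"
      using wfin less_trans[OF k(1) ennreal_one_less_top]
      by (simp add: ennreal_mult_less_top norm_minus_commute power2_commute)
    finally show ?thesis by (simp add: in_L2_iff_nn_integral)
  qed
  moreover have "L2_converges (lebesgue_on U) (\<lambda>k. grad ((w \<circ> r) k)) ?G"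
    using L2_converges_subseq[OF conv(2) r] by (simp add: o_def)
  ultimately have "has_trace U \<Gamma> u g"
    unfolding has_trace_def using w rg L2_converges_subseq[OF conv(1) r]
    by (intro conjI exI[of _ "w \<circ> r"]) auto
  then show ?thesis by blast
qed

text \<open>\<open>boundary_trace\<close> is a choice. Existence makes the chosen function a trace,
  and the bound proved for every trace then applies to it.\<close>

lemma norm_boundary_trace_le:
  assumes "u \<in> space_V U \<Gamma>'"
  shows "norm_L2 (surface_on \<Gamma>) (boundary_trace U \<Gamma> u)
    \<le> sqrt (4 * c * ((norm_L2 (lebesgue_on U) u)\<^sup>2 + \<epsilon>\<^sup>2 * (norm_L2 (lebesgue_on U) (weak_gradient U u))\<^sup>2))"
proof -
  have u: "in_L2 (lebesgue_on U) u" "\<exists>G. has_weak_gradient U u G" "has_trace U \<Gamma>' u (\<lambda>_. 0)"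
    using assms by (auto simp: space_V_def in_H1_def)
  have "has_weak_gradient U u (weak_gradient U u)"
    unfolding weak_gradient_def using u(2) by (rule someI_ex)
  then have G: "in_L2 (lebesgue_on U) (weak_gradient U u)" by (simp add: has_weak_gradient_def)
  have "has_trace U \<Gamma> u (boundary_trace U \<Gamma> u)"
    unfolding boundary_trace_def using trace_exists[OF u(1) G u(3)] by (rule someI_ex)
  then show ?thesis using c by (intro norm_L2_le trace_bound u G) auto
qed

end

section \<open>Reaction and source terms\<close>

text \<open>The null set of exceptional points has a null image, so some level between the two values
  avoids it; at the last crossing of that level the function would have to increase.\<close>

lemma lipschitz_mono_if_AE_deriv_pos:
  fixes h :: "real \<Rightarrow> real"
  assumes lip: "L-lipschitz_on UNIV h" and "a \<le> b"
    and pos: "AE s in lebesgue. \<exists>D. (h has_real_derivative D) (at s) \<and> 0 < D"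
  shows "h a \<le> h b"
proof (rule ccontr)
  assume "\<not> h a \<le> h b"
  then have "h b < h a" by simp
  define N where "N = {s. \<not> (\<exists>D. (h has_real_derivative D) (at s) \<and> 0 < D)}"
  have "\<exists>N'\<in>null_sets lebesgue. N \<subseteq> N'"
    using pos by (simp add: eventually_ae_filter N_def)
  then obtain N' where N': "N' \<in> null_sets lebesgue" "N \<subseteq> N'" by blast
  have "negligible N'" using N'(1) by (simp add: negligible_iff_null_sets)
  then have "negligible N" using N'(2) by (rule negligible_subset)
  have "negligible (h ` N)"
  proof (rule negligible_locally_Lipschitz_image[OF _ \<open>negligible N\<close>])
    fix x assume "x \<in> N"
    show "\<exists>T B. open T \<and> x \<in> T \<and> (\<forall>y\<in>N \<inter> T. norm (h y - h x) \<le> B * norm (y - x))"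
      using lipschitz_onD[OF lip] by (intro exI[of _ UNIV] exI[of _ L]) (auto simp: dist_norm)
  qed simp
  moreover have "\<not> negligible {h b<..<h a}"
    using \<open>h b < h a\<close> negligible_interval(2)[of "h b" "h a"] by (simp add: box_real)
  ultimately have "\<not> {h b<..<h a} \<subseteq> h ` N"
    using negligible_subset by blast
  then obtain c where "c \<in> {h b<..<h a}" and cN: "c \<notin> h ` N" by blast
  then have c: "h b < c" "c < h a" by auto
  have cont: "continuous_on S h" for S
    using lipschitz_on_continuous_on[OF lip] continuous_on_subset by blast
  define X where "X = {a..b} \<inter> h -` {c..}"
  have "closed X" unfolding X_def by (intro continuous_closed_preimage cont) auto
  have "a \<in> X" using c \<open>a \<le> b\<close> by (simp add: X_def)
  have bdd: "bdd_above X" unfolding X_def by (auto intro: bdd_aboveI[of _ b])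
  define s where "s = Sup X"
  have "s \<in> X" unfolding s_def using \<open>a \<in> X\<close> bdd \<open>closed X\<close> by (intro closed_contains_Sup) auto
  have "s \<noteq> b" using \<open>s \<in> X\<close> c by (auto simp: X_def)
  then have s: "a \<le> s" "s < b" "c \<le> h s" using \<open>s \<in> X\<close> by (auto simp: X_def)
  have after: "h t < c" if "s < t" "t \<le> b" for t
  proof (rule ccontr)
    assume "\<not> h t < c"
    then have "t \<in> X" using that s by (auto simp: X_def)
    then have "t \<le> s" unfolding s_def using bdd by (rule cSup_upper)
    then show False using that by simp
  qed
  have "h s \<le> c"
  proof (rule ccontr)
    assume "\<not> h s \<le> c"
    then have "h b < c" "c < h s" using c by auto
    then obtain t where t: "s \<le> t" "t \<le> b" "h t = c"
      using IVT2'[of h b c s] s cont by auto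
    then show False using after[of t] \<open>\<not> h s \<le> c\<close> by (cases "s = t") auto
  qed
  then have "h s = c" using s by simp
  then have "s \<notin> N" using cN by blast
  then obtain D where D: "(h has_real_derivative D) (at s)" "0 < D" by (auto simp: N_def)
  then obtain d where d: "0 < d" "\<And>k. 0 < k \<Longrightarrow> k < d \<Longrightarrow> h s < h (s + k)"
    using DERIV_pos_inc_right[OF D(1,2)] by blast
  define k where "k = min (d / 2) (b - s)"
  have "0 < k" "k < d" "s + k \<le> b" using d s by (auto simp: k_def)
  then have "h s < h (s + k)" "h (s + k) < c" using d after[of "s + k"] by auto
  then show False using \<open>h s = c\<close> by simp
qed

text \<open>Subtracting a linear function from \<open>R\<close> leaves a nondecreasing one. Because
  \<open>R 0 = 0\<close>, it has the sign of its argument, which is the quadratic lower bound; the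
  Lipschitz constant gives the linear growth.\<close>

lemma reaction_coercive:
  assumes "reaction_function R" and "R 0 = 0"
  obtains \<delta> L where "0 < \<delta>" "\<And>s. \<delta> * s\<^sup>2 \<le> R s * s" "\<And>s. \<bar>R s\<bar> \<le> L * \<bar>s\<bar>"
proof -
  obtain L \<delta>0 \<delta>1 where L: "L-lipschitz_on UNIV R" and \<delta>: "0 < \<delta>0"
    and ae: "AE s in lebesgue. \<exists>D. (R has_real_derivative D) (at s) \<and> \<delta>0 \<le> D \<and> D \<le> \<delta>1"
    using assms by (auto simp: reaction_function_def)
  \<comment> \<open>Half of the lower bound \<delta>0 is subtracted, so that the derivative of
    \<open>h\<close> is strictly positive, as the monotonicity lemma demands.\<close>
  define h where "h s = R s - \<delta>0 / 2 * s" for s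
  have "(\<delta>0 / 2)-lipschitz_on UNIV (\<lambda>s::real. \<delta>0 / 2 * s)"
  proof (rule lipschitz_onI)
    fix x y :: real
    have "\<delta>0 / 2 * x - \<delta>0 / 2 * y = \<delta>0 / 2 * (x - y)" by (simp add: algebra_simps)
    then show "dist (\<delta>0 / 2 * x) (\<delta>0 / 2 * y) \<le> \<delta>0 / 2 * dist x y"
      using \<delta> by (simp only: dist_real_def abs_mult abs_of_pos half_gt_zero)
  qed (use \<delta> in simp)
  then have lip: "(L + \<delta>0 / 2)-lipschitz_on UNIV h"
    unfolding h_def by (rule lipschitz_on_diff[OF L])
  have pos: "AE s in lebesgue. \<exists>D. (h has_real_derivative D) (at s) \<and> 0 < D"
    using ae
  proof eventually_elim
    fix s assume "\<exists>D. (R has_real_derivative D) (at s) \<and> \<delta>0 \<le> D \<and> D \<le> \<delta>1"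
    then obtain D where D: "(R has_real_derivative D) (at s)" "\<delta>0 \<le> D" by blast
    have "(h has_real_derivative (D - \<delta>0 / 2)) (at s)"
      unfolding h_def using D by (auto intro!: derivative_eq_intros)
    moreover have "0 < D - \<delta>0 / 2" using D \<delta> by simp
    ultimately show "\<exists>D. (h has_real_derivative D) (at s) \<and> 0 < D" by blast
  qed
  have mono: "h a \<le> h b" if "a \<le> b" for a b
    by (rule lipschitz_mono_if_AE_deriv_pos[OF lip that pos])
  have "h 0 = 0" using assms by (simp add: h_def)
  have "\<delta>0 / 2 * s\<^sup>2 \<le> R s * s" for s
  proof -
    have "0 \<le> h s * s"
      using mono[of 0 s] mono[of s 0] \<open>h 0 = 0\<close> by (cases "0 \<le> s") (auto simp: mult_nonpos_nonpos)
    then show ?thesis by (simp add: h_def algebra_simps power2_eq_square)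
  qed
  moreover have "\<bar>R s\<bar> \<le> L * \<bar>s\<bar>" for s
    using lipschitz_onD[OF L, of s 0] assms by (simp add: dist_real_def)
  ultimately show thesis using that[of "\<delta>0 / 2" L] \<delta> by simp
qed


section \<open>Bound on the source that is uniform over all scales\<close>

lemma liquid_part_exhausts:
  fixes \<Omega> Yl Ys :: "(real^'n) set"
  assumes "bounded \<Omega>" and dec: "unit_cell_decomposition Yl Ys" and adm: "admissible_scale \<Omega> Yl Ys \<epsilon>"
  shows "\<exists>S. compact S \<and> S \<subseteq> \<Omega> \<and> (\<forall>W. open W \<longrightarrow> W \<subseteq> closure \<Omega> \<longrightarrow> W \<subseteq> liquid_part \<Omega> Yl \<epsilon> \<union> S)"
proof -
  have \<epsilon>: "0 < \<epsilon>" and cov: "closure \<Omega> = (\<Union>k\<in>cells \<Omega> \<epsilon>. closure (scaled_cell \<epsilon> unit_cell k))"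
    using adm by (auto simp: admissible_scale_def)
  have fin: "finite (cells \<Omega> \<epsilon>)" using \<open>bounded \<Omega>\<close> \<epsilon> by (rule finite_cells)
  have cell: "closure unit_cell = closure Yl \<union> closure Ys"
    using dec by (simp add: unit_cell_decomposition_def)
  \<comment> \<open>Closed inclusions lie in open cells contained in \<Omega>, so this finite union
    keeps away from the boundary of \<Omega>, where \<open>f\<close> is not controlled.\<close>
  define S where "S = (\<Union>k\<in>cells \<Omega> \<epsilon>. scaled_cell \<epsilon> (closure Ys) k)"
  define Z where "Z = (\<Union>k\<in>cells \<Omega> \<epsilon>. closure (scaled_cell \<epsilon> Yl k))"
  have "bounded (closure Ys)"
    using bounded_box closure_solid_subset_unit_cell[OF dec, unfolded unit_cell_def] by (rule bounded_subset)
  then have "compact (closure Ys)" by (simp add: compact_eq_bounded_closed)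
  then have "compact S"
    unfolding S_def scaled_cell_eq using fin
    by (intro compact_UN ballI compact_continuous_image continuous_intros) auto
  moreover have "S \<subseteq> \<Omega>"
  proof -
    have "scaled_cell \<epsilon> (closure Ys) k \<subseteq> \<Omega>" if "k \<in> cells \<Omega> \<epsilon>" for k
      using scaled_cell_mono[OF closure_solid_subset_unit_cell[OF dec], of \<epsilon> k] that by (auto simp: cells_def)
    then show ?thesis by (auto simp: S_def)
  qed
  moreover have "W \<subseteq> liquid_part \<Omega> Yl \<epsilon> \<union> S" if W: "open W" "W \<subseteq> closure \<Omega>" for W
  proof -
    have "closure \<Omega> \<subseteq> Z \<union> S"
    proof
      fix x assume "x \<in> closure \<Omega>"
      then obtain k where k: "k \<in> cells \<Omega> \<epsilon>" "x \<in> scaled_cell \<epsilon> (closure unit_cell) k"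
        unfolding cov closure_scaled_cell by blast
      then have "x \<in> scaled_cell \<epsilon> (closure Yl) k \<or> x \<in> scaled_cell \<epsilon> (closure Ys) k"
        unfolding cell by (auto simp: scaled_cell_def)
      then show "x \<in> Z \<union> S" using k by (auto simp: S_def Z_def closure_scaled_cell)
    qed
    \<comment> \<open>What remains of \<open>W\<close> is open and covered by the closed liquid
      pieces, hence inside their interior; this also takes care of the faces between cells.\<close>
    then have "W - S \<subseteq> interior Z"
      using W \<open>compact S\<close> by (intro interior_maximal) (auto simp: compact_imp_closed open_Diff)
    then show ?thesis by (auto simp: liquid_part_def Z_def)
  qed
  ultimately show ?thesis by blast
qed

lemma liquid_part_subset_closure:
  assumes "unit_cell_decomposition Yl Ys" and "admissible_scale \<Omega> Yl Ys \<epsilon>"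
  shows "liquid_part \<Omega> Yl \<epsilon> \<subseteq> closure \<Omega>"
proof -
  have cov: "closure \<Omega> = (\<Union>k\<in>cells \<Omega> \<epsilon>. closure (scaled_cell \<epsilon> unit_cell k))"
    using assms by (auto simp: admissible_scale_def)
  have "Yl \<subseteq> unit_cell" using assms by (simp add: unit_cell_decomposition_def)
  then have "closure (scaled_cell \<epsilon> Yl k) \<subseteq> closure (scaled_cell \<epsilon> unit_cell k)" for k
    by (intro closure_mono scaled_cell_mono)
  then have "(\<Union>k\<in>cells \<Omega> \<epsilon>. closure (scaled_cell \<epsilon> Yl k)) \<subseteq> closure \<Omega>" unfolding cov by (rule UN_mono[OF order_refl])
  then show ?thesis unfolding liquid_part_def using interior_subset by (rule order_trans[rotated])
qed

text \<open>Up to a compact subset of \<open>\<Omega>\<close>, where \<open>f\<close> is bounded, the liquid part at one scale contains the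
  liquid parts at all scales, so square integrability at one scale gives a uniform bound.\<close>

lemma uniform_source_bound:
  fixes \<Omega> Yl Ys :: "(real^'n) set" and f :: "real^'n \<Rightarrow> real"
  assumes bdd: "bounded \<Omega>" and dec: "unit_cell_decomposition Yl Ys" and f: "continuous_on \<Omega> f"
  shows "\<exists>F\<ge>0. \<forall>\<epsilon>. admissible_scale \<Omega> Yl Ys \<epsilon> \<longrightarrow> in_L2 (lebesgue_on (liquid_part \<Omega> Yl \<epsilon>)) f \<longrightarrow>
    norm_L2 (lebesgue_on (liquid_part \<Omega> Yl \<epsilon>)) f \<le> F"
proof (cases "\<exists>\<epsilon>. admissible_scale \<Omega> Yl Ys \<epsilon> \<and> in_L2 (lebesgue_on (liquid_part \<Omega> Yl \<epsilon>)) f")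
  case False
  then show ?thesis by (intro exI[of _ 0]) auto
next
  case True
  then obtain \<epsilon>0 where adm0: "admissible_scale \<Omega> Yl Ys \<epsilon>0" and L2: "in_L2 (lebesgue_on (liquid_part \<Omega> Yl \<epsilon>0)) f"
    by blast
  let ?V = "liquid_part \<Omega> Yl \<epsilon>0"
  obtain S where S: "compact S" "S \<subseteq> \<Omega>" "\<And>W. open W \<Longrightarrow> W \<subseteq> closure \<Omega> \<Longrightarrow> W \<subseteq> ?V \<union> S"
    using liquid_part_exhausts[OF bdd dec adm0] by blast
  obtain B where B: "\<And>x. x \<in> S \<Longrightarrow> norm (f x) \<le> B"
    using compact_imp_bounded[OF compact_continuous_image[OF continuous_on_subset[OF f S(2)] S(1)]]
    by (auto simp: bounded_iff)
  have sets: "?V \<in> sets lebesgue" "S \<in> sets lebesgue" "S \<in> sets lborel"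
    using S(1) by (auto simp: liquid_part_def compact_imp_closed)
  \<comment> \<open>One number for all scales: the integral of f^2 over the liquid part at
    \<epsilon>0, plus that of the bound B^2 over the compact remainder.\<close>
  define T where "T = (\<integral>\<^sup>+x. ennreal ((f x)\<^sup>2) * indicator ?V x + ennreal (B\<^sup>2) * indicator S x \<partial>lebesgue)"
  have "T < \<infinity>"
  proof -
    have "T = (\<integral>\<^sup>+x. ennreal ((f x)\<^sup>2) * indicator ?V x \<partial>lebesgue) + (\<integral>\<^sup>+x. ennreal (B\<^sup>2) * indicator S x \<partial>lebesgue)"
      unfolding T_def
    proof (rule nn_integral_add)
      have "f \<in> borel_measurable (lebesgue_on ?V)" using L2 by (simp add: in_L2_def)
      then have "(\<lambda>x. ennreal ((f x)\<^sup>2)) \<in> borel_measurable (lebesgue_on ?V)" by measurable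
      then show "(\<lambda>x. ennreal ((f x)\<^sup>2) * indicator ?V x) \<in> borel_measurable lebesgue"
        using sets(1) borel_measurable_restrict_space_iff_ennreal[of ?V lebesgue "\<lambda>x. ennreal ((f x)\<^sup>2)"] by blast
      show "(\<lambda>x. ennreal (B\<^sup>2) * indicator S x) \<in> borel_measurable lebesgue"
        using sets(2) by (intro borel_measurable_times_ennreal borel_measurable_indicator borel_measurable_const)
    qed
    also have "(\<integral>\<^sup>+x. ennreal (B\<^sup>2) * indicator S x \<partial>lebesgue) = ennreal (B\<^sup>2) * emeasure lborel S"
      using sets by (simp only: nn_integral_completion nn_integral_cmult_indicator)
    also have "(\<integral>\<^sup>+x. ennreal ((f x)\<^sup>2) * indicator ?V x \<partial>lebesgue) = (\<integral>\<^sup>+x. ennreal ((norm (f x))\<^sup>2) \<partial>lebesgue_on ?V)"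
      using sets by (subst nn_integral_restrict_space) auto
    also have "\<dots> + ennreal (B\<^sup>2) * emeasure lborel S < \<infinity>"
      using L2 emeasure_compact_finite[OF S(1)]
      by (simp add: in_L2_iff_nn_integral ennreal_mult_less_top)
    finally show ?thesis .
  qed
  then have T: "T = ennreal (enn2real T)" by simp
  show ?thesis
  proof (intro exI[of _ "sqrt (enn2real T)"] conjI allI impI)
    show "0 \<le> sqrt (enn2real T)" by simp
    fix \<epsilon> assume adm: "admissible_scale \<Omega> Yl Ys \<epsilon>"
    let ?U = "liquid_part \<Omega> Yl \<epsilon>"
    have U: "?U \<in> sets lebesgue" by (simp add: liquid_part_def)
    have "open ?U" by (simp add: liquid_part_def)
    then have sub: "?U \<subseteq> ?V \<union> S"
      using liquid_part_subset_closure[OF dec adm] by (rule S(3))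
    show "norm_L2 (lebesgue_on ?U) f \<le> sqrt (enn2real T)"
    proof (rule norm_L2_le)
      have "(\<integral>\<^sup>+x. ennreal ((norm (f x))\<^sup>2) \<partial>lebesgue_on ?U) = (\<integral>\<^sup>+x. ennreal ((f x)\<^sup>2) * indicator ?U x \<partial>lebesgue)"
        using U by (subst nn_integral_restrict_space) auto
      also have "\<dots> \<le> T"
        unfolding T_def
      proof (rule nn_integral_mono)
        fix x
        have "ennreal ((f x)\<^sup>2) \<le> ennreal (B\<^sup>2)" if "x \<in> S"
          using power_mono[OF B[OF that], of 2] by (auto intro!: ennreal_leI)
        then show "ennreal ((f x)\<^sup>2) * indicator ?U x
           \<le> ennreal ((f x)\<^sup>2) * indicator ?V x + ennreal (B\<^sup>2) * indicator S x"
          using sub by (auto simp: indicator_def)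
      qed
      finally show "(\<integral>\<^sup>+x. ennreal ((norm (f x))\<^sup>2) \<partial>lebesgue_on ?U) \<le> ennreal (enn2real T)"
        using T by simp
    qed simp
  qed
qed

section \<open>Energy estimate\<close>

text \<open>The new exceptional set is contained in the image of the old one under the inverse
  dilation, a Lipschitz image of a null set.\<close>

lemma AE_lebesgue_scale:
  fixes P :: "'a::euclidean_space \<Rightarrow> bool"
  assumes "AE y in lebesgue. P y" and "c \<noteq> 0"
  shows "AE x in lebesgue. P (c *\<^sub>R x)"
proof -
  obtain N where N: "N \<in> null_sets lebesgue" "{y. \<not> P y} \<subseteq> N"
    using assms(1) by (auto simp: eventually_ae_filter)
  have "negligible N" using N(1) by (simp add: negligible_iff_null_sets)
  have "negligible ((\<lambda>y. (1 / c) *\<^sub>R y) ` N)"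
  proof (rule negligible_locally_Lipschitz_image[OF _ \<open>negligible N\<close>])
    fix x assume "x \<in> N"
    show "\<exists>T B. open T \<and> x \<in> T \<and> (\<forall>y\<in>N \<inter> T. norm ((1 / c) *\<^sub>R y - (1 / c) *\<^sub>R x) \<le> B * norm (y - x))"
      by (intro exI[of _ UNIV] exI[of _ "\<bar>1 / c\<bar>"])
         (simp add: scaleR_diff_right[symmetric] del: scaleR_diff_right)
  qed simp
  then have "(\<lambda>y. (1 / c) *\<^sub>R y) ` N \<in> null_sets lebesgue" by (simp add: negligible_iff_null_sets)
  moreover have "{x. \<not> P (c *\<^sub>R x)} \<subseteq> (\<lambda>y. (1 / c) *\<^sub>R y) ` N"
  proof
    fix x assume "x \<in> {x. \<not> P (c *\<^sub>R x)}"
    then have "c *\<^sub>R x \<in> N" using N by auto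
    then show "x \<in> (\<lambda>y. (1 / c) *\<^sub>R y) ` N"
      using \<open>c \<noteq> 0\<close> by (intro image_eqI[of _ _ "c *\<^sub>R x"]) auto
  qed
  ultimately show ?thesis unfolding eventually_ae_filter by auto
qed

lemma measurable_lebesgue_scale:
  fixes A :: "'a::euclidean_space \<Rightarrow> 'b::topological_space"
  assumes A: "A \<in> borel_measurable lebesgue" and "c \<noteq> 0"
  shows "(\<lambda>x. A (c *\<^sub>R x)) \<in> borel_measurable lebesgue"
proof -
  have "(\<lambda>x. 0 + (\<Sum>j\<in>Basis. (c * (x \<bullet> j)) *\<^sub>R j)) \<in> (lebesgue :: 'a measure) \<rightarrow>\<^sub>M lebesgue"
    using \<open>c \<noteq> 0\<close> by (intro lebesgue_affine_measurable) auto
  moreover have "0 + (\<Sum>j\<in>Basis. (c * (x \<bullet> j)) *\<^sub>R j) = c *\<^sub>R x" for x :: 'a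
    by (simp add: scaleR_scaleR[symmetric] scaleR_sum_right[symmetric] euclidean_representation
        del: scaleR_scaleR)
  ultimately have "(\<lambda>x::'a. c *\<^sub>R x) \<in> lebesgue \<rightarrow>\<^sub>M lebesgue" by simp
  then show ?thesis using A by (rule measurable_compose)
qed

lemma quadratic_form_eq:
  fixes A :: "real^'n^'n"
  shows "(A *v \<xi>) \<bullet> \<xi> = (\<Sum>i\<in>UNIV. \<Sum>j\<in>UNIV. A $ i $ j * \<xi> $ i * \<xi> $ j)"
  by (simp add: inner_vec_def matrix_vector_mult_def sum_distrib_left mult_ac)

text \<open>The lower ellipticity bound gives the inequality under the integral. The upper one makes
  the integrand integrable, so that its Bochner integral is not merely the default value 0.\<close>

lemma diffusion_coercive:
  fixes A :: "real^'n \<Rightarrow> real^'n^'n" and G :: "real^'n \<Rightarrow> real^'n"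
  assumes A: "A \<in> borel_measurable lebesgue"
    and ell: "AE y in lebesgue. \<forall>\<xi>. \<gamma>1 * (norm \<xi>)\<^sup>2 \<le> (\<Sum>i\<in>UNIV. \<Sum>j\<in>UNIV. A y $ i $ j * \<xi> $ i * \<xi> $ j) \<and>
           (\<Sum>i\<in>UNIV. \<Sum>j\<in>UNIV. A y $ i $ j * \<xi> $ i * \<xi> $ j) \<le> \<gamma>2 * (norm \<xi>)\<^sup>2"
    and "0 < \<gamma>1" "0 < \<epsilon>" and U: "open U" and G: "in_L2 (lebesgue_on U) G"
  shows "\<gamma>1 * (norm_L2 (lebesgue_on U) G)\<^sup>2 \<le> (\<integral>x. (A ((1 / \<epsilon>) *\<^sub>R x) *v G x) \<bullet> G x \<partial>lebesgue_on U)"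
proof -
  let ?q = "\<lambda>x. (A ((1 / \<epsilon>) *\<^sub>R x) *v G x) \<bullet> G x"
  have G2: "integrable (lebesgue_on U) (\<lambda>x. (norm (G x))\<^sup>2)" and Gm: "G \<in> borel_measurable (lebesgue_on U)"
    using G by (auto simp: in_L2_def)
  have "AE x in lebesgue. \<gamma>1 * (norm (G x))\<^sup>2 \<le> ?q x \<and> ?q x \<le> \<gamma>2 * (norm (G x))\<^sup>2"
  proof -
    have "1 / \<epsilon> \<noteq> 0" using \<open>0 < \<epsilon>\<close> by simp
    from AE_lebesgue_scale[OF ell this] show ?thesis
      by eventually_elim (simp only: quadratic_form_eq)
  qed
  then have ae: "AE x in lebesgue_on U. \<gamma>1 * (norm (G x))\<^sup>2 \<le> ?q x \<and> ?q x \<le> \<gamma>2 * (norm (G x))\<^sup>2"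
    using U by (subst AE_restrict_space_iff) auto
  have Am: "(\<lambda>x. A ((1 / \<epsilon>) *\<^sub>R x)) \<in> borel_measurable (lebesgue_on U)"
    using measurable_lebesgue_scale[OF A, of "1 / \<epsilon>"] \<open>0 < \<epsilon>\<close> by (intro measurable_restrict_space1) simp
  have [measurable]: "(\<lambda>x. A ((1 / \<epsilon>) *\<^sub>R x) $ i $ j) \<in> borel_measurable (lebesgue_on U)" for i j
    by (rule measurable_compose[OF Am]) (intro borel_measurable_continuous_onI continuous_intros)
  have [measurable]: "(\<lambda>x. G x $ i) \<in> borel_measurable (lebesgue_on U)" for i
    by (rule measurable_compose[OF Gm]) (intro borel_measurable_continuous_onI continuous_intros)
  have "?q \<in> borel_measurable (lebesgue_on U)"
    unfolding quadratic_form_eq by measurable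
  then have "integrable (lebesgue_on U) ?q"
  proof (rule Bochner_Integration.integrable_bound[OF integrable_mult_right[OF G2, of \<gamma>2]])
    show "AE x in lebesgue_on U. norm (?q x) \<le> norm (\<gamma>2 * (norm (G x))\<^sup>2)"
      using ae
    proof eventually_elim
      fix x assume *: "\<gamma>1 * (norm (G x))\<^sup>2 \<le> ?q x \<and> ?q x \<le> \<gamma>2 * (norm (G x))\<^sup>2"
      have "0 \<le> \<gamma>1 * (norm (G x))\<^sup>2" using \<open>0 < \<gamma>1\<close> by simp
      then show "norm (?q x) \<le> norm (\<gamma>2 * (norm (G x))\<^sup>2)" using * unfolding real_norm_def by linarith
    qed
  qed
  then have "(\<integral>x. \<gamma>1 * (norm (G x))\<^sup>2 \<partial>lebesgue_on U) \<le> (\<integral>x. ?q x \<partial>lebesgue_on U)"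
    using ae G2 by (intro integral_mono_AE integrable_mult_right) auto
  then show ?thesis by (simp add: norm_L2_def)
qed

text \<open>\<mu> is the coercivity constant of the scaled reaction. Young's inequality with weight
  \<mu> splits f u into f^2 / (2 \<mu>) and \<mu> u^2 / 2; half of the reaction term absorbs the
  second part and the other half stays on the left.\<close>

lemma energy_estimate:
  fixes A :: "real^'n \<Rightarrow> real^'n^'n" and U :: "(real^'n) set"
  assumes A: "A \<in> borel_measurable lebesgue"
    and ell: "AE y in lebesgue. \<forall>\<xi>. \<gamma>1 * (norm \<xi>)\<^sup>2 \<le> (\<Sum>i\<in>UNIV. \<Sum>j\<in>UNIV. A y $ i $ j * \<xi> $ i * \<xi> $ j) \<and>
           (\<Sum>i\<in>UNIV. \<Sum>j\<in>UNIV. A y $ i $ j * \<xi> $ i * \<xi> $ j) \<le> \<gamma>2 * (norm \<xi>)\<^sup>2"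
    and \<gamma>: "0 < \<gamma>1" and \<epsilon>: "0 < \<epsilon>" and U: "open U"
    and R: "continuous_on UNIV R" "0 < \<delta>" "\<And>s. \<delta> * s\<^sup>2 \<le> R s * s" "\<And>s. \<bar>R s\<bar> \<le> L * \<bar>s\<bar>"
    and f: "in_L2 (lebesgue_on U) f"
    and sol: "weak_solution U \<Gamma>ext A R f \<alpha> \<epsilon> u"
  defines "\<mu> \<equiv> \<epsilon> powr \<alpha> * \<delta>"
  shows "\<gamma>1 * (norm_L2 (lebesgue_on U) (weak_gradient U u))\<^sup>2 + \<mu> / 2 * (norm_L2 (lebesgue_on U) u)\<^sup>2
     \<le> (norm_L2 (lebesgue_on U) f)\<^sup>2 / (2 * \<mu>)"
proof -
  let ?M = "lebesgue_on U" and ?G = "weak_gradient U u"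
  have V: "u \<in> space_V U \<Gamma>ext" using sol by (simp add: weak_solution_def)
  then have u: "in_L2 ?M u" and ex: "\<exists>G. has_weak_gradient U u G" by (auto simp: space_V_def in_H1_def)
  have "has_weak_gradient U u ?G" unfolding weak_gradient_def using ex by (rule someI_ex)
  then have G: "in_L2 ?M ?G" by (simp add: has_weak_gradient_def)
  have eq: "(\<integral>x. (A ((1 / \<epsilon>) *\<^sub>R x) *v ?G x) \<bullet> ?G x \<partial>?M) + \<epsilon> powr \<alpha> * (\<integral>x. R (u x) * u x \<partial>?M) = (\<integral>x. f x * u x \<partial>?M)"
    using sol V by (auto simp: weak_solution_def)
  have um [measurable]: "u \<in> borel_measurable ?M" and u2: "integrable ?M (\<lambda>x. (u x)\<^sup>2)"
    and f2: "integrable ?M (\<lambda>x. (f x)\<^sup>2)" using u f by (auto simp: in_L2_def)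
  have nu: "(norm_L2 ?M u)\<^sup>2 = (\<integral>x. (u x)\<^sup>2 \<partial>?M)" and nf: "(norm_L2 ?M f)\<^sup>2 = (\<integral>x. (f x)\<^sup>2 \<partial>?M)"
    by (simp_all add: norm_L2_def)
  have "0 < \<mu>" using \<epsilon> R by (simp add: \<mu>_def)
  have "\<delta> * (norm_L2 ?M u)\<^sup>2 \<le> (\<integral>x. R (u x) * u x \<partial>?M)"
  proof -
    have "R \<in> borel_measurable borel" using R(1) by (rule borel_measurable_continuous_onI)
    then have [measurable]: "(\<lambda>x. R (u x)) \<in> borel_measurable ?M" using measurable_compose[OF um] by blast
    \<comment> \<open>Linear growth of \<open>R\<close> gives a majorant; integrability is required
      for comparing the integrals below.\<close>
    have "integrable ?M (\<lambda>x. R (u x) * u x)"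
    proof (rule Bochner_Integration.integrable_bound[OF integrable_mult_right[OF u2, of L]])
      show "AE x in ?M. norm (R (u x) * u x) \<le> norm (L * (u x)\<^sup>2)"
      proof (rule AE_I2)
        fix x
        have "\<bar>R (u x)\<bar> * \<bar>u x\<bar> \<le> (L * \<bar>u x\<bar>) * \<bar>u x\<bar>" using R(4) by (rule mult_right_mono) simp
        also have "\<dots> = L * (u x)\<^sup>2" by (simp add: power2_eq_square)
        finally show "norm (R (u x) * u x) \<le> norm (L * (u x)\<^sup>2)"
          unfolding real_norm_def abs_mult[of "R (u x)"] by linarith
      qed
    qed measurable
    then have "(\<integral>x. \<delta> * (u x)\<^sup>2 \<partial>?M) \<le> (\<integral>x. R (u x) * u x \<partial>?M)"
      using u2 R(3) by (intro integral_mono integrable_mult_right) auto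
    then show ?thesis by (simp add: nu)
  qed
  then have "\<mu> * (norm_L2 ?M u)\<^sup>2 \<le> \<epsilon> powr \<alpha> * (\<integral>x. R (u x) * u x \<partial>?M)"
    unfolding \<mu>_def mult.assoc by (rule mult_left_mono) simp
  moreover have "\<gamma>1 * (norm_L2 ?M ?G)\<^sup>2 \<le> (\<integral>x. (A ((1 / \<epsilon>) *\<^sub>R x) *v ?G x) \<bullet> ?G x \<partial>?M)"
    by (rule diffusion_coercive[OF A ell \<gamma> \<epsilon> U G])
  moreover have "(\<integral>x. f x * u x \<partial>?M) \<le> (norm_L2 ?M f)\<^sup>2 / (2 * \<mu>) + \<mu> / 2 * (norm_L2 ?M u)\<^sup>2"
  proof -
    have "(\<integral>x. f x * u x \<partial>?M) \<le> (\<integral>x. (1 / (2 * \<mu>)) * (f x)\<^sup>2 + \<mu> / 2 * (u x)\<^sup>2 \<partial>?M)"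
    proof (rule integral_mono')
      fix x
      have "0 \<le> (f x - \<mu> * u x)\<^sup>2 / (2 * \<mu>)" using \<open>0 < \<mu>\<close> by simp
      also have "\<dots> = (1 / (2 * \<mu>)) * (f x)\<^sup>2 + \<mu> / 2 * (u x)\<^sup>2 - f x * u x"
        using \<open>0 < \<mu>\<close> by (simp add: field_simps power2_eq_square)
      finally show "f x * u x \<le> (1 / (2 * \<mu>)) * (f x)\<^sup>2 + \<mu> / 2 * (u x)\<^sup>2" by simp
      show "0 \<le> (1 / (2 * \<mu>)) * (f x)\<^sup>2 + \<mu> / 2 * (u x)\<^sup>2" using \<open>0 < \<mu>\<close> by simp
    qed (intro Bochner_Integration.integrable_add integrable_mult_right f2 u2)
    also have "\<dots> = (1 / (2 * \<mu>)) * (\<integral>x. (f x)\<^sup>2 \<partial>?M) + \<mu> / 2 * (\<integral>x. (u x)\<^sup>2 \<partial>?M)"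
      using f2 u2 by simp
    finally show ?thesis by (simp add: nu nf)
  qed
  ultimately show ?thesis using eq by linarith
qed

section \<open>Combination of the estimates and choice of the constant\<close>

theorem theorem4p2:
  fixes \<Omega> Yl Ys :: "(real^'n) set"
    and A :: "real^'n \<Rightarrow> real^'n^'n"
    and R :: "real \<Rightarrow> real"
    and f :: "real^'n \<Rightarrow> real"
    and \<alpha> :: real
  assumes "open \<Omega>" and "bounded \<Omega>" and "connected \<Omega>" and "\<Omega> \<noteq> {}" and "lipschitz_boundary \<Omega>"
    and "unit_cell_decomposition Yl Ys"
    and "diffusion_matrix A"
    and "reaction_function R" and "R 0 = 0"
    and "smooth_on \<Omega> f"
    and "\<alpha> < 0"
  shows "\<exists>C. \<forall>\<epsilon> u.
    admissible_scale \<Omega> Yl Ys \<epsilon> \<longrightarrow>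
    in_L2 (lebesgue_on (liquid_part \<Omega> Yl \<epsilon>)) f \<longrightarrow>
    weak_solution (liquid_part \<Omega> Yl \<epsilon>) (frontier \<Omega>) A R f \<alpha> \<epsilon> u \<longrightarrow>
      norm_L2 (lebesgue_on (liquid_part \<Omega> Yl \<epsilon>)) u
        + sqrt \<epsilon> * norm_L2 (surface_on (internal_boundary \<Omega> Ys \<epsilon>))
            (boundary_trace (liquid_part \<Omega> Yl \<epsilon>) (internal_boundary \<Omega> Ys \<epsilon>) u)
      \<le> C * (\<epsilon> powr (- \<alpha> / 2) + \<epsilon>)"
proof -
  have "Ck_on 0 \<Omega> f" using \<open>smooth_on \<Omega> f\<close> unfolding smooth_on_def by blast
  then have "continuous_on \<Omega> f" by simp
  then obtain F where F: "0 \<le> F" "\<And>\<epsilon>. admissible_scale \<Omega> Yl Ys \<epsilon> \<Longrightarrow>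
      in_L2 (lebesgue_on (liquid_part \<Omega> Yl \<epsilon>)) f \<Longrightarrow> norm_L2 (lebesgue_on (liquid_part \<Omega> Yl \<epsilon>)) f \<le> F"
    using uniform_source_bound[OF \<open>bounded \<Omega>\<close> \<open>unit_cell_decomposition Yl Ys\<close>] by blast
  obtain K where K: "0 \<le> K" "\<And>\<epsilon> w. admissible_scale \<Omega> Yl Ys \<epsilon> \<Longrightarrow> smooth_on UNIV w \<Longrightarrow>
    (\<integral>\<^sup>+x. ennreal ((w x)\<^sup>2) \<partial>surface_on (internal_boundary \<Omega> Ys \<epsilon>))
      \<le> ennreal (K / \<epsilon>) * (\<integral>\<^sup>+x. ennreal ((w x)\<^sup>2 + \<epsilon>\<^sup>2 * (norm (grad w x))\<^sup>2) \<partial>lebesgue_on (liquid_part \<Omega> Yl \<epsilon>))"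
    using scaled_trace_inequality[OF \<open>unit_cell_decomposition Yl Ys\<close> \<open>bounded \<Omega>\<close> \<open>\<Omega> \<noteq> {}\<close>] by blast
  obtain \<gamma>1 \<gamma>2 where \<gamma>: "0 < \<gamma>1" and ell:
    "AE y in lebesgue. \<forall>\<xi>. \<gamma>1 * (norm \<xi>)\<^sup>2 \<le> (\<Sum>i\<in>UNIV. \<Sum>j\<in>UNIV. A y $ i $ j * \<xi> $ i * \<xi> $ j) \<and>
           (\<Sum>i\<in>UNIV. \<Sum>j\<in>UNIV. A y $ i $ j * \<xi> $ i * \<xi> $ j) \<le> \<gamma>2 * (norm \<xi>)\<^sup>2"
    using \<open>diffusion_matrix A\<close> unfolding diffusion_matrix_def by blast
  have A: "A \<in> borel_measurable lebesgue" using \<open>diffusion_matrix A\<close> by (simp add: diffusion_matrix_def)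
  obtain \<delta> L where R: "0 < \<delta>" "\<And>s. \<delta> * s\<^sup>2 \<le> R s * s" "\<And>s. \<bar>R s\<bar> \<le> L * \<bar>s\<bar>"
    using reaction_coercive[OF \<open>reaction_function R\<close> \<open>R 0 = 0\<close>] by blast
  have Rc: "continuous_on UNIV R" using \<open>reaction_function R\<close> by (simp add: reaction_function_def)
  \<comment> \<open>The squared norms of \<open>u\<close> and of its gradient will be at most p^2
    times the two summands, with p = \<epsilon> powr (-\<alpha> / 2).\<close>
  define D where "D = F\<^sup>2 / \<delta>\<^sup>2 + F\<^sup>2 / (2 * \<delta> * \<gamma>1)"
  have "0 \<le> D" using R \<gamma> by (simp add: D_def)
  show ?thesis
  proof (intro exI[of _ "F / \<delta> + sqrt (4 * K * D)"] allI impI)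
    fix \<epsilon> u
    let ?U = "liquid_part \<Omega> Yl \<epsilon>" and ?\<Gamma> = "internal_boundary \<Omega> Ys \<epsilon>"
    assume adm: "admissible_scale \<Omega> Yl Ys \<epsilon>" and f: "in_L2 (lebesgue_on ?U) f"
      and sol: "weak_solution ?U (frontier \<Omega>) A R f \<alpha> \<epsilon> u"
    have \<epsilon>: "0 < \<epsilon>" "\<epsilon> < 1" using adm by (auto simp: admissible_scale_def)
    have "open ?U" by (simp add: liquid_part_def)
    define n0 where "n0 = norm_L2 (lebesgue_on ?U) u"
    define n1 where "n1 = norm_L2 (lebesgue_on ?U) (weak_gradient ?U u)"
    \<comment> \<open>Since \<alpha> < 0 and \<epsilon> < 1, this quantity is at most 1, and the
      weight of the reaction is 1 / p^2.\<close>
    define p where "p = \<epsilon> powr (- \<alpha> / 2)"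
    have p: "0 < p" "p \<le> 1" using \<epsilon> \<open>\<alpha> < 0\<close> powr_mono2[of "- \<alpha> / 2" \<epsilon> 1] by (auto simp: p_def)
    have "p\<^sup>2 * \<epsilon> powr \<alpha> = 1"
      using \<epsilon> by (simp add: p_def power2_eq_square powr_add[symmetric])
    then have \<epsilon>\<alpha>: "\<epsilon> powr \<alpha> = 1 / p\<^sup>2" using p by (simp add: field_simps)
    have nonneg: "0 \<le> n0" by (simp add: n0_def norm_L2_nonneg)
    have "(norm_L2 (lebesgue_on ?U) f)\<^sup>2 \<le> F\<^sup>2"
      using F(2)[OF adm f] norm_L2_nonneg by (intro power_mono) auto
    then have "(norm_L2 (lebesgue_on ?U) f)\<^sup>2 / (2 * (\<epsilon> powr \<alpha> * \<delta>)) \<le> F\<^sup>2 / (2 * (\<epsilon> powr \<alpha> * \<delta>))"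
      using R by (intro divide_right_mono) auto
    then have "\<gamma>1 * n1\<^sup>2 + (\<epsilon> powr \<alpha> * \<delta>) / 2 * n0\<^sup>2 \<le> F\<^sup>2 / (2 * (\<epsilon> powr \<alpha> * \<delta>))"
      using energy_estimate[OF A ell \<gamma> \<epsilon>(1) \<open>open ?U\<close> Rc R f sol] unfolding n0_def n1_def by linarith
    then have energy: "\<gamma>1 * n1\<^sup>2 + \<delta> / (2 * p\<^sup>2) * n0\<^sup>2 \<le> F\<^sup>2 * p\<^sup>2 / (2 * \<delta>)"
      by (simp add: \<epsilon>\<alpha> mult_ac)
    have n1: "n1\<^sup>2 \<le> p\<^sup>2 * (F\<^sup>2 / (2 * \<delta> * \<gamma>1))"
    proof -
      have "0 \<le> \<delta> / (2 * p\<^sup>2) * n0\<^sup>2" using R by simp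
      then have "\<gamma>1 * n1\<^sup>2 \<le> F\<^sup>2 * p\<^sup>2 / (2 * \<delta>)" using energy by linarith
      then show ?thesis using \<gamma> R by (simp add: field_simps)
    qed
    have n0: "n0\<^sup>2 \<le> (F / \<delta> * p\<^sup>2)\<^sup>2"
    proof -
      have "0 \<le> \<gamma>1 * n1\<^sup>2" using \<gamma> by simp
      then have "\<delta> / (2 * p\<^sup>2) * n0\<^sup>2 \<le> F\<^sup>2 * p\<^sup>2 / (2 * \<delta>)" using energy by linarith
      then show ?thesis using p R by (simp add: field_simps power2_eq_square)
    qed
    \<comment> \<open>The norm of \<open>u\<close> in the volume is of the smaller order p^2. It is
      weakened to the order p, which the gradient bound imposes on the boundary term.\<close>
    have "p\<^sup>2 \<le> p" using p by (simp add: power2_eq_square mult_left_le)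
    have "n0 \<le> F / \<delta> * p\<^sup>2"
      using n0 F R by (intro power2_le_imp_le[OF n0]) auto
    also have "\<dots> \<le> F / \<delta> * p" using \<open>p\<^sup>2 \<le> p\<close> F R by (intro mult_left_mono) auto
    finally have bulk: "n0 \<le> F / \<delta> * p" .
    \<comment> \<open>The factor 1 / \<epsilon> in the trace constant is cancelled by the weight
      sqrt \<epsilon> of the boundary norm.\<close>
    interpret boundary_trace_setting ?U ?\<Gamma> "K / \<epsilon>" \<epsilon>
      using K \<epsilon> adm by unfold_locales auto
    have V: "u \<in> space_V ?U (frontier \<Omega>)" using sol by (simp add: weak_solution_def)
    have "norm_L2 (surface_on ?\<Gamma>) (boundary_trace ?U ?\<Gamma> u) \<le> sqrt (4 * (K / \<epsilon>) * (n0\<^sup>2 + \<epsilon>\<^sup>2 * n1\<^sup>2))"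
      using norm_boundary_trace_le[OF V] by (simp add: n0_def n1_def)
    then have "sqrt \<epsilon> * norm_L2 (surface_on ?\<Gamma>) (boundary_trace ?U ?\<Gamma> u)
        \<le> sqrt \<epsilon> * sqrt (4 * (K / \<epsilon>) * (n0\<^sup>2 + \<epsilon>\<^sup>2 * n1\<^sup>2))"
      using \<epsilon> by (intro mult_left_mono) auto
    also have "\<dots> = sqrt (4 * K * (n0\<^sup>2 + \<epsilon>\<^sup>2 * n1\<^sup>2))"
      using \<epsilon> by (simp add: real_sqrt_mult[symmetric])
    also have "\<dots> \<le> sqrt (4 * K * (p\<^sup>2 * D))"
    proof -
      have "n0\<^sup>2 \<le> p\<^sup>2 * (F\<^sup>2 / \<delta>\<^sup>2)"
        using power_mono[OF bulk nonneg, of 2] by (simp add: power_mult_distrib power_divide mult.commute)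
      moreover have "\<epsilon>\<^sup>2 * n1\<^sup>2 \<le> 1 * n1\<^sup>2"
        using \<epsilon> by (intro mult_right_mono) (auto simp: power_le_one)
      ultimately have "n0\<^sup>2 + \<epsilon>\<^sup>2 * n1\<^sup>2 \<le> p\<^sup>2 * D"
        using n1 unfolding D_def distrib_left by linarith
      then show ?thesis using K by (intro real_sqrt_le_mono mult_left_mono) auto
    qed
    also have "\<dots> = sqrt (4 * K * D) * p"
      using p by (simp add: real_sqrt_mult)
    finally have "n0 + sqrt \<epsilon> * norm_L2 (surface_on ?\<Gamma>) (boundary_trace ?U ?\<Gamma> u)
        \<le> (F / \<delta> + sqrt (4 * K * D)) * p"
      using bulk by (simp add: distrib_right)
    \<comment> \<open>The bound so far has the order p; adding \<epsilon> enlarges the right-hand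
      side to the form claimed.\<close>
    also have "\<dots> \<le> (F / \<delta> + sqrt (4 * K * D)) * (p + \<epsilon>)"
      using F R K \<open>0 \<le> D\<close> \<epsilon> by (intro mult_left_mono) auto
    finally show "norm_L2 (lebesgue_on ?U) u + sqrt \<epsilon> * norm_L2 (surface_on ?\<Gamma>) (boundary_trace ?U ?\<Gamma> u)
        \<le> (F / \<delta> + sqrt (4 * K * D)) * (\<epsilon> powr (- \<alpha> / 2) + \<epsilon>)"
      unfolding n0_def p_def .
  qed
qed

end
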